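(* Up to analytic isomorphism, the set of configuration spaces of cabled linkages is exactly the set of spaces of the form $X\times\mathbb R^{2k}$ where $X$ is a compact quasialgebraic set (and $k\ge 0$ is an integer). That is, the configuration space $\mathcal C(\mathcal L)$ of every cabled linkage $\mathcal L$ is analytically isomorphic to $X\times\mathbb R^{2k}$ for some compact quasialgebraic set $X$ and some integer $k\ge 0$, and conversely every such space $X\times\mathbb R^{2k}$ is analytically isomorphic to $\mathcal C(\mathcal L)$ for some cabled linkage $\mathcal L$.
   Context: A cabled linkage is a quintuple $\mathcal L=(L,\ell,V,\mu,F)$, where $L$ is a finite graph with vertex set $\mathcal V(L)$ and edge set $\mathcal E(L)$, $\ell$ assigns a positive real number $\ell(\overline{vw})$ to each edge $\overline{vw}$, $V\subset\mathcal V(L)$ is a subset (the fixed vertices), $\mu\colon V\to\mathbb C$ is a map (telling where they are fixed), and $F\subset\mathcal E(L)$ is a subset (the flexible edges). Its configuration space is the set $\mathcal C(\mathcal L)$ of all maps $\varphi\colon\mathcal V(L)\to\mathbb C$ such that $\varphi(v)=\mu(v)$ for $v\in V$, $|\varphi(v)-\varphi(w)|\le\ell(\overline{vw})$ if $\overline{vw}\in F$, and $|\varphi(v)-\varphi(w)|=\ell(\overline{vw})$ if $\overline{vw}\in\mathcal E(L)-F$. Viewing $\mathbb C$ as $\mathbb R^2$, $\mathcal C(\mathcal L)$ is a subset of $\mathbb C^{\mathcal V(L)}=\mathbb R^{2|\mathcal V(L)|}$. A quasialgebraic set is a subset of some $\mathbb R^n$ of the form $\{x\in\mathbb R^n\mid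 p_i(x)=0,\ i=1,\ldots,k,\ \text{and } q_j(x)\ge 0,\ j=1,\ldots,m\}$ for some real polynomials $p_i$ and $q_j$. For $X\subset\mathbb R^n$ and $Y\subset\mathbb R^m$, a homeomorphism $f\colon X\to Y$ is an analytic isomorphism if $f$ and $f^{-1}$ are both restrictions of analytic maps, i.e., maps locally given by power series. *)

theory Defs
  imports "HOL-Analysis.Analysis"
begin

(* The space R^I is powertop_real I, whose points are the extensional functions I -> R;
   the space R^n is powertop_real {..<n}. *)

definition multi_indices :: "'i set \<Rightarrow> ('i \<Rightarrow> nat) set" where
  "multi_indices I = {\<alpha>. \<forall>i. i \<notin> I \<longrightarrow> \<alpha> i = 0}"

definition monomial :: "'i set \<Rightarrow> ('i \<Rightarrow> nat) \<Rightarrow> ('i \<Rightarrow> real) \<Rightarrow> real" where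
  "monomial I \<alpha> x = (\<Prod>i\<in>I. x i ^ \<alpha> i)"

definition polynomial_on :: "'i set \<Rightarrow> (('i \<Rightarrow> real) \<Rightarrow> real) \<Rightarrow> bool" where
  "polynomial_on I p \<longleftrightarrow>
     (\<exists>A c. finite A \<and> A \<subseteq> multi_indices I \<and>
        (\<forall>x \<in> I \<rightarrow>\<^sub>E UNIV. p x = (\<Sum>\<alpha>\<in>A. c \<alpha> * monomial I \<alpha> x)))"

definition quasialgebraic :: "'i set \<Rightarrow> ('i \<Rightarrow> real) set \<Rightarrow> bool" where
  "quasialgebraic I X \<longleftrightarrow>
     (\<exists>P Q. finite P \<and> finite Q \<and> (\<forall>p \<in> P \<union> Q. polynomial_on I p) \<and>
        X = {x \<in> I \<rightarrow>\<^sub>E UNIV. (\<forall>p\<in>P. p x = 0) \<and> (\<forall>q\<in>Q. q x \<ge> 0)})"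

(* For real-valued families has_sum amounts to absolute convergence, so no ordering of the
   multi-indices has to be chosen. *)
definition analytic_at :: "'i set \<Rightarrow> (('i \<Rightarrow> real) \<Rightarrow> real) \<Rightarrow> ('i \<Rightarrow> real) \<Rightarrow> bool" where
  "analytic_at I f a \<longleftrightarrow>
     (\<exists>c. \<exists>r>0. \<forall>x \<in> I \<rightarrow>\<^sub>E UNIV. (\<forall>i\<in>I. \<bar>x i - a i\<bar> < r) \<longrightarrow>
        ((\<lambda>\<alpha>. c \<alpha> * monomial I \<alpha> (\<lambda>i. x i - a i)) has_sum f x) (multi_indices I))"

definition analytic_map ::
  "'i set \<Rightarrow> 'j set \<Rightarrow> ('i \<Rightarrow> real) set \<Rightarrow> (('i \<Rightarrow> real) \<Rightarrow> ('j \<Rightarrow> real)) \<Rightarrow> bool" where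
  "analytic_map I J U F \<longleftrightarrow>
     openin (powertop_real I) U \<and> F \<in> U \<rightarrow> (J \<rightarrow>\<^sub>E UNIV) \<and>
     (\<forall>a\<in>U. \<forall>j\<in>J. analytic_at I (\<lambda>x. F x j) a)"

(* The analytic map is defined on some open neighbourhood of X, not necessarily on all of R^I. *)
definition restriction_of_analytic ::
  "'i set \<Rightarrow> 'j set \<Rightarrow> ('i \<Rightarrow> real) set \<Rightarrow> (('i \<Rightarrow> real) \<Rightarrow> ('j \<Rightarrow> real)) \<Rightarrow> bool" where
  "restriction_of_analytic I J X f \<longleftrightarrow>
     (\<exists>U F. analytic_map I J U F \<and> X \<subseteq> U \<and> (\<forall>x\<in>X. f x = F x))"

definition analytically_isomorphic ::
  "'i set \<Rightarrow> ('i \<Rightarrow> real) set \<Rightarrow> 'j set \<Rightarrow> ('j \<Rightarrow> real) set \<Rightarrow> bool" where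
  "analytically_isomorphic I X J Y \<longleftrightarrow>
     (\<exists>f g. homeomorphic_maps
              (subtopology (powertop_real I) X) (subtopology (powertop_real J) Y) f g \<and>
            restriction_of_analytic I J X f \<and> restriction_of_analytic J I Y g)"

(* The product of X, a subset of R^n, with R^m, as a subset of R^(n+m). *)
definition times_Euclidean :: "nat \<Rightarrow> (nat \<Rightarrow> real) set \<Rightarrow> nat \<Rightarrow> (nat \<Rightarrow> real) set" where
  "times_Euclidean n X m = {z \<in> {..<n + m} \<rightarrow>\<^sub>E UNIV. restrict z {..<n} \<in> X}"

record 'v linkage =
  vertices :: "'v set"
  edges :: "'v set set"
  edge_length :: "'v set \<Rightarrow> real"
  fixed :: "'v set"
  position :: "'v \<Rightarrow> complex"
  flexible :: "'v set set"

definition cabled_linkage :: "'v linkage \<Rightarrow> bool" where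
  "cabled_linkage L \<longleftrightarrow>
     finite (vertices L) \<and>
     (\<forall>e \<in> edges L. e \<subseteq> vertices L \<and> card e = 2) \<and>
     (\<forall>e \<in> edges L. edge_length L e > 0) \<and>
     fixed L \<subseteq> vertices L \<and>
     flexible L \<subseteq> edges L"

definition configuration_space :: "'v linkage \<Rightarrow> ('v \<Rightarrow> complex) set" where
  "configuration_space L =
     {\<phi> \<in> vertices L \<rightarrow>\<^sub>E UNIV.
        (\<forall>v \<in> fixed L. \<phi> v = position L v) \<and>
        (\<forall>v w. {v, w} \<in> flexible L \<longrightarrow> cmod (\<phi> v - \<phi> w) \<le> edge_length L {v, w}) \<and>
        (\<forall>v w. {v, w} \<in> edges L - flexible L \<longrightarrow> cmod (\<phi> v - \<phi> w) = edge_length L {v, w})}"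

(* C^V viewed as R^(V <+> V): the left copy of V carries real parts, the right copy
   imaginary parts. *)
definition real_coords :: "'v set \<Rightarrow> ('v \<Rightarrow> complex) \<Rightarrow> ('v + 'v \<Rightarrow> real)" where
  "real_coords V \<phi> =
     restrict (case_sum (\<lambda>v. Re (\<phi> v)) (\<lambda>v. Im (\<phi> v))) (V <+> V)"

definition real_configuration_space :: "'v linkage \<Rightarrow> ('v + 'v \<Rightarrow> real) set" where
  "real_configuration_space L = real_coords (vertices L) ` configuration_space L"

end

theory Submission
  imports Defs
begin

text \<open>
  A linkage splits into connected components. A component with a fixed vertex has a bounded set of
  configurations; any other component moves freely by translations, and after subtracting the
  position of one chosen vertex its configurations are bounded too. Doing this in every component
  without fixed vertex exhibits the configuration space as \<open>X \<times> \<real>\<^sup>2\<^sup>k\<close>, where \<open>X\<close> is cut out by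
  the equations and inequalities for the squared lengths. All the maps involved are affine.

  For the converse, a compact set \<open>X \<subseteq> \<real>\<^sup>n\<close> is first shrunk by a small factor \<open>\<epsilon>\<close>; \<open>k\<close> isolated
  vertices account for \<open>\<real>\<^sup>2\<^sup>k\<close>. A linkage is grown one vertex at a time so that at every stage its
  configurations are exactly the values of an analytic map on the parameter space
  (\<open>parametrizes\<close>): every new vertex either is determined by the earlier ones, its position being
  an analytic function of them, or imposes a condition on the parameters. It does not matter which
  vertex carries which function, so one only records the set of functions that occur as
  positions of vertices (\<open>realizable\<close>).

  The construction rests on one mechanism, Peaucellier's inversor (\<open>inversor\<close>). Given moving
  points \<open>c\<close> and \<open>p\<close>, let \<open>a\<close> and \<open>b\<close> be the two points at distance \<open>r\<close> from \<open>c\<close> and \<open>l\<close> from \<open>p\<close>,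
  and let \<open>q = a + b - p\<close> be the fourth vertex of the rhombus on \<open>a, p, b\<close>. Then \<open>q\<close> is the inverse
  of \<open>p\<close> with respect to \<open>c\<close>, with power \<open>r\<^sup>2 - l\<^sup>2\<close>. Each of \<open>a\<close>, \<open>b\<close>, \<open>q\<close> is one of the two
  intersections of two circles. If all motions are small, the two intersections stay apart, and a
  cable to a fixed vertex selects the right one. This is why no spurious configurations appear
  and why all functions stay analytic.

  Inversion in a point of a circle takes the circle to a line, by stereographic projection; so from
  a vertex on a circle the inversor produces a vertex moving on the real axis. For \<open>c\<close> and \<open>p\<close> on the real axis the
  inversor realizes \<open>c + \<kappa> / (p - c)\<close>, with \<open>c\<close> itself allowed to vary. Applying it twice with the
  same centre gives \<open>c + \<lambda> (p - c)\<close>, whence midpoints, translations and sums; reciprocals then give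
  squares and products (\<open>arithmetic_gates\<close>). Thus a small multiple of every polynomial in the
  inputs is the position of a vertex on the real axis close to \<open>0\<close>. A cable of length \<open>1\<close> to the
  fixed point \<open>1\<close> forces this value to be nonnegative, and a second one to \<open>-1\<close> forces it to vanish.
  The resulting linkage is the graph of an analytic map over \<open>X \<times> \<real>\<^sup>2\<^sup>k\<close>; its inverse reads off
  coordinates of vertices.

  Analyticity of all these functions comes down to closure of convergent power series under sums
  and under composition with power series in one variable (\<open>analytic_at_compose\<close>), applied to
  squares, reciprocals and square roots.
\<close>

section \<open>Real-analytic functions of several variables\<close>

lemma monomial_add:
  "monomial I (\<lambda>i. \<alpha> i + \<beta> i) x = monomial I \<alpha> x * monomial I \<beta> x"
  by (simp add: monomial_def power_add prod.distrib)

lemma monomial_zero [simp]: "monomial I (\<lambda>_. 0) x = 1"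
  by (simp add: monomial_def)

lemma abs_monomial_le:
  assumes "\<And>i. i \<in> I \<Longrightarrow> \<bar>x i\<bar> \<le> s"
  shows "\<bar>monomial I \<alpha> x\<bar> \<le> monomial I \<alpha> (\<lambda>_. s)"
  unfolding monomial_def abs_prod
  by (intro prod_mono) (auto simp: power_abs assms power_mono)

lemma monomial_nonneg: "0 \<le> s \<Longrightarrow> 0 \<le> monomial I \<alpha> (\<lambda>_. s)"
  by (simp add: monomial_def prod_nonneg)

lemma monomial_at_zero:
  assumes "finite I" "\<alpha> \<in> multi_indices I - {\<lambda>_. 0}"
  shows "monomial I \<alpha> (\<lambda>_. 0) = 0"
proof -
  obtain i where "\<alpha> i \<noteq> 0" using assms by fastforce
  then have "i \<in> I" using assms by (auto simp: multi_indices_def)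
  then show ?thesis using \<open>\<alpha> i \<noteq> 0\<close> assms by (auto simp: monomial_def intro!: prod_zero)
qed

lemma monomial_terms_at_zero:
  assumes "finite I" "\<alpha> \<in> multi_indices I - {\<lambda>_. 0}"
  shows "c \<alpha> * monomial I \<alpha> (\<lambda>i. x i - x i) = 0"
  using monomial_at_zero[OF assms] by simp

lemma monomial_scale_le:
  assumes "finite I" "\<alpha> \<in> multi_indices I - {\<lambda>_. 0}" "0 \<le> \<theta>" "\<theta> \<le> 1" "0 \<le> s"
  shows "monomial I \<alpha> (\<lambda>_. \<theta> * s) \<le> \<theta> * monomial I \<alpha> (\<lambda>_. s)"
proof -
  obtain i where "\<alpha> i \<noteq> 0" using assms by fastforce
  then have i: "i \<in> I" using assms by (auto simp: multi_indices_def)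
  have "(\<Prod>j\<in>I. \<theta> ^ \<alpha> j) = \<theta> ^ \<alpha> i * (\<Prod>j\<in>I-{i}. \<theta> ^ \<alpha> j)"
    using i assms(1) by (simp add: prod.remove)
  also have "\<dots> \<le> \<theta> * 1"
  proof (intro mult_mono prod_le_1)
    show "\<theta> ^ \<alpha> i \<le> \<theta>"
      using power_decreasing[of 1 "\<alpha> i" \<theta>] \<open>\<alpha> i \<noteq> 0\<close> assms by simp
  qed (use assms in \<open>auto simp: power_le_one prod_nonneg\<close>)
  finally have "(\<Prod>j\<in>I. \<theta> ^ \<alpha> j) \<le> \<theta>" by simp
  then show ?thesis
    using assms by (simp add: monomial_def power_mult_distrib prod.distrib mult_right_mono prod_nonneg)
qed

lemma summable_on_compare:
  fixes f g :: "'t \<Rightarrow> real"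
  assumes "g summable_on T" "\<And>t. t \<in> T \<Longrightarrow> \<bar>f t\<bar> \<le> g t"
  shows "f summable_on T"
  by (rule summable_on_iff_abs_summable_on_real[THEN iffD2],
      rule Infinite_Sum.abs_summable_on_comparison_test'[OF assms(1)]) (simp add: assms(2))

lemma abs_summable_terms:
  fixes w :: "'t \<Rightarrow> real"
  assumes "(\<lambda>t. \<bar>w t\<bar> * monomial I (e t) (\<lambda>_. s)) summable_on T"
    and "\<And>i. i \<in> I \<Longrightarrow> \<bar>x i\<bar> \<le> s"
  shows "(\<lambda>t. w t * monomial I (e t) x) summable_on T"
proof (rule summable_on_compare)
  show "\<bar>w t * monomial I (e t) x\<bar> \<le> \<bar>w t\<bar> * monomial I (e t) (\<lambda>_. s)" for t
    by (simp add: abs_mult mult_left_mono abs_monomial_le assms(2))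
qed fact

text \<open>The sum may run over any family of monomial terms, with repeated exponents allowed: collecting
  the terms with equal exponent is legitimate by absolute convergence. So a composition needs no
  explicit coefficients.\<close>

lemma analytic_atI_family:
  fixes w :: "'t \<Rightarrow> real"
  assumes s: "s > 0" and e: "e \<in> T \<rightarrow> multi_indices I"
    and summ: "(\<lambda>t. \<bar>w t\<bar> * monomial I (e t) (\<lambda>_. s)) summable_on T"
    and f: "\<And>x. x \<in> I \<rightarrow>\<^sub>E UNIV \<Longrightarrow> (\<And>i. i \<in> I \<Longrightarrow> \<bar>x i - a i\<bar> \<le> s) \<Longrightarrow>
              ((\<lambda>t. w t * monomial I (e t) (\<lambda>i. x i - a i)) has_sum f x) T"
  shows "analytic_at I f a"
proof -
  let ?B = "\<lambda>\<gamma>. {t \<in> T. e t = \<gamma>}"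
  define c where "c \<gamma> = (\<Sum>\<^sub>\<infinity>t\<in>?B \<gamma>. w t)" for \<gamma>
  have bij: "bij_betw snd (Sigma (multi_indices I) ?B) T"
    by (rule bij_betwI[where g = "\<lambda>t. (e t, t)"]) (use e in auto)
  have "((\<lambda>\<gamma>. c \<gamma> * monomial I \<gamma> (\<lambda>i. x i - a i)) has_sum f x) (multi_indices I)"
    if x: "x \<in> I \<rightarrow>\<^sub>E UNIV" "\<forall>i\<in>I. \<bar>x i - a i\<bar> < s" for x
  proof (rule has_sum_SigmaD)
    have *: "((\<lambda>t. w t * monomial I (e t) (\<lambda>i. x i - a i)) has_sum f x) T"
      using f x by (simp add: less_imp_le)
    then show "((\<lambda>p. w (snd p) * monomial I (e (snd p)) (\<lambda>i. x i - a i)) has_sum f x)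
      (Sigma (multi_indices I) ?B)"
      by (subst has_sum_reindex_bij_betw[OF bij])
    fix \<gamma> assume "\<gamma> \<in> multi_indices I"
    have "(\<lambda>t. w t * monomial I (e t) (\<lambda>i. x i - a i)) summable_on ?B \<gamma>"
      using has_sum_imp_summable[OF *] by (rule summable_on_subset_banach) auto
    then have "((\<lambda>t. w t * monomial I (e t) (\<lambda>i. x i - a i)) has_sum
        (\<Sum>\<^sub>\<infinity>t\<in>?B \<gamma>. w t * monomial I (e t) (\<lambda>i. x i - a i))) (?B \<gamma>)"
      by (rule has_sum_infsum)
    also have "(\<Sum>\<^sub>\<infinity>t\<in>?B \<gamma>. w t * monomial I (e t) (\<lambda>i. x i - a i)) =
        (\<Sum>\<^sub>\<infinity>t\<in>?B \<gamma>. w t * monomial I \<gamma> (\<lambda>i. x i - a i))"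
      by (rule infsum_cong) auto
    also have "\<dots> = c \<gamma> * monomial I \<gamma> (\<lambda>i. x i - a i)"
      unfolding c_def by (rule infsum_cmult_left')
    finally show "((\<lambda>t. w (snd (\<gamma>, t)) * monomial I (e (snd (\<gamma>, t))) (\<lambda>i. x i - a i)) has_sum
        c \<gamma> * monomial I \<gamma> (\<lambda>i. x i - a i)) (?B \<gamma>)"
      by simp
  qed
  then show ?thesis unfolding analytic_at_def using s by blast
qed

lemma analytic_atE:
  assumes "analytic_at I f a"
  obtains r c where "r > 0"
    "\<And>x. x \<in> I \<rightarrow>\<^sub>E UNIV \<Longrightarrow> \<forall>i\<in>I. \<bar>x i - a i\<bar> < r \<Longrightarrow>
       ((\<lambda>\<alpha>. c \<alpha> * monomial I \<alpha> (\<lambda>i. x i - a i)) has_sum f x) (multi_indices I)"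
  using assms unfolding analytic_at_def by blast

text \<open>Without constant term, shrinking the radius by a factor \<open>\<theta> \<le> 1\<close> shrinks the majorant by at least
  \<open>\<theta>\<close>. A small majorant \<open>M\<close> serves twice: for continuity, and for substituting into a power series
  with a prescribed radius of convergence.\<close>

lemma analytic_at_expansion:
  assumes fin: "finite I" and an: "analytic_at I f a" and a: "a \<in> I \<rightarrow>\<^sub>E UNIV"
    and "\<epsilon> > 0"
  obtains s M c where "s > 0" "0 \<le> M" "M < \<epsilon>"
    "((\<lambda>\<alpha>. \<bar>c \<alpha>\<bar> * monomial I \<alpha> (\<lambda>_. s)) has_sum M) (multi_indices I - {\<lambda>_. 0})"
    "\<And>x. x \<in> I \<rightarrow>\<^sub>E UNIV \<Longrightarrow> \<forall>i\<in>I. \<bar>x i - a i\<bar> \<le> s \<Longrightarrow>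
       ((\<lambda>\<alpha>. c \<alpha> * monomial I \<alpha> (\<lambda>i. x i - a i)) has_sum (f x - f a)) (multi_indices I - {\<lambda>_. 0})"
proof -
  let ?J = "multi_indices I - {\<lambda>_. 0 :: nat}"
  obtain r c where r: "r > 0" and c: "\<And>x. x \<in> I \<rightarrow>\<^sub>E UNIV \<Longrightarrow> \<forall>i\<in>I. \<bar>x i - a i\<bar> < r \<Longrightarrow>
        ((\<lambda>\<alpha>. c \<alpha> * monomial I \<alpha> (\<lambda>i. x i - a i)) has_sum f x) (multi_indices I)"
    by (rule analytic_atE[OF an]) (rule that)
  have z: "(\<lambda>_. 0) \<in> multi_indices I" by (simp add: multi_indices_def)
  have split: "((\<lambda>\<alpha>. c \<alpha> * monomial I \<alpha> (\<lambda>i. x i - a i)) has_sum (f x - c (\<lambda>_. 0))) ?J"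
    if "x \<in> I \<rightarrow>\<^sub>E UNIV" "\<forall>i\<in>I. \<bar>x i - a i\<bar> < r" for x
    using has_sum_Diff[OF c[OF that], of "{\<lambda>_. 0}" "c (\<lambda>_. 0)"] z
    by (simp add: has_sum_finiteI)
  have "((\<lambda>\<alpha>. 0) has_sum (f a - c (\<lambda>_. 0))) ?J"
    using split[OF a] r by (subst has_sum_cong[OF monomial_terms_at_zero[symmetric]]) (auto simp: fin)
  then have fa: "c (\<lambda>_. 0) = f a"
    using has_sum_0[of ?J "\<lambda>_. 0"] has_sum_unique by fastforce
  \<comment> \<open>Convergence at the corner of a smaller cube is absolute convergence of the majorant series.\<close>
  define y where "y = (\<lambda>i\<in>I. a i + r/2)"
  have "(\<lambda>\<alpha>. c \<alpha> * monomial I \<alpha> (\<lambda>i. y i - a i)) summable_on ?J"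
    by (rule has_sum_imp_summable, rule split) (use r in \<open>auto simp: y_def\<close>)
  also have "?this \<longleftrightarrow> (\<lambda>\<alpha>. c \<alpha> * monomial I \<alpha> (\<lambda>_. r/2)) summable_on ?J"
    by (intro summable_on_cong) (auto simp: monomial_def y_def)
  finally have "(\<lambda>\<alpha>. c \<alpha> * monomial I \<alpha> (\<lambda>_. r/2)) summable_on ?J" .
  from summable_on_iff_abs_summable_on_real[THEN iffD1, OF this] have summ: "(\<lambda>\<alpha>. \<bar>c \<alpha>\<bar> * monomial I \<alpha> (\<lambda>_. r/2)) summable_on ?J"
    using r by (simp add: abs_mult monomial_nonneg)
  define K where "K = (\<Sum>\<^sub>\<infinity>\<alpha>\<in>?J. \<bar>c \<alpha>\<bar> * monomial I \<alpha> (\<lambda>_. r/2))"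
  have K: "K \<ge> 0" unfolding K_def using r by (intro infsum_nonneg) (simp add: monomial_nonneg)
  define \<theta> where "\<theta> = min 1 (\<epsilon> / (2 * (K + 1)))"
  have \<theta>: "0 < \<theta>" "\<theta> \<le> 1" using \<open>\<epsilon> > 0\<close> K by (auto simp: \<theta>_def)
  have "\<theta> * K \<le> \<epsilon> / (2 * (K + 1)) * K"
    using K by (intro mult_right_mono) (auto simp: \<theta>_def)
  also have "\<dots> < \<epsilon>" using K \<open>\<epsilon> > 0\<close> by (simp add: field_simps add_strict_increasing2)
  finally have \<theta>K: "\<theta> * K < \<epsilon>" .
  let ?s = "\<theta> * (r/2)"
  have le: "\<bar>c \<alpha>\<bar> * monomial I \<alpha> (\<lambda>_. ?s) \<le> \<theta> * (\<bar>c \<alpha>\<bar> * monomial I \<alpha> (\<lambda>_. r/2))" if "\<alpha> \<in> ?J" for \<alpha>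
    using mult_left_mono[OF monomial_scale_le[OF fin that, of \<theta> "r/2"], of "\<bar>c \<alpha>\<bar>"] \<theta> r
    by (simp add: algebra_simps)
  have summ': "(\<lambda>\<alpha>. \<bar>c \<alpha>\<bar> * monomial I \<alpha> (\<lambda>_. ?s)) summable_on ?J"
    by (rule summable_on_compare[OF summable_on_cmult_right[OF summ, of \<theta>]])
      (use le \<theta> r in \<open>auto simp: abs_mult monomial_nonneg\<close>)
  show thesis
  proof (rule that[of ?s "\<Sum>\<^sub>\<infinity>\<alpha>\<in>?J. \<bar>c \<alpha>\<bar> * monomial I \<alpha> (\<lambda>_. ?s)" c])
    show "0 < ?s" using \<theta> r by simp
    show "0 \<le> (\<Sum>\<^sub>\<infinity>\<alpha>\<in>?J. \<bar>c \<alpha>\<bar> * monomial I \<alpha> (\<lambda>_. ?s))"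
      using \<theta> r by (intro infsum_nonneg) (simp add: monomial_nonneg)
    have "(\<Sum>\<^sub>\<infinity>\<alpha>\<in>?J. \<bar>c \<alpha>\<bar> * monomial I \<alpha> (\<lambda>_. ?s)) \<le> (\<Sum>\<^sub>\<infinity>\<alpha>\<in>?J. \<theta> * (\<bar>c \<alpha>\<bar> * monomial I \<alpha> (\<lambda>_. r/2)))"
      by (intro infsum_mono summ' summable_on_cmult_right summ le)
    also have "\<dots> = \<theta> * K" unfolding K_def by (rule infsum_cmult_right')
    finally show "(\<Sum>\<^sub>\<infinity>\<alpha>\<in>?J. \<bar>c \<alpha>\<bar> * monomial I \<alpha> (\<lambda>_. ?s)) < \<epsilon>" using \<theta>K by simp
    show "((\<lambda>\<alpha>. \<bar>c \<alpha>\<bar> * monomial I \<alpha> (\<lambda>_. ?s)) has_sum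
        (\<Sum>\<^sub>\<infinity>\<alpha>\<in>?J. \<bar>c \<alpha>\<bar> * monomial I \<alpha> (\<lambda>_. ?s))) ?J"
      using summ' by (rule has_sum_infsum)
    fix x :: "'a \<Rightarrow> real" assume x: "x \<in> I \<rightarrow>\<^sub>E UNIV" "\<forall>i\<in>I. \<bar>x i - a i\<bar> \<le> ?s"
    have "?s < r" using mult_right_mono[OF \<theta>(2), of "r/2"] r by simp
    then show "((\<lambda>\<alpha>. c \<alpha> * monomial I \<alpha> (\<lambda>i. x i - a i)) has_sum (f x - f a)) ?J"
      using split[OF x(1)] x(2) fa by fastforce
  qed
qed

lemma analytic_at_const: "analytic_at I (\<lambda>_. b) a"
proof (rule analytic_atI_family[where T = "{()}" and s = 1 and w = "\<lambda>_. b" and e = "\<lambda>_ _. 0"])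
qed (auto simp: multi_indices_def intro: has_sum_finiteI)

lemma analytic_at_coord:
  assumes "finite I" "j \<in> I"
  shows "analytic_at I (\<lambda>x. x j) a"
proof (rule analytic_atI_family[where T = UNIV and s = 1 and w = "\<lambda>b. if b then 1 else a j"
      and e = "\<lambda>b i. if b \<and> i = j then 1 else 0"])
  fix x :: "'a \<Rightarrow> real"
  have "monomial I (\<lambda>i. if i = j then 1 else 0) (\<lambda>i. x i - a i) = x j - a j"
    using assms by (simp add: monomial_def if_distrib[of "\<lambda>n. _ ^ n"] prod.delta cong: if_cong)
  then show "((\<lambda>b. (if b then 1 else a j) * monomial I (\<lambda>i. if b \<and> i = j then 1 else 0) (\<lambda>i. x i - a i))
      has_sum x j) UNIV"
    using has_sum_finite[of UNIV "\<lambda>b. (if b then 1 else a j) *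
      monomial I (\<lambda>i. if b \<and> i = j then 1 else 0) (\<lambda>i. x i - a i)"]
    by (simp add: UNIV_bool)
qed (use assms in \<open>auto simp: multi_indices_def\<close>)

lemma analytic_at_add:
  assumes "analytic_at I f a" "analytic_at I g a"
  shows "analytic_at I (\<lambda>x. f x + g x) a"
proof -
  obtain r c where r: "r > 0" and c: "\<And>x. x \<in> I \<rightarrow>\<^sub>E UNIV \<Longrightarrow> \<forall>i\<in>I. \<bar>x i - a i\<bar> < r \<Longrightarrow>
        ((\<lambda>\<alpha>. c \<alpha> * monomial I \<alpha> (\<lambda>i. x i - a i)) has_sum f x) (multi_indices I)"
    by (rule analytic_atE[OF assms(1)]) (rule that)
  obtain t d where t: "t > 0" and d: "\<And>x. x \<in> I \<rightarrow>\<^sub>E UNIV \<Longrightarrow> \<forall>i\<in>I. \<bar>x i - a i\<bar> < t \<Longrightarrow>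
        ((\<lambda>\<alpha>. d \<alpha> * monomial I \<alpha> (\<lambda>i. x i - a i)) has_sum g x) (multi_indices I)"
    by (rule analytic_atE[OF assms(2)]) (rule that)
  show ?thesis unfolding analytic_at_def
  proof (intro exI conjI ballI impI)
    show "min r t > 0" using r t by simp
    fix x assume x: "x \<in> I \<rightarrow>\<^sub>E (UNIV :: real set)" "\<forall>i\<in>I. \<bar>x i - a i\<bar> < min r t"
    have "((\<lambda>\<alpha>. c \<alpha> * monomial I \<alpha> (\<lambda>i. x i - a i)) has_sum f x) (multi_indices I)"
      "((\<lambda>\<alpha>. d \<alpha> * monomial I \<alpha> (\<lambda>i. x i - a i)) has_sum g x) (multi_indices I)"
      using x by (auto intro!: c d)
    from has_sum_add[OF this]
    show "((\<lambda>\<alpha>. (c \<alpha> + d \<alpha>) * monomial I \<alpha> (\<lambda>i. x i - a i)) has_sum f x + g x) (multi_indices I)"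
      by (simp only: distrib_right)
  qed
qed

lemma analytic_at_cmult:
  assumes "analytic_at I f a"
  shows "analytic_at I (\<lambda>x. b * f x) a"
proof -
  obtain r c where r: "r > 0" and c: "\<And>x. x \<in> I \<rightarrow>\<^sub>E UNIV \<Longrightarrow> \<forall>i\<in>I. \<bar>x i - a i\<bar> < r \<Longrightarrow>
        ((\<lambda>\<alpha>. c \<alpha> * monomial I \<alpha> (\<lambda>i. x i - a i)) has_sum f x) (multi_indices I)"
    by (rule analytic_atE[OF assms(1)]) (rule that)
  then have "((\<lambda>\<alpha>. (b * c \<alpha>) * monomial I \<alpha> (\<lambda>i. x i - a i)) has_sum b * f x) (multi_indices I)"
    if "x \<in> I \<rightarrow>\<^sub>E UNIV" "\<forall>i\<in>I. \<bar>x i - a i\<bar> < r" for x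
    using has_sum_cmult_right[OF c[OF that], of b] by (simp only: mult.assoc)
  with r show ?thesis unfolding analytic_at_def
    by (intro exI[of _ "\<lambda>\<alpha>. b * c \<alpha>"] exI[of _ r]) blast
qed

lemma analytic_at_diff:
  assumes "analytic_at I f a" "analytic_at I g a"
  shows "analytic_at I (\<lambda>x. f x - g x) a"
  using analytic_at_add[OF assms(1) analytic_at_cmult[OF assms(2), of "-1"]] by simp

lemma abs_has_sum_le:
  fixes f g :: "'t \<Rightarrow> real"
  assumes "(g has_sum G) T" "(f has_sum F) T" "\<And>t. t \<in> T \<Longrightarrow> \<bar>f t\<bar> \<le> g t"
  shows "\<bar>F\<bar> \<le> G"
proof -
  have "F \<le> G" by (rule has_sum_mono[OF assms(2,1)]) (use assms(3) in fastforce)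
  moreover have "((\<lambda>t. - f t) has_sum - F) T"
    using assms(2) by (simp add: has_sum_uminus)
  then have "- F \<le> G" by (rule has_sum_mono[OF _ assms(1)]) (use assms(3) in fastforce)
  ultimately show ?thesis by simp
qed

text \<open>The \<open>k\<close>-th power of a sum, expanded as a sum over words of length \<open>k\<close>.\<close>

lemma has_sum_power_lists:
  fixes g :: "'t \<Rightarrow> real"
  assumes "(g has_sum S) T"
  shows "((\<lambda>ts. prod_list (map g ts)) has_sum S ^ k) {ts \<in> lists T. length ts = k}"
proof (induction k)
  case 0
  have "{ts \<in> lists T. length ts = 0} = {[]}" by auto
  then show ?case
    using has_sum_finite[of "{[]}" "\<lambda>ts. prod_list (map g ts)"] by simp
next
  case (Suc k)
  let ?A = "{ts \<in> lists T. length ts = k}"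
  have bij: "bij_betw (\<lambda>(t, ts). t # ts) (T \<times> ?A) {ts \<in> lists T. length ts = Suc k}"
    by (rule bij_betwI[where g = "\<lambda>ts. (hd ts, tl ts)"]) (auto simp: length_Suc_conv)
  have "(\<lambda>t. \<bar>g t\<bar>) summable_on T" "(\<lambda>ts. \<bar>prod_list (map g ts)\<bar>) summable_on ?A"
    using summable_on_iff_abs_summable_on_real[THEN iffD1, OF has_sum_imp_summable[OF assms]]
      summable_on_iff_abs_summable_on_real[THEN iffD1, OF has_sum_imp_summable[OF Suc]] by simp_all
  then obtain G H where G: "((\<lambda>t. \<bar>g t\<bar>) has_sum G) T"
    and H: "((\<lambda>ts. \<bar>prod_list (map g ts)\<bar>) has_sum H) ?A"
    by (auto simp: summable_on_def)
  have "(\<lambda>(t, ts). \<bar>g t\<bar> * \<bar>prod_list (map g ts)\<bar>) summable_on T \<times> ?A"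
    by (rule summable_on_SigmaI[where g = "\<lambda>t. \<bar>g t\<bar> * H"])
       (use G H in \<open>auto intro: has_sum_cmult_right summable_on_cmult_left has_sum_imp_summable\<close>)
  then have summ: "(\<lambda>(t, ts). g t * prod_list (map g ts)) summable_on T \<times> ?A"
    by (rule summable_on_compare) (auto simp: abs_mult)
  have "((\<lambda>(t, ts). g t * prod_list (map g ts)) has_sum S * S ^ k) (T \<times> ?A)"
    by (rule has_sum_SigmaI[where g = "\<lambda>t. g t * S ^ k"])
       (use assms Suc summ in \<open>auto intro: has_sum_cmult_right has_sum_cmult_left\<close>)
  moreover have "(\<lambda>(t, ts). g t * prod_list (map g ts)) =
      (\<lambda>p. prod_list (map g ((\<lambda>(t, ts). t # ts) p)))"
    by auto
  ultimately have "((\<lambda>p. prod_list (map g ((\<lambda>(t, ts). t # ts) p))) has_sum S * S ^ k) (T \<times> ?A)"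
    by (simp only:)
  from has_sum_reindex_bij_betw[OF bij, THEN iffD1, OF this] show ?case
    by (simp only: power_Suc)
qed

lemma monomial_sum_list:
  "prod_list (map (\<lambda>\<alpha>. monomial I \<alpha> x) ts) = monomial I (\<lambda>i. \<Sum>\<alpha>\<leftarrow>ts. \<alpha> i) x"
  by (induction ts) (simp_all add: monomial_add)

lemma prod_list_mult:
  "prod_list (map (\<lambda>t. f t * g t) ts) = prod_list (map f ts) * prod_list (map g ts)"
  for f g :: "'t \<Rightarrow> real"
  by (induction ts) simp_all

text \<open>Expanding every power of \<open>f x - f a\<close> over words of multi-indices turns \<open>h (f x)\<close> into one sum over
  all finite words. It converges absolutely because the majorant of \<open>f x - f a\<close> has been made
  smaller than the radius of convergence \<open>\<rho>\<close>.\<close>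

lemma analytic_at_compose:
  assumes fin: "finite I" and an: "analytic_at I f a" and a: "a \<in> I \<rightarrow>\<^sub>E UNIV"
    and "\<rho> > 0" and h: "\<And>v. \<bar>v\<bar> < \<rho> \<Longrightarrow> (\<lambda>k. b k * v ^ k) sums h (f a + v)"
  shows "analytic_at I (\<lambda>x. h (f x)) a"
proof -
  let ?J = "multi_indices I - {\<lambda>_. 0 :: nat}"
  obtain s M c where s: "s > 0" and M: "0 \<le> M" "M < \<rho>"
    and major: "((\<lambda>\<alpha>. \<bar>c \<alpha>\<bar> * monomial I \<alpha> (\<lambda>_. s)) has_sum M) ?J"
    and f: "\<And>x. x \<in> I \<rightarrow>\<^sub>E UNIV \<Longrightarrow> \<forall>i\<in>I. \<bar>x i - a i\<bar> \<le> s \<Longrightarrow>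
       ((\<lambda>\<alpha>. c \<alpha> * monomial I \<alpha> (\<lambda>i. x i - a i)) has_sum (f x - f a)) ?J"
    by (rule analytic_at_expansion[OF fin an a \<open>\<rho> > 0\<close>]) (rule that)
  define w where "w ts = b (length ts) * prod_list (map c ts)" for ts
  define e :: "('a \<Rightarrow> nat) list \<Rightarrow> 'a \<Rightarrow> nat" where "e ts = (\<lambda>i. \<Sum>\<alpha>\<leftarrow>ts. \<alpha> i)" for ts
  let ?L = "\<lambda>k. {ts \<in> lists ?J. length ts = k}"
  have term_eq: "w ts * monomial I (e ts) x =
      b (length ts) * prod_list (map (\<lambda>\<alpha>. c \<alpha> * monomial I \<alpha> x) ts)" for ts x
    by (simp add: w_def e_def prod_list_mult monomial_sum_list mult.assoc)
  have abs_term_eq: "\<bar>w ts\<bar> * monomial I (e ts) (\<lambda>_. s) =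
      \<bar>b (length ts)\<bar> * prod_list (map (\<lambda>\<alpha>. \<bar>c \<alpha>\<bar> * monomial I \<alpha> (\<lambda>_. s)) ts)" for ts
  proof -
    have "\<bar>prod_list (map c ts)\<bar> = prod_list (map (\<lambda>\<alpha>. \<bar>c \<alpha>\<bar>) ts)"
      by (induction ts) (simp_all add: abs_mult)
    then show ?thesis by (simp add: w_def e_def abs_mult prod_list_mult monomial_sum_list mult.assoc)
  qed
  have bij: "bij_betw snd (Sigma UNIV ?L) (lists ?J)"
    by (rule bij_betwI[where g = "\<lambda>ts. (length ts, ts)"]) auto
  have major_power: "((\<lambda>ts. \<bar>w ts\<bar> * monomial I (e ts) (\<lambda>_. s)) has_sum \<bar>b k\<bar> * M ^ k) (?L k)" for k
  proof -
    have "((\<lambda>ts. \<bar>b k\<bar> * prod_list (map (\<lambda>\<alpha>. \<bar>c \<alpha>\<bar> * monomial I \<alpha> (\<lambda>_. s)) ts))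
        has_sum \<bar>b k\<bar> * M ^ k) (?L k)"
      by (rule has_sum_cmult_right[OF has_sum_power_lists[OF major]])
    then show ?thesis
      by (rule has_sum_cong[THEN iffD1, rotated]) (auto simp: abs_term_eq)
  qed
  have abs_b: "summable (\<lambda>k. \<bar>b k\<bar> * \<bar>v\<bar> ^ k)" if v: "\<bar>v\<bar> < \<rho>" for v
  proof -
    obtain r where r: "\<bar>v\<bar> < r" "r < \<rho>" using v dense by blast
    have "summable (\<lambda>k. b k * r ^ k)" using h[of r] r by (auto simp: sums_iff)
    then have "summable (\<lambda>k. norm (b k * v ^ k))" by (rule powser_insidea) (use r in auto)
    then show ?thesis by (simp add: abs_mult power_abs)
  qed
  have "(\<lambda>k. \<bar>b k\<bar> * M ^ k) summable_on UNIV"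
    using abs_b[of M] M by (intro norm_summable_imp_summable_on) (simp add: abs_mult power_abs)
  then have "(\<lambda>p. \<bar>w (snd p)\<bar> * monomial I (e (snd p)) (\<lambda>_. s)) summable_on Sigma UNIV ?L"
    using major_power s
    by (intro summable_on_SigmaI[where g = "\<lambda>k. \<bar>b k\<bar> * M ^ k"]) (auto simp: monomial_nonneg)
  then have summ: "(\<lambda>ts. \<bar>w ts\<bar> * monomial I (e ts) (\<lambda>_. s)) summable_on lists ?J"
    by (subst (asm) summable_on_reindex_bij_betw[OF bij])
  show ?thesis
  proof (rule analytic_atI_family[OF s _ summ])
    show "e \<in> lists ?J \<rightarrow> multi_indices I"
    proof
      fix ts assume "ts \<in> lists ?J"
      then show "e ts \<in> multi_indices I"
        unfolding e_def multi_indices_def by (induction ts) auto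
    qed
    fix x assume x: "x \<in> I \<rightarrow>\<^sub>E UNIV" "\<And>i. i \<in> I \<Longrightarrow> \<bar>x i - a i\<bar> \<le> s"
    define v where "v = f x - f a"
    have fv: "((\<lambda>\<alpha>. c \<alpha> * monomial I \<alpha> (\<lambda>i. x i - a i)) has_sum v) ?J"
      unfolding v_def using f x by blast
    have "\<bar>v\<bar> \<le> M"
    proof (rule abs_has_sum_le[OF major fv])
      fix \<alpha> show "\<bar>c \<alpha> * monomial I \<alpha> (\<lambda>i. x i - a i)\<bar> \<le> \<bar>c \<alpha>\<bar> * monomial I \<alpha> (\<lambda>_. s)"
        using abs_monomial_le[of I "\<lambda>i. x i - a i" s \<alpha>] x(2) by (simp add: abs_mult mult_left_mono)
    qed
    then have v: "\<bar>v\<bar> < \<rho>" using M by simp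
    have "((\<lambda>p. w (snd p) * monomial I (e (snd p)) (\<lambda>i. x i - a i)) has_sum h (f a + v)) (Sigma UNIV ?L)"
    proof (rule has_sum_SigmaI)
      fix k
      have "((\<lambda>ts. b k * prod_list (map (\<lambda>\<alpha>. c \<alpha> * monomial I \<alpha> (\<lambda>i. x i - a i)) ts))
          has_sum b k * v ^ k) (?L k)"
        by (rule has_sum_cmult_right[OF has_sum_power_lists[OF fv]])
      then show "((\<lambda>ts. w (snd (k, ts)) * monomial I (e (snd (k, ts))) (\<lambda>i. x i - a i))
          has_sum b k * v ^ k) (?L k)"
        by (rule has_sum_cong[THEN iffD1, rotated]) (auto simp: term_eq)
    next
      show "((\<lambda>k. b k * v ^ k) has_sum h (f a + v)) UNIV"
        using norm_summable_imp_has_sum[OF _ h[OF v]] abs_b[OF v] by (simp add: abs_mult power_abs)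
    next
      show "(\<lambda>p. w (snd p) * monomial I (e (snd p)) (\<lambda>i. x i - a i)) summable_on Sigma UNIV ?L"
        by (subst summable_on_reindex_bij_betw[OF bij]) (rule abs_summable_terms[OF summ x(2)])
    qed
    then have "((\<lambda>ts. w ts * monomial I (e ts) (\<lambda>i. x i - a i)) has_sum h (f a + v)) (lists ?J)"
      by (subst (asm) has_sum_reindex_bij_betw[OF bij])
    then show "((\<lambda>ts. w ts * monomial I (e ts) (\<lambda>i. x i - a i)) has_sum h (f x)) (lists ?J)"
      by (simp add: v_def)
  qed
qed

lemma analytic_at_square:
  assumes "finite I" "analytic_at I f a" "a \<in> I \<rightarrow>\<^sub>E UNIV"
  shows "analytic_at I (\<lambda>x. (f x)\<^sup>2) a"
proof (rule analytic_at_compose[OF assms, where \<rho> = 1 and h = "\<lambda>u. u\<^sup>2"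
      and b = "\<lambda>k. if k = 0 then (f a)\<^sup>2 else if k = 1 then 2 * f a else if k = 2 then 1 else 0"])
  fix v :: real
  let ?t = "\<lambda>k::nat. (if k = 0 then (f a)\<^sup>2 else if k = 1 then 2 * f a else if k = 2 then 1 else 0) * v ^ k"
  have "?t sums (\<Sum>k\<in>{0, 1, 2}. ?t k)"
    by (rule sums_finite) simp_all
  also have "(\<Sum>k\<in>{0, 1, 2}. ?t k) = (f a + v)\<^sup>2"
    by (simp add: power2_sum)
  finally show "?t sums (f a + v)\<^sup>2" .
qed simp

text \<open>Polarization reduces products to squares, that is to \<open>analytic_at_compose\<close>.\<close>

lemma analytic_at_mult:
  assumes "finite I" "a \<in> I \<rightarrow>\<^sub>E UNIV" "analytic_at I f a" "analytic_at I g a"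
  shows "analytic_at I (\<lambda>x. f x * g x) a"
proof -
  have "analytic_at I (\<lambda>x. 1/2 * ((f x + g x)\<^sup>2 + (-1) * (f x)\<^sup>2 + (-1) * (g x)\<^sup>2)) a"
    using assms by (intro analytic_at_cmult analytic_at_add analytic_at_square) auto
  then show ?thesis by (simp add: power2_eq_square algebra_simps)
qed

lemma analytic_at_inverse:
  assumes "finite I" "analytic_at I f a" "a \<in> I \<rightarrow>\<^sub>E UNIV" "f a \<noteq> 0"
  shows "analytic_at I (\<lambda>x. inverse (f x)) a"
proof (rule analytic_at_compose[OF assms(1-3), where \<rho> = "\<bar>f a\<bar>" and h = inverse and b = "\<lambda>k. inverse (f a) * (- inverse (f a)) ^ k"])
  fix v assume v: "\<bar>v\<bar> < \<bar>f a\<bar>"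
  have "(\<lambda>k. (- v / f a) ^ k) sums (1 / (1 - (- v / f a)))"
    by (rule geometric_sums) (use v in simp)
  then have "(\<lambda>k. inverse (f a) * (- v / f a) ^ k) sums (inverse (f a) * (1 / (1 - (- v / f a))))"
    by (rule sums_mult)
  moreover have "inverse (f a) * (1 / (1 - (- v / f a))) = inverse (f a + v)"
    using v assms(4) by (simp add: field_simps)
  moreover have "(\<lambda>k. inverse (f a) * (- v / f a) ^ k) =
      (\<lambda>k. inverse (f a) * (- inverse (f a)) ^ k * v ^ k)"
  proof
    fix k
    have "- v / f a = - inverse (f a) * v" by (simp add: field_simps)
    then show "inverse (f a) * (- v / f a) ^ k = inverse (f a) * (- inverse (f a)) ^ k * v ^ k"
      by (simp only: power_mult_distrib mult.assoc)
  qed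
  ultimately show "(\<lambda>k. inverse (f a) * (- inverse (f a)) ^ k * v ^ k) sums inverse (f a + v)"
    by (simp only:)
qed (use assms in auto)

lemma analytic_at_sqrt:
  assumes "finite I" "analytic_at I f a" "a \<in> I \<rightarrow>\<^sub>E UNIV" "f a > 0"
  shows "analytic_at I (\<lambda>x. sqrt (f x)) a"
proof (rule analytic_at_compose[OF assms(1-3), where \<rho> = "f a" and h = sqrt
      and b = "\<lambda>k. sqrt (f a) * ((1/2) gchoose k) * inverse (f a) ^ k"])
  fix v assume v: "\<bar>v\<bar> < f a"
  have "(\<lambda>k. ((1/2) gchoose k) * (v / f a) ^ k) sums ((1 + v / f a) powr (1/2))"
    by (rule gen_binomial_real) (use v in simp)
  then have "(\<lambda>k. sqrt (f a) * (((1/2) gchoose k) * (v / f a) ^ k)) sums (sqrt (f a) * (1 + v / f a) powr (1/2))"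
    by (rule sums_mult)
  moreover have "sqrt (f a) * (1 + v / f a) powr (1/2) = sqrt (f a + v)"
  proof -
    have "0 \<le> 1 + v / f a" using v assms(4) by (simp add: field_simps)
    then have "sqrt (f a) * (1 + v / f a) powr (1/2) = sqrt (f a * (1 + v / f a))"
      by (simp add: powr_half_sqrt real_sqrt_mult)
    also have "f a * (1 + v / f a) = f a + v" using assms(4) by (simp add: field_simps)
    finally show ?thesis .
  qed
  moreover have "(\<lambda>k. sqrt (f a) * (((1/2) gchoose k) * (v / f a) ^ k)) =
      (\<lambda>k. sqrt (f a) * ((1/2) gchoose k) * inverse (f a) ^ k * v ^ k)"
  proof
    fix k
    have "v / f a = inverse (f a) * v" by (simp add: field_simps)
    then show "sqrt (f a) * (((1/2) gchoose k) * (v / f a) ^ k) =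
      sqrt (f a) * ((1/2) gchoose k) * inverse (f a) ^ k * v ^ k"
      by (simp only: power_mult_distrib mult.assoc)
  qed
  ultimately show "(\<lambda>k. sqrt (f a) * ((1/2) gchoose k) * inverse (f a) ^ k * v ^ k) sums sqrt (f a + v)"
    by (simp only:)
qed (use assms in auto)

lemma openin_box:
  assumes "finite I"
  shows "openin (powertop_real I) {x \<in> I \<rightarrow>\<^sub>E UNIV. \<forall>i\<in>I. \<bar>x i - a i\<bar> < d}"
proof -
  have "{x \<in> I \<rightarrow>\<^sub>E UNIV. \<forall>i\<in>I. \<bar>x i - a i\<bar> < d} = (\<Pi>\<^sub>E i\<in>I. {a i - d <..< a i + d})"
  proof (intro set_eqI)
    fix x
    have "\<bar>x i - a i\<bar> < d \<longleftrightarrow> x i \<in> {a i - d <..< a i + d}" for i by auto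
    then show "x \<in> {x \<in> I \<rightarrow>\<^sub>E UNIV. \<forall>i\<in>I. \<bar>x i - a i\<bar> < d} \<longleftrightarrow> x \<in> (\<Pi>\<^sub>E i\<in>I. {a i - d <..< a i + d})"
      by (simp only: mem_Collect_eq PiE_iff) blast
  qed
  then show ?thesis using assms by (auto simp: openin_PiE_gen)
qed

lemma open_contains_box:
  assumes "finite I" "openin (powertop_real I) U" "a \<in> U"
  obtains r where "r > 0" "\<And>x. x \<in> I \<rightarrow>\<^sub>E UNIV \<Longrightarrow> \<forall>i\<in>I. \<bar>x i - a i\<bar> < r \<Longrightarrow> x \<in> U"
proof -
  obtain W where W: "\<forall>i\<in>I. open (W i)" "a \<in> Pi\<^sub>E I W" "Pi\<^sub>E I W \<subseteq> U"
    using assms(2,3) unfolding openin_product_topology_alt by auto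
  have "\<exists>e>0. \<forall>y. \<bar>y - a i\<bar> < e \<longrightarrow> y \<in> W i" if "i \<in> I" for i
  proof -
    have "open (W i)" "a i \<in> W i" using W that by auto
    then show ?thesis unfolding open_dist dist_real_def by blast
  qed
  then obtain e where e: "\<And>i. i \<in> I \<Longrightarrow> e i > 0 \<and> (\<forall>y. \<bar>y - a i\<bar> < e i \<longrightarrow> y \<in> W i)"
    by metis
  let ?r = "Min (insert 1 (e ` I))"
  show thesis
  proof
    show "?r > 0" using assms(1) e by simp
    fix x :: "'a \<Rightarrow> real" assume x: "x \<in> I \<rightarrow>\<^sub>E UNIV" "\<forall>i\<in>I. \<bar>x i - a i\<bar> < ?r"
    have "x i \<in> W i" if "i \<in> I" for i
    proof -
      have "?r \<le> e i" using assms(1) that by simp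
      then show ?thesis using e[OF that] x(2) that by fastforce
    qed
    then show "x \<in> U" using x(1) W(3) by blast
  qed
qed

lemma analytic_at_cong:
  assumes I: "finite I" and U: "openin (powertop_real I) U" "a \<in> U"
    and f: "analytic_at I f a" and eq: "\<And>x. x \<in> U \<Longrightarrow> f x = g x"
  shows "analytic_at I g a"
proof (rule open_contains_box[OF I U])
  fix t assume t: "t > 0" "\<And>x. x \<in> I \<rightarrow>\<^sub>E UNIV \<Longrightarrow> \<forall>i\<in>I. \<bar>x i - a i\<bar> < t \<Longrightarrow> x \<in> U"
  show ?thesis
  proof (rule analytic_atE[OF f])
    fix r c
    assume r: "r > 0" and c: "\<And>x. x \<in> I \<rightarrow>\<^sub>E UNIV \<Longrightarrow> \<forall>i\<in>I. \<bar>x i - a i\<bar> < r \<Longrightarrow>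
       ((\<lambda>\<alpha>. c \<alpha> * monomial I \<alpha> (\<lambda>i. x i - a i)) has_sum f x) (multi_indices I)"
    show ?thesis unfolding analytic_at_def
    proof (intro exI conjI ballI impI)
      show "min r t > 0" using r t by simp
      fix x assume x: "x \<in> I \<rightarrow>\<^sub>E (UNIV :: real set)" "\<forall>i\<in>I. \<bar>x i - a i\<bar> < min r t"
      have "f x = g x" using x by (intro eq t(2)) auto
      moreover have "((\<lambda>\<alpha>. c \<alpha> * monomial I \<alpha> (\<lambda>i. x i - a i)) has_sum f x) (multi_indices I)"
        using x by (intro c) auto
      ultimately show "((\<lambda>\<alpha>. c \<alpha> * monomial I \<alpha> (\<lambda>i. x i - a i)) has_sum g x) (multi_indices I)"
        by (simp only:)
    qed
  qed
qed

text \<open>The oscillation of \<open>F\<close> on a small cube is at most the majorant of its expansion without constant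
  term.\<close>

lemma restriction_of_analytic_continuous:
  assumes fin: "finite I" and "restriction_of_analytic I J X f"
  shows "continuous_map (subtopology (powertop_real I) X) (powertop_real J) f"
proof -
  obtain U F where UF: "analytic_map I J U F" and XU: "X \<subseteq> U" and fF: "\<forall>x\<in>X. f x = F x"
    using assms(2) unfolding restriction_of_analytic_def by blast
  have U: "openin (powertop_real I) U" and F: "F \<in> U \<rightarrow> (J \<rightarrow>\<^sub>E UNIV)"
    and an: "\<And>a j. a \<in> U \<Longrightarrow> j \<in> J \<Longrightarrow> analytic_at I (\<lambda>x. F x j) a"
    using UF unfolding analytic_map_def by auto
  have Usub: "U \<subseteq> I \<rightarrow>\<^sub>E UNIV" using openin_subset[OF U] by simp
  have "continuous_map (subtopology (powertop_real I) U) euclideanreal (\<lambda>x. F x j)" if j: "j \<in> J" for j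
  proof -
    have "openin (powertop_real I) {x \<in> U. F x j \<in> V}" if "open V" for V
    proof (subst openin_subopen, intro ballI)
      fix a assume "a \<in> {x \<in> U. F x j \<in> V}"
      then have a: "a \<in> U" "F a j \<in> V" and a': "a \<in> I \<rightarrow>\<^sub>E UNIV" using Usub by auto
      obtain \<epsilon> where "\<epsilon> > 0" and \<epsilon>: "\<And>y. \<bar>y - F a j\<bar> < \<epsilon> \<Longrightarrow> y \<in> V"
        using \<open>open V\<close> a(2) unfolding open_dist dist_real_def by blast
      obtain s M c where s: "s > 0" and M: "0 \<le> M" "M < \<epsilon>"
        and major: "((\<lambda>\<alpha>. \<bar>c \<alpha>\<bar> * monomial I \<alpha> (\<lambda>_. s)) has_sum M) (multi_indices I - {\<lambda>_. 0})"
        and f: "\<And>x. x \<in> I \<rightarrow>\<^sub>E UNIV \<Longrightarrow> \<forall>i\<in>I. \<bar>x i - a i\<bar> \<le> s \<Longrightarrow>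
           ((\<lambda>\<alpha>. c \<alpha> * monomial I \<alpha> (\<lambda>i. x i - a i)) has_sum (F x j - F a j)) (multi_indices I - {\<lambda>_. 0})"
        by (rule analytic_at_expansion[OF fin an[OF a(1) j] a' \<open>\<epsilon> > 0\<close>]) (rule that)
      have near: "F x j \<in> V" if "x \<in> I \<rightarrow>\<^sub>E UNIV" "\<forall>i\<in>I. \<bar>x i - a i\<bar> < s" for x
      proof -
        have x: "\<forall>i\<in>I. \<bar>x i - a i\<bar> \<le> s" using that by (simp add: less_imp_le)
        have "\<bar>F x j - F a j\<bar> \<le> M"
        proof (rule abs_has_sum_le[OF major f[OF that(1) x]])
          fix \<alpha> show "\<bar>c \<alpha> * monomial I \<alpha> (\<lambda>i. x i - a i)\<bar> \<le> \<bar>c \<alpha>\<bar> * monomial I \<alpha> (\<lambda>_. s)"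
            using abs_monomial_le[of I "\<lambda>i. x i - a i" s \<alpha>] x by (simp add: abs_mult mult_left_mono)
        qed
        then show ?thesis using M \<epsilon> by simp
      qed
      let ?B = "{x \<in> I \<rightarrow>\<^sub>E UNIV. \<forall>i\<in>I. \<bar>x i - a i\<bar> < s}"
      show "\<exists>T. openin (powertop_real I) T \<and> a \<in> T \<and> T \<subseteq> {x \<in> U. F x j \<in> V}"
      proof (intro exI conjI)
        show "openin (powertop_real I) (U \<inter> ?B)" by (intro openin_Int U openin_box fin)
        show "a \<in> U \<inter> ?B" using a a' s by simp
        show "U \<inter> ?B \<subseteq> {x \<in> U. F x j \<in> V}" using near by blast
      qed
    qed
    moreover have "topspace (subtopology (powertop_real I) U) = U" using Usub by auto
    ultimately show ?thesis
      by (simp add: continuous_map_def openin_open_subtopology[OF U])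
  qed
  then have "continuous_map (subtopology (powertop_real I) U) (powertop_real J) F"
    using F Usub by (auto simp: continuous_map_componentwise PiE_iff extensional_def)
  then have "continuous_map (subtopology (powertop_real I) X) (powertop_real J) F"
    using XU by (rule continuous_map_from_subtopology_mono)
  then show ?thesis
    by (rule continuous_map_eq) (use fF in auto)
qed

lemma analytically_isomorphicI:
  assumes "finite I" "finite J" "X \<subseteq> I \<rightarrow>\<^sub>E UNIV" "Y \<subseteq> J \<rightarrow>\<^sub>E UNIV"
    and "restriction_of_analytic I J X f" "restriction_of_analytic J I Y g"
    and "\<And>x. x \<in> X \<Longrightarrow> f x \<in> Y \<and> g (f x) = x" "\<And>y. y \<in> Y \<Longrightarrow> g y \<in> X \<and> f (g y) = y"
  shows "analytically_isomorphic I X J Y"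
proof -
  have "homeomorphic_maps (subtopology (powertop_real I) X) (subtopology (powertop_real J) Y) f g"
    unfolding homeomorphic_maps_def continuous_map_in_subtopology
    using assms by (auto intro: restriction_of_analytic_continuous)
  then show ?thesis unfolding analytically_isomorphic_def using assms by blast
qed

section \<open>Polynomials and quasialgebraic sets\<close>

lemma polynomial_on_monomial:
  assumes "\<alpha> \<in> multi_indices I"
  shows "polynomial_on I (monomial I \<alpha>)"
  unfolding polynomial_on_def by (intro exI[of _ "{\<alpha>}"] exI[of _ "\<lambda>_. 1"]) (simp add: assms)

lemma polynomial_on_cmult:
  assumes "polynomial_on I p"
  shows "polynomial_on I (\<lambda>x. a * p x)"
proof -
  obtain A c where A: "finite A" "A \<subseteq> multi_indices I"
    "\<forall>x \<in> I \<rightarrow>\<^sub>E UNIV. p x = (\<Sum>\<alpha>\<in>A. c \<alpha> * monomial I \<alpha> x)"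
    using assms unfolding polynomial_on_def by blast
  show ?thesis unfolding polynomial_on_def
    by (intro exI[of _ A] exI[of _ "\<lambda>\<alpha>. a * c \<alpha>"]) (simp add: A sum_distrib_left mult.assoc)
qed

lemma polynomial_on_add:
  assumes "polynomial_on I p" "polynomial_on I q"
  shows "polynomial_on I (\<lambda>x. p x + q x)"
proof -
  obtain A c where A: "finite A" "A \<subseteq> multi_indices I"
    "\<forall>x \<in> I \<rightarrow>\<^sub>E UNIV. p x = (\<Sum>\<alpha>\<in>A. c \<alpha> * monomial I \<alpha> x)"
    using assms(1) unfolding polynomial_on_def by blast
  obtain B d where B: "finite B" "B \<subseteq> multi_indices I"
    "\<forall>x \<in> I \<rightarrow>\<^sub>E UNIV. q x = (\<Sum>\<alpha>\<in>B. d \<alpha> * monomial I \<alpha> x)"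
    using assms(2) unfolding polynomial_on_def by blast
  let ?e = "\<lambda>\<alpha>. (if \<alpha> \<in> A then c \<alpha> else 0) + (if \<alpha> \<in> B then d \<alpha> else 0)"
  have ext: "(\<Sum>\<alpha>\<in>S. w \<alpha> * monomial I \<alpha> x) = (\<Sum>\<alpha>\<in>A \<union> B. (if \<alpha> \<in> S then w \<alpha> else 0) * monomial I \<alpha> x)"
    if "S \<subseteq> A \<union> B" for S w x
    by (rule sum.mono_neutral_cong_left) (use that A B in auto)
  have "p x + q x = (\<Sum>\<alpha>\<in>A \<union> B. ?e \<alpha> * monomial I \<alpha> x)" if "x \<in> I \<rightarrow>\<^sub>E UNIV" for x
    using A(3) B(3) that ext[of A c x] ext[of B d x]
    by (simp only: distrib_right sum.distrib) auto
  then show ?thesis unfolding polynomial_on_def using A B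
    by (intro exI[of _ "A \<union> B"] exI[of _ ?e]) blast
qed

lemma polynomial_on_const: "polynomial_on I (\<lambda>_. a)"
  using polynomial_on_cmult[OF polynomial_on_monomial[of "\<lambda>_. 0" I], of a]
  by (simp add: multi_indices_def)

lemma polynomial_on_coord:
  assumes "finite I" "i \<in> I"
  shows "polynomial_on I (\<lambda>x. x i)"
proof -
  let ?\<alpha> = "\<lambda>j. if j = i then 1 else 0 :: nat"
  have "monomial I ?\<alpha> = (\<lambda>x. x i)"
    using assms by (simp add: fun_eq_iff monomial_def if_distrib[of "\<lambda>n. _ ^ n"] prod.delta cong: if_cong)
  moreover have "?\<alpha> \<in> multi_indices I" using assms by (auto simp: multi_indices_def)
  ultimately show ?thesis using polynomial_on_monomial by metis
qed

lemma polynomial_on_sum: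
  "(\<And>j. j \<in> J \<Longrightarrow> polynomial_on I (f j)) \<Longrightarrow> polynomial_on I (\<lambda>x. \<Sum>j\<in>J. f j x)"
proof (induction J rule: infinite_finite_induct)
  case (insert j J) then show ?case by (simp add: polynomial_on_add)
qed (simp_all add: polynomial_on_const)

lemma polynomial_on_cong:
  assumes "polynomial_on I p" "\<And>x. x \<in> I \<rightarrow>\<^sub>E UNIV \<Longrightarrow> p x = q x"
  shows "polynomial_on I q"
  using assms unfolding polynomial_on_def by simp

lemma polynomial_on_mult:
  assumes "polynomial_on I p" "polynomial_on I q"
  shows "polynomial_on I (\<lambda>x. p x * q x)"
proof -
  obtain A c where A: "finite A" "A \<subseteq> multi_indices I"
    "\<forall>x \<in> I \<rightarrow>\<^sub>E UNIV. p x = (\<Sum>\<alpha>\<in>A. c \<alpha> * monomial I \<alpha> x)"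
    using assms(1) unfolding polynomial_on_def by blast
  obtain B d where B: "finite B" "B \<subseteq> multi_indices I"
    "\<forall>x \<in> I \<rightarrow>\<^sub>E UNIV. q x = (\<Sum>\<beta>\<in>B. d \<beta> * monomial I \<beta> x)"
    using assms(2) unfolding polynomial_on_def by blast
  have "polynomial_on I (\<lambda>x. \<Sum>\<alpha>\<in>A. \<Sum>\<beta>\<in>B. (c \<alpha> * d \<beta>) * monomial I (\<lambda>i. \<alpha> i + \<beta> i) x)"
    using A(2) B(2) by (intro polynomial_on_sum polynomial_on_cmult polynomial_on_monomial)
      (force simp: multi_indices_def subset_iff)
  then show ?thesis
    by (rule polynomial_on_cong)
       (simp add: A B sum_product monomial_add mult_ac)
qed

lemma polynomial_on_diff:
  assumes "polynomial_on I p" "polynomial_on I q"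
  shows "polynomial_on I (\<lambda>x. p x - q x)"
  using polynomial_on_add[OF assms(1) polynomial_on_cmult[OF assms(2), of "-1"]] by simp

lemma polynomial_on_continuous:
  assumes "finite I" "polynomial_on I p"
  shows "continuous_map (powertop_real I) euclideanreal p"
proof -
  obtain A c where A: "finite A"
    "\<forall>x \<in> I \<rightarrow>\<^sub>E UNIV. p x = (\<Sum>\<alpha>\<in>A. c \<alpha> * monomial I \<alpha> x)"
    using assms(2) unfolding polynomial_on_def by blast
  have "continuous_map (powertop_real I) euclideanreal (\<lambda>x. \<Sum>\<alpha>\<in>A. c \<alpha> * monomial I \<alpha> x)"
    unfolding monomial_def
    by (intro continuous_map_sum continuous_map_real_mult continuous_map_prod continuous_map_real_pow
        continuous_map_product_projection A(1) assms(1)) auto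
  then show ?thesis by (rule continuous_map_eq) (use A(2) in simp)
qed

lemma quasialgebraic_closedin:
  assumes "finite I" "quasialgebraic I X"
  shows "closedin (powertop_real I) X"
proof -
  let ?T = "powertop_real I"
  obtain P Q where PQ: "\<forall>p\<in>P \<union> Q. polynomial_on I p"
    and X: "X = {x \<in> I \<rightarrow>\<^sub>E UNIV. (\<forall>p\<in>P. p x = 0) \<and> (\<forall>q\<in>Q. q x \<ge> 0)}"
    using assms(2) unfolding quasialgebraic_def by blast
  have pre: "closedin ?T {x \<in> topspace ?T. p x \<in> C}" if "p \<in> P \<union> Q" "closed C" for p C
    using PQ that polynomial_on_continuous[OF assms(1)]
    by (intro closedin_continuous_map_preimage[of _ euclideanreal]) auto
  let ?\<C> = "insert (topspace ?T) ((\<lambda>p. {x \<in> topspace ?T. p x \<in> {0}}) ` P \<union>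
      (\<lambda>q. {x \<in> topspace ?T. q x \<in> {0..}}) ` Q)"
  have "closedin ?T (\<Inter>?\<C>)"
    using pre[of _ "{0}"] pre[of _ "{0..}"] closedin_topspace[of ?T]
    by (intro closedin_Inter) (simp, elim insertE UnE imageE, simp_all)
  also have "\<Inter>?\<C> = X" unfolding X Inter_insert Inter_Un_distrib by auto
  finally show ?thesis .
qed

lemma quasialgebraic_bounded_compactin:
  assumes "finite I" "quasialgebraic I X" "\<And>i x. i \<in> I \<Longrightarrow> x \<in> X \<Longrightarrow> \<bar>x i\<bar> \<le> B i"
  shows "compactin (powertop_real I) X"
proof (rule closed_compactin)
  show "compactin (powertop_real I) (\<Pi>\<^sub>E i\<in>I. {- B i..B i})"
    by (simp add: compactin_PiE)
  have ext: "X \<subseteq> I \<rightarrow>\<^sub>E UNIV" using assms(2) unfolding quasialgebraic_def by blast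
  show "X \<subseteq> (\<Pi>\<^sub>E i\<in>I. {- B i..B i})"
  proof
    fix x assume x: "x \<in> X"
    have "x i \<in> {- B i..B i}" if "i \<in> I" for i
      using assms(3)[OF that x] by (simp add: abs_le_iff)
    then show "x \<in> (\<Pi>\<^sub>E i\<in>I. {- B i..B i})"
      using ext x by (auto simp: PiE_iff)
  qed
  show "closedin (powertop_real I) X" by (rule quasialgebraic_closedin[OF assms(1,2)])
qed

section \<open>Linkages whose configurations are parametrized analytically\<close>

definition plane_analytic :: "'i set \<Rightarrow> ('i \<Rightarrow> real) set \<Rightarrow> (('i \<Rightarrow> real) \<Rightarrow> complex) \<Rightarrow> bool" where
  "plane_analytic I U h \<longleftrightarrow>
     (\<forall>a\<in>U. analytic_at I (\<lambda>x. Re (h x)) a \<and> analytic_at I (\<lambda>x. Im (h x)) a)"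

lemma plane_analytic_const: "plane_analytic I U (\<lambda>_. c)"
  by (simp add: plane_analytic_def analytic_at_const)

lemma plane_analytic_add:
  assumes "plane_analytic I U f" "plane_analytic I U g"
  shows "plane_analytic I U (\<lambda>x. f x + g x)"
  using assms unfolding plane_analytic_def by (auto intro: analytic_at_add)

lemma plane_analytic_diff:
  assumes "plane_analytic I U f" "plane_analytic I U g"
  shows "plane_analytic I U (\<lambda>x. f x - g x)"
  using assms unfolding plane_analytic_def by (auto intro: analytic_at_diff)

lemma plane_analytic_mult:
  assumes "finite I" "U \<subseteq> I \<rightarrow>\<^sub>E UNIV" "plane_analytic I U f" "plane_analytic I U g"
  shows "plane_analytic I U (\<lambda>x. f x * g x)"
  unfolding plane_analytic_def
proof
  fix a assume a: "a \<in> U"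
  then have "analytic_at I (\<lambda>x. Re (f x)) a" "analytic_at I (\<lambda>x. Im (f x)) a"
    "analytic_at I (\<lambda>x. Re (g x)) a" "analytic_at I (\<lambda>x. Im (g x)) a" "a \<in> I \<rightarrow>\<^sub>E UNIV"
    using assms unfolding plane_analytic_def by blast+
  then show "analytic_at I (\<lambda>x. Re (f x * g x)) a \<and> analytic_at I (\<lambda>x. Im (f x * g x)) a"
    unfolding times_complex.sel
    by (intro conjI analytic_at_add analytic_at_diff analytic_at_mult assms(1))
qed

text \<open>The parametrization \<open>G\<close> is stored vertex by vertex. Injectivity is left to the end,
  where it comes from vertices that show the parameters.\<close>

definition parametrizes ::
  "'i set \<Rightarrow> ('i \<Rightarrow> real) set \<Rightarrow> ('i \<Rightarrow> real) set \<Rightarrow> 'v linkage \<Rightarrow> ('v \<Rightarrow> ('i \<Rightarrow> real) \<Rightarrow> complex) \<Rightarrow> bool"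
  where
  "parametrizes I U Y L G \<longleftrightarrow>
     cabled_linkage L \<and> configuration_space L = (\<lambda>y. \<lambda>v\<in>vertices L. G v y) ` Y \<and>
     (\<forall>v\<in>vertices L. plane_analytic I U (G v))"

text \<open>The new vertex \<open>w\<close> is joined to the vertices in \<open>S\<close>, by cables to those in \<open>T\<close>; it is fixed at \<open>p\<close> if
  \<open>c = Some p\<close>. An edge at \<open>w\<close> is \<open>{w, s}\<close>, so that removing \<open>w\<close> recovers \<open>s\<close> and thus its length.\<close>

definition add_vertex ::
  "'v linkage \<Rightarrow> 'v \<Rightarrow> complex option \<Rightarrow> 'v set \<Rightarrow> ('v \<Rightarrow> real) \<Rightarrow> 'v set \<Rightarrow> 'v linkage" where
  "add_vertex L w c S len T =
     \<lparr>vertices = insert w (vertices L),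
      edges = edges L \<union> (\<lambda>s. {w, s}) ` S,
      edge_length = (\<lambda>e. if w \<in> e then len (the_elem (e - {w})) else edge_length L e),
      fixed = (if c = None then fixed L else insert w (fixed L)),
      position = (case c of None \<Rightarrow> position L | Some p \<Rightarrow> (position L)(w := p)),
      flexible = flexible L \<union> (\<lambda>s. {w, s}) ` T\<rparr>"

text \<open>The conditions that \<open>add_vertex\<close> puts on the position \<open>z\<close> of the new vertex.\<close>

definition admissible :: "complex option \<Rightarrow> 'v set \<Rightarrow> ('v \<Rightarrow> real) \<Rightarrow> 'v set \<Rightarrow> ('v \<Rightarrow> complex) \<Rightarrow> complex \<Rightarrow> bool"
  where
  "admissible c S len T \<phi> z \<longleftrightarrow>
     (\<forall>p. c = Some p \<longrightarrow> z = p) \<and> (\<forall>s\<in>T. cmod (z - \<phi> s) \<le> len s) \<and>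
     (\<forall>s\<in>S - T. cmod (z - \<phi> s) = len s)"

lemma vertices_add_vertex [simp]: "vertices (add_vertex L w c S len T) = insert w (vertices L)"
  by (simp add: add_vertex_def)

lemma cabled_linkage_add_vertex:
  assumes "cabled_linkage L" "w \<notin> vertices L" "S \<subseteq> vertices L" "T \<subseteq> S"
    and "\<And>s. s \<in> S \<Longrightarrow> len s > 0"
  shows "cabled_linkage (add_vertex L w c S len T)"
proof -
  have old: "w \<notin> e" if "e \<in> edges L" for e
    using that assms(1,2) unfolding cabled_linkage_def by blast
  have new: "s \<noteq> w" if "s \<in> S" for s
    using that assms(2,3) by blast
  have diff: "the_elem ({w, s} - {w}) = s" if "s \<in> S" for s
    using new[OF that] by (simp add: insert_Diff_if)
  show ?thesis
    using assms old new diff unfolding cabled_linkage_def add_vertex_def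
    by (auto split: option.splits simp: card_insert_if)
qed

lemma configuration_space_add_vertex:
  assumes L: "cabled_linkage L" and w: "w \<notin> vertices L" and "S \<subseteq> vertices L" "T \<subseteq> S"
    and pos: "\<And>s. s \<in> S \<Longrightarrow> len s > 0"
  shows "\<phi> \<in> configuration_space (add_vertex L w c S len T) \<longleftrightarrow>
     \<phi> \<in> insert w (vertices L) \<rightarrow>\<^sub>E UNIV \<and> restrict \<phi> (vertices L) \<in> configuration_space L \<and>
     admissible c S len T \<phi> (\<phi> w)"
proof -
  let ?V = "vertices L" and ?L = "add_vertex L w c S len T"
  have old: "w \<notin> e" if "e \<in> edges L" for e
    using that L w unfolding cabled_linkage_def by blast
  have FE: "flexible L \<subseteq> edges L" and fV: "fixed L \<subseteq> ?V"
    using L unfolding cabled_linkage_def by blast+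
  have new: "s \<noteq> w" if "s \<in> S" for s
    using that assms(2,3) by blast
  have diff: "the_elem ({w, s} - {w}) = s" if "s \<noteq> w" for s
    using that by (simp add: insert_Diff_if)
  have wfix: "w \<notin> fixed L" using fV w by blast
  have flex: "{v, u} \<in> flexible ?L \<longleftrightarrow> {v, u} \<in> flexible L \<or> (v = w \<and> u \<in> T) \<or> (u = w \<and> v \<in> T)" for u v
    by (auto simp: add_vertex_def doubleton_eq_iff)
  have edge: "{v, u} \<in> edges ?L - flexible ?L \<longleftrightarrow> {v, u} \<in> edges L - flexible L \<or>
      (v = w \<and> u \<in> S - T) \<or> (u = w \<and> v \<in> S - T)" for u v
    using old[of "{w, v}"] old[of "{w, u}"] old[of "{v, w}"] FE new \<open>T \<subseteq> S\<close>
    by (auto simp: add_vertex_def doubleton_eq_iff)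
  have len: "edge_length ?L {v, u} = edge_length L {v, u}" if "{v, u} \<in> edges L" for v u
    using old[OF that] by (simp add: add_vertex_def)
  have lenw: "edge_length ?L {w, s} = len s" "edge_length ?L {s, w} = len s" if "s \<in> S" for s
    using diff[OF new[OF that]] by (simp_all add: add_vertex_def insert_commute)
  have fixed: "(\<forall>v\<in>fixed ?L. \<phi> v = position ?L v) \<longleftrightarrow>
      (\<forall>v\<in>fixed L. \<phi> v = position L v) \<and> (\<forall>p. c = Some p \<longrightarrow> \<phi> w = p)"
    using wfix by (auto simp: add_vertex_def split: option.splits)
  have flexc: "(\<forall>v u. {v, u} \<in> flexible ?L \<longrightarrow> cmod (\<phi> v - \<phi> u) \<le> edge_length ?L {v, u}) \<longleftrightarrow>
      (\<forall>v u. {v, u} \<in> flexible L \<longrightarrow> cmod (\<phi> v - \<phi> u) \<le> edge_length L {v, u}) \<and>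
      (\<forall>s\<in>T. cmod (\<phi> w - \<phi> s) \<le> len s)" 
    unfolding flex using len lenw FE \<open>T \<subseteq> S\<close>
    by (auto simp: norm_minus_commute subset_iff)
  have rigid: "(\<forall>v u. {v, u} \<in> edges ?L - flexible ?L \<longrightarrow> cmod (\<phi> v - \<phi> u) = edge_length ?L {v, u}) \<longleftrightarrow>
      (\<forall>v u. {v, u} \<in> edges L - flexible L \<longrightarrow> cmod (\<phi> v - \<phi> u) = edge_length L {v, u}) \<and>
      (\<forall>s\<in>S - T. cmod (\<phi> w - \<phi> s) = len s)" 
    unfolding edge using len lenw by (auto simp: norm_minus_commute)
  have edgeV: "v \<in> ?V \<and> u \<in> ?V" if "{v, u} \<in> edges L" for v u
    using L that unfolding cabled_linkage_def by (metis insert_subset)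
  have restr: "restrict \<phi> ?V \<in> configuration_space L \<longleftrightarrow>
      (\<forall>v\<in>fixed L. \<phi> v = position L v) \<and>
      (\<forall>v u. {v, u} \<in> flexible L \<longrightarrow> cmod (\<phi> v - \<phi> u) \<le> edge_length L {v, u}) \<and>
      (\<forall>v u. {v, u} \<in> edges L - flexible L \<longrightarrow> cmod (\<phi> v - \<phi> u) = edge_length L {v, u})"
  proof -
    have r: "restrict \<phi> ?V v = \<phi> v" if "v \<in> ?V" for v using that by simp
    have "(\<forall>v\<in>fixed L. restrict \<phi> ?V v = position L v) \<longleftrightarrow> (\<forall>v\<in>fixed L. \<phi> v = position L v)"
      using r fV by (metis subsetD)
    moreover have "(\<forall>v u. {v, u} \<in> flexible L \<longrightarrow> cmod (restrict \<phi> ?V v - restrict \<phi> ?V u) \<le> edge_length L {v, u})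
       \<longleftrightarrow> (\<forall>v u. {v, u} \<in> flexible L \<longrightarrow> cmod (\<phi> v - \<phi> u) \<le> edge_length L {v, u})"
      using r edgeV FE by (metis subsetD)
    moreover have "(\<forall>v u. {v, u} \<in> edges L - flexible L \<longrightarrow> cmod (restrict \<phi> ?V v - restrict \<phi> ?V u) = edge_length L {v, u})
       \<longleftrightarrow> (\<forall>v u. {v, u} \<in> edges L - flexible L \<longrightarrow> cmod (\<phi> v - \<phi> u) = edge_length L {v, u})"
      using r edgeV by (metis DiffD1)
    ultimately show ?thesis unfolding configuration_space_def by auto
  qed
  show ?thesis
    unfolding configuration_space_def[of ?L] mem_Collect_eq fixed flexc rigid restr admissible_def
      vertices_add_vertex by blast
qed

text \<open>The single growth step. A parameter \<open>y\<close> survives if the new vertex has an admissible position, and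
  then this position must be \<open>h y\<close> alone.\<close>

lemma parametrizes_add_vertex:
  assumes G: "parametrizes I U Y L G"
    and w: "w \<notin> vertices L" "S \<subseteq> vertices L" "T \<subseteq> S" "\<And>s. s \<in> S \<Longrightarrow> len s > 0"
    and h: "plane_analytic I U h" and Y': "Y' \<subseteq> Y"
    and unique: "\<And>y z. y \<in> Y \<Longrightarrow> admissible c S len T (\<lambda>s. G s y) z \<longleftrightarrow> y \<in> Y' \<and> z = h y"
  shows "parametrizes I U Y' (add_vertex L w c S len T) (G(w := h))"
proof -
  let ?V = "vertices L" and ?L = "add_vertex L w c S len T" and ?G = "G(w := h)"
  have L: "cabled_linkage L" and C: "configuration_space L = (\<lambda>y. \<lambda>v\<in>?V. G v y) ` Y"
    using G unfolding parametrizes_def by blast+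
  note config = configuration_space_add_vertex[where len = len and c = c, OF L w]
  have adm: "admissible c S len T \<phi> z \<longleftrightarrow> admissible c S len T (\<lambda>s. G s y) z"
    if "\<And>v. v \<in> ?V \<Longrightarrow> \<phi> v = G v y" for \<phi> y z
  proof -
    have "\<phi> s = G s y" if "s \<in> S" for s using that \<open>S \<subseteq> ?V\<close> \<open>\<And>v. v \<in> ?V \<Longrightarrow> \<phi> v = G v y\<close> by blast
    then have "\<forall>s\<in>T. \<phi> s = G s y" "\<forall>s\<in>S - T. \<phi> s = G s y" using \<open>T \<subseteq> S\<close> by auto
    then show ?thesis unfolding admissible_def by simp
  qed
  have "configuration_space ?L = (\<lambda>y. \<lambda>v\<in>insert w ?V. ?G v y) ` Y'" (is "_ = ?R")
  proof (intro set_eqI iffI)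
    fix \<phi> assume "\<phi> \<in> configuration_space ?L"
    then have \<phi>: "\<phi> \<in> insert w ?V \<rightarrow>\<^sub>E UNIV" "restrict \<phi> ?V \<in> configuration_space L"
      "admissible c S len T \<phi> (\<phi> w)"
      using config by blast+
    then obtain y where y: "y \<in> Y" "restrict \<phi> ?V = (\<lambda>v\<in>?V. G v y)" using C by blast
    have eq: "\<phi> v = G v y" if "v \<in> ?V" for v using fun_cong[OF y(2), of v] that by simp
    have "y \<in> Y' \<and> \<phi> w = h y"
      using adm[of \<phi> y, OF eq] \<phi>(3) unique[OF y(1)] by blast
    moreover have "\<phi> = (\<lambda>v\<in>insert w ?V. ?G v y)"
      using \<phi>(1) eq calculation w(1) by (auto simp: fun_eq_iff PiE_iff extensional_def)
    ultimately show "\<phi> \<in> ?R" by blast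
  next
    fix \<phi> assume "\<phi> \<in> ?R"
    then obtain y where y: "y \<in> Y'" "\<phi> = (\<lambda>v\<in>insert w ?V. ?G v y)" by blast
    have eq: "\<phi> v = G v y" if "v \<in> ?V" for v using y(2) that w(1) by auto
    have "restrict \<phi> ?V = (\<lambda>v\<in>?V. G v y)" using eq by auto
    moreover have "\<phi> w = h y" using y(2) by simp
    ultimately show "\<phi> \<in> configuration_space ?L"
      using config[of \<phi>] C y adm[of \<phi> y, OF eq] unique[of y] Y' by auto
  qed
  then show ?thesis
    using G h w(1) cabled_linkage_add_vertex[where len = len and c = c, OF L w] unfolding parametrizes_def by auto
qed

text \<open>Forgetting the linkage and keeping only the functions that occur as positions of vertices. Equality
  on \<open>U\<close> suffices because \<open>U\<close> is open; \<open>U\<close> is nonempty so that functions with no common value belong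
  to different vertices.\<close>

definition realizable ::
  "'i set \<Rightarrow> ('i \<Rightarrow> real) set \<Rightarrow> ('i \<Rightarrow> real) set \<Rightarrow> (('i \<Rightarrow> real) \<Rightarrow> complex) set \<Rightarrow> bool" where
  "realizable I U Y \<F> \<longleftrightarrow>
     finite I \<and> openin (powertop_real I) U \<and> U \<noteq> {} \<and> Y \<subseteq> U \<and>
     (\<exists>(L :: nat linkage) G. parametrizes I U Y L G \<and>
        (\<forall>f\<in>\<F>. \<exists>v\<in>vertices L. \<forall>y\<in>U. G v y = f y))"

lemma realizableE:
  assumes "realizable I U Y \<F>"
  obtains L G loc where "cabled_linkage (L :: nat linkage)" "finite (vertices L)" "parametrizes I U Y L G"
    "\<And>f. f \<in> \<F> \<Longrightarrow> loc f \<in> vertices L" "\<And>f y. f \<in> \<F> \<Longrightarrow> y \<in> U \<Longrightarrow> G (loc f) y = f y"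
proof -
  from assms obtain L :: "nat linkage" and G where LG: "parametrizes I U Y L G"
    "\<forall>f\<in>\<F>. \<exists>v\<in>vertices L. \<forall>y\<in>U. G v y = f y" unfolding realizable_def by blast
  moreover from LG(2) obtain loc where "\<And>f. f \<in> \<F> \<Longrightarrow> loc f \<in> vertices L \<and> (\<forall>y\<in>U. G (loc f) y = f y)"
    by metis
  ultimately show thesis using that[of L G loc] by (auto simp: parametrizes_def cabled_linkage_def)
qed

lemma realizableI:
  assumes "realizable I U Y \<F>" "Y' \<subseteq> Y" "parametrizes I U Y' (L :: nat linkage) G"
    "\<And>f. f \<in> \<F>' \<Longrightarrow> \<exists>v\<in>vertices L. \<forall>y\<in>U. G v y = f y"
  shows "realizable I U Y' \<F>'"
  using assms unfolding realizable_def by blast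

lemma realizable_mono: "realizable I U Y \<F> \<Longrightarrow> \<F>' \<subseteq> \<F> \<Longrightarrow> realizable I U Y \<F>'"
  unfolding realizable_def by blast

lemma realizable_cong:
  assumes "realizable I U Y (insert f \<F>)" "\<And>y. y \<in> U \<Longrightarrow> f y = g y"
  shows "realizable I U Y (insert g \<F>)"
proof (rule realizableE[OF assms(1)])
  fix L :: "nat linkage" and G loc
  assume L: "parametrizes I U Y L G" and loc: "\<And>k. k \<in> insert f \<F> \<Longrightarrow> loc k \<in> vertices L"
    "\<And>k y. k \<in> insert f \<F> \<Longrightarrow> y \<in> U \<Longrightarrow> G (loc k) y = k y"
  show ?thesis
  proof (rule realizableI[OF assms(1) order_refl L])
    fix k assume "k \<in> insert g \<F>"
    then show "\<exists>v\<in>vertices L. \<forall>y\<in>U. G v y = k y"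
      using loc(1)[of f] loc(2)[of f] loc(1)[of k] loc(2)[of k] assms(2) by (cases "k = g") auto
  qed
qed

lemma realizable_analytic:
  assumes "realizable I U Y \<F>" "f \<in> \<F>"
  shows "plane_analytic I U f"
proof -
  obtain L :: "nat linkage" and G v where L: "parametrizes I U Y L G" "v \<in> vertices L"
    and v: "\<forall>y\<in>U. G v y = f y" and I: "finite I" "openin (powertop_real I) U"
    using assms unfolding realizable_def by blast
  have an: "plane_analytic I U (G v)" using L unfolding parametrizes_def by blast
  show ?thesis unfolding plane_analytic_def
  proof
    fix a assume a: "a \<in> U"
    have re: "analytic_at I (\<lambda>x. Re (G v x)) a" and im: "analytic_at I (\<lambda>x. Im (G v x)) a"
      using an a unfolding plane_analytic_def by blast+
    show "analytic_at I (\<lambda>x. Re (f x)) a \<and> analytic_at I (\<lambda>x. Im (f x)) a"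
      using analytic_at_cong[OF I a re, of "\<lambda>x. Re (f x)"]
        analytic_at_cong[OF I a im, of "\<lambda>x. Im (f x)"] v by simp
  qed
qed

lemma realizable_domain:
  assumes "realizable I U Y \<F>"
  shows "finite I" "openin (powertop_real I) U" "U \<subseteq> I \<rightarrow>\<^sub>E UNIV" "U \<noteq> {}" "Y \<subseteq> U"
  using assms openin_subset[of "powertop_real I" U] unfolding realizable_def by auto

lemma realizable_const:
  assumes "realizable I U Y \<F>"
  shows "realizable I U Y (insert (\<lambda>_. c) \<F>)"
proof (rule realizableE[OF assms])
  fix L :: "nat linkage" and G loc
  assume L: "cabled_linkage L" "finite (vertices L)" "parametrizes I U Y L G"
    and loc: "\<And>f. f \<in> \<F> \<Longrightarrow> loc f \<in> vertices L" "\<And>f y. f \<in> \<F> \<Longrightarrow> y \<in> U \<Longrightarrow> G (loc f) y = f y"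
  obtain w where w: "w \<notin> vertices L" using ex_new_if_finite[OF _ L(2)] by blast
  have "parametrizes I U Y (add_vertex L w (Some c) {} (\<lambda>_. 1) {}) (G(w := \<lambda>_. c))"
    by (rule parametrizes_add_vertex[OF L(3) w])
       (auto simp: plane_analytic_const admissible_def)
  then show ?thesis
  proof (rule realizableI[OF assms order_refl])
    fix k assume "k \<in> insert (\<lambda>_. c) \<F>"
    then show "\<exists>v\<in>vertices (add_vertex L w (Some c) {} (\<lambda>_. 1) {}). \<forall>y\<in>U. (G(w := \<lambda>_. c)) v y = k y"
      using loc w by (cases "k = (\<lambda>_. c)") (force intro!: bexI[of _ w], auto intro!: bexI[of _ "loc k"])
  qed
qed

text \<open>A cable of length \<open>r\<close> to a new fixed vertex at \<open>c\<close>.\<close>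

lemma realizable_disk:
  assumes "realizable I U Y \<F>" "f \<in> \<F>" "r > 0"
  shows "realizable I U {y \<in> Y. cmod (f y - c) \<le> r} \<F>"
proof (rule realizableE[OF assms(1)])
  fix L :: "nat linkage" and G loc
  assume L: "cabled_linkage L" "finite (vertices L)" "parametrizes I U Y L G"
    and loc: "\<And>f. f \<in> \<F> \<Longrightarrow> loc f \<in> vertices L" "\<And>f y. f \<in> \<F> \<Longrightarrow> y \<in> U \<Longrightarrow> G (loc f) y = f y"
  have "Y \<subseteq> U" using assms(1) unfolding realizable_def by blast
  obtain w where w: "w \<notin> vertices L" using ex_new_if_finite[OF _ L(2)] by blast
  have "parametrizes I U {y \<in> Y. cmod (f y - c) \<le> r}
      (add_vertex L w (Some c) {loc f} (\<lambda>_. r) {loc f}) (G(w := \<lambda>_. c))"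
    using loc assms \<open>Y \<subseteq> U\<close>
    by (intro parametrizes_add_vertex[OF L(3) w])
       (auto simp: plane_analytic_const admissible_def norm_minus_commute subset_iff)
  then show ?thesis
  proof (rule realizableI[OF assms(1), rotated])
    fix k assume "k \<in> \<F>"
    then show "\<exists>v\<in>vertices (add_vertex L w (Some c) {loc f} (\<lambda>_. r) {loc f}).
        \<forall>y\<in>U. (G(w := \<lambda>_. c)) v y = k y"
      using loc w by (auto intro!: bexI[of _ "loc k"])
  qed auto
qed

text \<open>Points with equal distances to \<open>a\<close> and to \<open>b\<close> lie on a line perpendicular to the line through
  \<open>a\<close> and \<open>b\<close>, and a line meets a circle at most twice.\<close>

lemma two_circles:
  fixes a b p q h :: complex
  assumes "a \<noteq> b" "p \<noteq> q"
    and "cmod (p - a) = cmod (q - a)" "cmod (p - b) = cmod (q - b)"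
    and "cmod (h - a) = cmod (p - a)" "cmod (h - b) = cmod (p - b)"
  shows "h = p \<or> h = q"
proof -
  have inner: "(x - p) \<bullet> (b - a) = 0" if "cmod (x - a) = cmod (p - a)" "cmod (x - b) = cmod (p - b)" for x
  proof -
    have "(cmod (x - a))\<^sup>2 - (cmod (x - b))\<^sup>2 = (cmod (p - a))\<^sup>2 - (cmod (p - b))\<^sup>2" using that by simp
    then show ?thesis by (simp add: power2_norm_eq_inner inner_simps inner_commute)
  qed
  define u where "u = \<i> * (b - a)"
  have line: "\<exists>t::real. x = p + of_real t * u" if "(x - p) \<bullet> (b - a) = 0" for x
  proof
    let ?n = "(cmod (b - a))\<^sup>2"
    have n: "?n \<noteq> 0" using \<open>a \<noteq> b\<close> by simp
    \<comment> \<open>Expansion of \<open>x - p\<close> in the orthogonal basis \<open>b - a\<close>, \<open>u\<close>; the first coefficient vanishes.\<close>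
    have "of_real ?n * (x - p) = of_real ((x - p) \<bullet> u) * u"
      using that unfolding u_def cmod_power2 inner_complex_def
      by (simp add: complex_eq_iff power2_eq_square) algebra
    then show "x = p + of_real ((x - p) \<bullet> u / ?n) * u"
      using n by (simp add: field_simps)
  qed
  obtain s where s: "q = p + of_real s * u" using line[OF inner[of q]] assms by metis
  obtain t where t: "h = p + of_real t * u" using line[OF inner[of h]] assms by metis
  have quad: "x * (2 * ((p - a) \<bullet> u) + x * (u \<bullet> u)) = 0"
    if "cmod (p + of_real x * u - a) = cmod (p - a)" for x
  proof -
    have "(cmod ((p - a) + x *\<^sub>R u))\<^sup>2 = (cmod (p - a))\<^sup>2"
      using that by (simp add: scaleR_conv_of_real algebra_simps)
    then show ?thesis
      by (simp add: power2_norm_eq_inner inner_simps inner_commute algebra_simps)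
  qed
  have "s \<noteq> 0" using s \<open>p \<noteq> q\<close> by auto
  then have 1: "2 * ((p - a) \<bullet> u) + s * (u \<bullet> u) = 0" using quad[of s] s assms by auto
  have "t = 0 \<or> 2 * ((p - a) \<bullet> u) + t * (u \<bullet> u) = 0" using quad[of t] t assms by auto
  moreover have "(t - s) * (u \<bullet> u) =
      (2 * ((p - a) \<bullet> u) + t * (u \<bullet> u)) - (2 * ((p - a) \<bullet> u) + s * (u \<bullet> u))"
    by (simp add: algebra_simps)
  ultimately have "t = 0 \<or> (t - s) * (u \<bullet> u) = 0" using 1 by (metis diff_self)
  moreover have "u \<bullet> u \<noteq> 0" using \<open>a \<noteq> b\<close> by (simp add: u_def)
  ultimately show ?thesis using s t by auto
qed

text \<open>Two bars leave the choice between \<open>h\<close> and \<open>h'\<close>; the cable of length \<open>\<delta>\<close> to \<open>c\<close> admits only \<open>h\<close>. The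
  anchor \<open>c\<close> is a new vertex, so the cable cannot coincide with one of the bars.\<close>

lemma realizable_circle_intersection:
  assumes R: "realizable I U Y \<F>" and fg: "f \<in> \<F>" "g \<in> \<F>" and h: "plane_analytic I U h"
    and pos: "a > 0" "b > 0" "\<delta> > 0"
    and U: "\<And>y. y \<in> U \<Longrightarrow> f y \<noteq> g y"
      "\<And>y. y \<in> U \<Longrightarrow> cmod (h y - f y) = a" "\<And>y. y \<in> U \<Longrightarrow> cmod (h y - g y) = b"
      "\<And>y. y \<in> U \<Longrightarrow> cmod (h' y - f y) = a" "\<And>y. y \<in> U \<Longrightarrow> cmod (h' y - g y) = b"
      "\<And>y. y \<in> U \<Longrightarrow> cmod (h y - c) \<le> \<delta>" "\<And>y. y \<in> U \<Longrightarrow> cmod (h' y - c) > \<delta>"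
  shows "realizable I U Y (insert h \<F>)"
proof -
  have "Y \<subseteq> U" "U \<noteq> {}" using R unfolding realizable_def by blast+
  show ?thesis
  proof (rule realizableE[OF R])
    fix L :: "nat linkage" and G loc
    assume L: "cabled_linkage L" "finite (vertices L)" "parametrizes I U Y L G"
      and loc: "\<And>f. f \<in> \<F> \<Longrightarrow> loc f \<in> vertices L" "\<And>f y. f \<in> \<F> \<Longrightarrow> y \<in> U \<Longrightarrow> G (loc f) y = f y"
    obtain w where w: "w \<notin> vertices L" using ex_new_if_finite[OF _ L(2)] by blast
    let ?L = "add_vertex L w (Some c) {} (\<lambda>_. 1) {}"
    have L': "parametrizes I U Y ?L (G(w := \<lambda>_. c))"
      by (rule parametrizes_add_vertex[OF L(3) w]) (auto simp: plane_analytic_const admissible_def)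
    obtain v where v: "v \<notin> insert w (vertices L)" using ex_new_if_finite[of "insert w (vertices L)"] L(2) by auto
    have w': "loc f \<noteq> w" "loc g \<noteq> w" using loc(1) fg w by auto
    have fg': "loc f \<noteq> loc g"
      using U(1) loc(2)[of f] loc(2)[of g] fg \<open>U \<noteq> {}\<close> by (metis ex_in_conv)
    let ?len = "\<lambda>s. if s = loc f then a else if s = loc g then b else \<delta>"
    have "parametrizes I U Y (add_vertex ?L v None {loc f, loc g, w} ?len {w}) ((G(w := \<lambda>_. c))(v := h))"
    proof (rule parametrizes_add_vertex[OF L'])
      fix y z assume "y \<in> Y"
      then have y: "y \<in> U" using \<open>Y \<subseteq> U\<close> by blast
      have "h y \<noteq> h' y" using U(6,7)[OF y] by auto
      have "z = h y \<or> z = h' y" if "cmod (z - f y) = a" "cmod (z - g y) = b"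
        by (rule two_circles[OF U(1)[OF y] \<open>h y \<noteq> h' y\<close>]) (simp_all add: U[OF y] that)
      then have *: "cmod (z - c) \<le> \<delta> \<and> cmod (z - f y) = a \<and> cmod (z - g y) = b \<longleftrightarrow> z = h y"
        using U[OF y] by fastforce
      have "{loc f, loc g, w} - {w} = {loc f, loc g}" using w' by auto
      then have "admissible None {loc f, loc g, w} ?len {w} (\<lambda>s. (G(w := \<lambda>_. c)) s y) z \<longleftrightarrow>
         cmod (z - c) \<le> \<delta> \<and> cmod (z - f y) = a \<and> cmod (z - g y) = b"
        using loc(2)[OF fg(1) y] loc(2)[OF fg(2) y] w' fg' by (simp add: admissible_def)
      then show "admissible None {loc f, loc g, w} ?len {w} (\<lambda>s. (G(w := \<lambda>_. c)) s y) z \<longleftrightarrow> y \<in> Y \<and> z = h y"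
        using * \<open>y \<in> Y\<close> by blast
    qed (use v h loc(1) fg pos in \<open>auto split: if_splits\<close>)
    then show ?thesis
    proof (rule realizableI[OF R order_refl])
      fix k assume "k \<in> insert h \<F>"
      then show "\<exists>u\<in>vertices (add_vertex ?L v None {loc f, loc g, w} ?len {w}).
          \<forall>y\<in>U. ((G(w := \<lambda>_. c))(v := h)) u y = k y"
        using loc v w by (cases "k = h") (force intro!: bexI[of _ v], auto intro!: bexI[of _ "loc k"])
    qed
  qed
qed

section \<open>The Peaucellier inversor\<close>

definition inversion :: "real \<Rightarrow> complex \<Rightarrow> complex \<Rightarrow> complex" where
  "inversion \<kappa> c p = c + of_real (\<kappa> / (cmod (p - c))\<^sup>2) * (p - c)"

text \<open>The points at distance \<open>r\<close> from \<open>c\<close> and \<open>sqrt (r\<^sup>2 - \<kappa>)\<close> from \<open>p\<close>, one for each sign \<open>\<sigma> = \<plusminus> 1\<close>: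
  \<open>s\<close> is their coordinate along \<open>p - c\<close>, in units of \<open>p - c\<close>, and the square root the one across.\<close>

definition elbow :: "real \<Rightarrow> real \<Rightarrow> real \<Rightarrow> complex \<Rightarrow> complex \<Rightarrow> complex" where
  "elbow \<kappa> r \<sigma> c p =
     (let D = (cmod (p - c))\<^sup>2; s = (D + \<kappa>) / (2 * D)
      in c + Complex s (\<sigma> * sqrt (r\<^sup>2 / D - s\<^sup>2)) * (p - c))"

text \<open>The two circles meet transversally: the expression under the root in \<open>elbow\<close> is positive. Thus
  the elbows are distinct and analytic in \<open>c\<close> and \<open>p\<close>.\<close>

definition elbow_range :: "real \<Rightarrow> real \<Rightarrow> complex \<Rightarrow> complex \<Rightarrow> bool" where
  "elbow_range \<kappa> r c p \<longleftrightarrow>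
     (cmod (p - c))\<^sup>2 > 0 \<and> ((cmod (p - c))\<^sup>2 + \<kappa>)\<^sup>2 < 4 * r\<^sup>2 * (cmod (p - c))\<^sup>2"

lemma elbow_range_sqrt_pos:
  fixes D \<kappa> r :: real
  assumes "D > 0" "(D + \<kappa>)\<^sup>2 < 4 * r\<^sup>2 * D"
  shows "r\<^sup>2 / D - ((D + \<kappa>) / (2 * D))\<^sup>2 > 0"
proof -
  have "r\<^sup>2 / D - ((D + \<kappa>) / (2 * D))\<^sup>2 = (4 * r\<^sup>2 * D - (D + \<kappa>)\<^sup>2) / (4 * D\<^sup>2)"
    using assms(1) by (simp add: power_divide power_mult_distrib field_simps power2_eq_square)
  then show ?thesis using assms by simp
qed

lemma elbow_distances:
  assumes "elbow_range \<kappa> r c p" "\<sigma>\<^sup>2 = 1" "r > 0" "\<kappa> < r\<^sup>2"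
  shows "cmod (elbow \<kappa> r \<sigma> c p - c) = r" "cmod (elbow \<kappa> r \<sigma> c p - p) = sqrt (r\<^sup>2 - \<kappa>)"
proof -
  define D where "D = (cmod (p - c))\<^sup>2"
  define s where "s = (D + \<kappa>) / (2 * D)"
  define \<tau> where "\<tau> = sqrt (r\<^sup>2 / D - s\<^sup>2)"
  have D: "D > 0" "(D + \<kappa>)\<^sup>2 < 4 * r\<^sup>2 * D" using assms(1) by (auto simp: elbow_range_def D_def)
  have \<tau>: "\<tau>\<^sup>2 = r\<^sup>2 / D - s\<^sup>2"
    using elbow_range_sqrt_pos[OF D] by (simp add: \<tau>_def s_def)
  have e: "elbow \<kappa> r \<sigma> c p = c + Complex s (\<sigma> * \<tau>) * (p - c)"
    by (simp add: elbow_def Let_def D_def s_def \<tau>_def)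
  have "(cmod (elbow \<kappa> r \<sigma> c p - c))\<^sup>2 = (cmod (Complex s (\<sigma> * \<tau>)))\<^sup>2 * D"
    by (simp add: e norm_mult power_mult_distrib D_def)
  also have "\<dots> = (s\<^sup>2 + \<tau>\<^sup>2) * D"
    using assms(2) by (simp add: cmod_power2 power_mult_distrib)
  also have "\<dots> = r\<^sup>2" using D by (simp add: \<tau>)
  finally show "cmod (elbow \<kappa> r \<sigma> c p - c) = r"
    using assms(3) by (simp add: power2_eq_iff_nonneg)
  have "elbow \<kappa> r \<sigma> c p - p = Complex (s - 1) (\<sigma> * \<tau>) * (p - c)"
    by (simp add: e complex_eq_iff algebra_simps)
  then have "(cmod (elbow \<kappa> r \<sigma> c p - p))\<^sup>2 = (cmod (Complex (s - 1) (\<sigma> * \<tau>)))\<^sup>2 * D"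
    by (simp add: norm_mult power_mult_distrib D_def)
  also have "\<dots> = ((s - 1)\<^sup>2 + \<tau>\<^sup>2) * D"
    using assms(2) by (simp add: cmod_power2 power_mult_distrib)
  also have "\<dots> = r\<^sup>2 - 2 * s * D + D"
    using D(1) unfolding \<tau> by (simp add: power2_diff distrib_right left_diff_distrib)
  also have "\<dots> = r\<^sup>2 - \<kappa>" using D(1) by (simp add: s_def field_simps)
  finally show "cmod (elbow \<kappa> r \<sigma> c p - p) = sqrt (r\<^sup>2 - \<kappa>)"
    by (metis norm_ge_zero real_sqrt_abs abs_of_nonneg)
qed

text \<open>The components across \<open>p - c\<close> cancel, so the fourth vertex of the rhombus lies on the line
  through \<open>c\<close> and \<open>p\<close>.\<close>

lemma elbows_sum:
  assumes "p \<noteq> c"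
  shows "elbow \<kappa> r 1 c p + elbow \<kappa> r (-1) c p - p = inversion \<kappa> c p"
proof -
  define D where "D = (cmod (p - c))\<^sup>2"
  define s where "s = (D + \<kappa>) / (2 * D)"
  define t where "t = sqrt (r\<^sup>2 / D - s\<^sup>2)"
  have "D \<noteq> 0" using assms by (simp add: D_def)
  then have "2 * s = 1 + \<kappa> / D" by (simp add: s_def field_simps)
  then have s: "Complex s t + Complex s (- t) = 1 + of_real (\<kappa> / D)"
    by (simp add: complex_eq_iff)
  have "elbow \<kappa> r 1 c p + elbow \<kappa> r (-1) c p - p =
      c + (Complex s t + Complex s (- t) - 1) * (p - c)"
    by (simp add: elbow_def Let_def D_def s_def t_def algebra_simps)
  also have "\<dots> = inversion \<kappa> c p"
    unfolding s by (simp add: inversion_def D_def)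
  finally show ?thesis .
qed

lemma elbows_differ:
  assumes "elbow_range \<kappa> r c p"
  shows "elbow \<kappa> r 1 c p \<noteq> elbow \<kappa> r (-1) c p"
proof -
  have "p \<noteq> c" using assms by (auto simp: elbow_range_def)
  moreover have "r\<^sup>2 / (cmod (p - c))\<^sup>2 - (((cmod (p - c))\<^sup>2 + \<kappa>) / (2 * (cmod (p - c))\<^sup>2))\<^sup>2 > 0"
    using elbow_range_sqrt_pos assms unfolding elbow_range_def by blast
  ultimately show ?thesis
    by (simp add: elbow_def Let_def)
qed

lemma inversion_differs:
  assumes "p \<noteq> c" "\<kappa> \<noteq> (cmod (p - c))\<^sup>2"
  shows "inversion \<kappa> c p \<noteq> p"
proof
  assume "inversion \<kappa> c p = p"
  then have "of_real (\<kappa> / (cmod (p - c))\<^sup>2) * (p - c) = 1 * (p - c)" by (simp add: inversion_def algebra_simps)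
  then have "\<kappa> / (cmod (p - c))\<^sup>2 = 1"
    using assms(1) by (metis mult_right_cancel of_real_eq_1_iff right_minus_eq)
  then show False using assms by (simp add: field_simps)
qed

lemma plane_analytic_elbow:
  assumes I: "finite I" and U: "U \<subseteq> I \<rightarrow>\<^sub>E UNIV"
    and fg: "plane_analytic I U f" "plane_analytic I U g"
    and "\<And>y. y \<in> U \<Longrightarrow> elbow_range \<kappa> r (f y) (g y)"
  shows "plane_analytic I U (\<lambda>y. elbow \<kappa> r \<sigma> (f y) (g y))"
proof -
  define D where "D y = (cmod (g y - f y))\<^sup>2" for y
  define s where "s y = (D y + \<kappa>) / (2 * D y)" for y
  define \<tau> where "\<tau> y = sqrt (r\<^sup>2 / D y - (s y)\<^sup>2)" for y
  have d: "plane_analytic I U (\<lambda>y. g y - f y)" using fg by (simp add: plane_analytic_diff)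
  have an: "analytic_at I s a \<and> analytic_at I (\<lambda>y. \<sigma> * \<tau> y) a" if a: "a \<in> U" for a
  proof -
    have a': "a \<in> I \<rightarrow>\<^sub>E UNIV" using a U by blast
    have range: "elbow_range \<kappa> r (f a) (g a)" using assms(5) a by blast
    have re: "analytic_at I (\<lambda>y. Re (g y - f y)) a" "analytic_at I (\<lambda>y. Im (g y - f y)) a"
      using d a unfolding plane_analytic_def by blast+
    have D: "analytic_at I D a" unfolding D_def cmod_power2
      by (intro analytic_at_add analytic_at_square I a' re)
    have "D a > 0" using range by (simp add: elbow_range_def D_def)
    then have iD: "analytic_at I (\<lambda>y. inverse (D y)) a"
      by (intro analytic_at_inverse I D a') simp
    have "s = (\<lambda>y. 1/2 * ((D y + \<kappa>) * inverse (D y)))"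
      by (simp add: s_def fun_eq_iff field_simps)
    then have s: "analytic_at I s a"
      by (simp only:) (intro analytic_at_cmult analytic_at_mult analytic_at_add analytic_at_const D iD I a')
    have "r\<^sup>2 * inverse (D a) - (s a)\<^sup>2 > 0"
      using elbow_range_sqrt_pos[of "D a" \<kappa> r] range
      unfolding elbow_range_def s_def D_def by (simp only: divide_inverse)
    then have "analytic_at I (\<lambda>y. sqrt (r\<^sup>2 * inverse (D y) - (s y)\<^sup>2)) a"
      by (intro analytic_at_sqrt analytic_at_diff analytic_at_square analytic_at_cmult iD s I a')
    moreover have "\<tau> = (\<lambda>y. sqrt (r\<^sup>2 * inverse (D y) - (s y)\<^sup>2))"
      by (simp add: \<tau>_def fun_eq_iff divide_real_def)
    ultimately have "analytic_at I \<tau> a" by (simp only:)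
    then show ?thesis using s by (intro conjI analytic_at_cmult)
  qed
  have "plane_analytic I U (\<lambda>y. f y + Complex (s y) (\<sigma> * \<tau> y) * (g y - f y))"
    by (intro plane_analytic_add plane_analytic_mult I U d fg) (auto simp: plane_analytic_def an)
  then show ?thesis
    by (simp add: elbow_def Let_def s_def \<tau>_def D_def)
qed

text \<open>Arms of length \<open>r\<close> at the centre and \<open>sqrt (r\<^sup>2 - \<kappa>)\<close> at the rhombus give the power \<open>\<kappa>\<close>. The
  condition on \<open>\<kappa>\<close> keeps \<open>p\<close> away from its inverse, so that the opposite vertices of the rhombus
  can be told apart. The radius \<open>\<eta>\<close> depends only on the base points, which lets one compose
  inversors without knowing the linkage.\<close>

theorem inversor:
  fixes c0 p0 :: complex
  assumes "c0 \<noteq> p0" "\<kappa> \<noteq> (cmod (p0 - c0))\<^sup>2"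
  obtains \<eta> where "\<eta> > 0"
    "\<And>(I :: 'i set) U Y \<F> f g. realizable I U Y \<F> \<Longrightarrow> f \<in> \<F> \<Longrightarrow> g \<in> \<F> \<Longrightarrow>
       \<forall>y\<in>U. cmod (f y - c0) < \<eta> \<and> cmod (g y - p0) < \<eta> \<Longrightarrow>
       realizable I U Y (insert (\<lambda>y. inversion \<kappa> (f y) (g y)) \<F>)"
proof -
  define D0 where "D0 = (cmod (p0 - c0))\<^sup>2"
  have D0: "D0 > 0" using assms(1) by (simp add: D0_def)
  \<comment> \<open>Long enough for both \<open>\<kappa> < r\<^sup>2\<close> and \<open>elbow_range\<close> at the base points.\<close>
  define r where "r = sqrt (\<bar>\<kappa>\<bar> + (D0 + \<kappa>)\<^sup>2 / (4 * D0) + 1)"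
  have r2: "r\<^sup>2 = \<bar>\<kappa>\<bar> + (D0 + \<kappa>)\<^sup>2 / (4 * D0) + 1"
    using D0 by (simp add: r_def)
  have r: "r > 0" using D0 by (simp add: r_def add_nonneg_pos)
  have \<kappa>r: "\<kappa> < r\<^sup>2"
  proof -
    have "(D0 + \<kappa>)\<^sup>2 / (4 * D0) \<ge> 0" using D0 by simp
    then show ?thesis unfolding r2 by linarith
  qed
  have range0: "elbow_range \<kappa> r c0 p0"
    unfolding elbow_range_def D0_def[symmetric]
  proof
    have "4 * r\<^sup>2 * D0 = 4 * (\<bar>\<kappa>\<bar> * D0) + (D0 + \<kappa>)\<^sup>2 + 4 * D0"
      unfolding r2 using D0 by (simp add: distrib_right distrib_left)
    moreover have "\<bar>\<kappa>\<bar> * D0 \<ge> 0" using D0 by simp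
    ultimately show "(D0 + \<kappa>)\<^sup>2 < 4 * r\<^sup>2 * D0" using D0 by linarith
  qed fact
  define A where "A = (\<lambda>q. elbow \<kappa> r 1 (fst q) (snd q))"
  define B where "B = (\<lambda>q. elbow \<kappa> r (-1) (fst q) (snd q))"
  define Q where "Q = (\<lambda>q. inversion \<kappa> (fst q) (snd q))"
  let ?N = "nhds (c0, p0)" and ?z = "(c0, p0)"
  have fst: "(fst \<longlongrightarrow> c0) ?N" and snd: "(snd \<longlongrightarrow> p0) ?N"
    using tendsto_fst[OF tendsto_ident_at] by (auto intro!: tendsto_eq_intros filterlim_ident)
  have D: "((\<lambda>q. (cmod (snd q - fst q))\<^sup>2) \<longlongrightarrow> D0) ?N"
    unfolding D0_def by (intro tendsto_intros fst snd)
  have elbow: "((\<lambda>q. elbow \<kappa> r \<sigma> (fst q) (snd q)) \<longlongrightarrow> elbow \<kappa> r \<sigma> c0 p0) ?N" for \<sigma>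
    unfolding elbow_def Let_def D0_def[symmetric]
    by (intro tendsto_intros tendsto_Complex fst snd D) (use D0 in auto)
  have A: "(A \<longlongrightarrow> A ?z) ?N" and B: "(B \<longlongrightarrow> B ?z) ?N"
    unfolding A_def B_def using elbow by simp_all
  have Q: "(Q \<longlongrightarrow> Q ?z) ?N"
    unfolding Q_def inversion_def fst_conv snd_conv D0_def[symmetric]
    by (intro tendsto_intros fst snd D) (use D0 in auto)
  have AB: "A ?z \<noteq> B ?z" using elbows_differ[OF range0] by (simp add: A_def B_def)
  have QP: "Q ?z \<noteq> p0" using inversion_differs assms by (simp add: Q_def)
  have ev_near: "eventually (\<lambda>q. cmod (X q - X ?z) < e) ?N" if "(X \<longlongrightarrow> X ?z) ?N" "e > 0" for X :: "_ \<Rightarrow> complex" and e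
    using tendstoD[OF that] by (simp add: dist_norm)
  have ev_far: "eventually (\<lambda>q. cmod (X q - w) > e) ?N" if "(X \<longlongrightarrow> x) ?N" "e < cmod (x - w)"
    for X :: "_ \<Rightarrow> complex" and e x w
    by (rule order_tendstoD(1)[OF _ that(2)]) (intro tendsto_intros that)
  \<comment> \<open>Cables of half the distance between the two candidates separate them near the base points.\<close>
  define \<delta> where "\<delta> = cmod (A ?z - B ?z) / 2"
  define \<epsilon> where "\<epsilon> = cmod (Q ?z - p0) / 2"
  have pos: "\<delta> > 0" "\<epsilon> > 0" using AB QP by (auto simp: \<delta>_def \<epsilon>_def)
  have "eventually (\<lambda>q. elbow_range \<kappa> r (fst q) (snd q)) ?N"
  proof -
    have "eventually (\<lambda>q. (cmod (snd q - fst q))\<^sup>2 > 0) ?N" by (rule order_tendstoD(1)[OF D D0])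
    moreover have "eventually (\<lambda>q. 4 * r\<^sup>2 * (cmod (snd q - fst q))\<^sup>2 - ((cmod (snd q - fst q))\<^sup>2 + \<kappa>)\<^sup>2 > 0) ?N"
    proof (rule order_tendstoD(1))
      show "((\<lambda>q. 4 * r\<^sup>2 * (cmod (snd q - fst q))\<^sup>2 - ((cmod (snd q - fst q))\<^sup>2 + \<kappa>)\<^sup>2) \<longlongrightarrow>
          4 * r\<^sup>2 * D0 - (D0 + \<kappa>)\<^sup>2) ?N"
        by (intro tendsto_intros D)
      show "0 < 4 * r\<^sup>2 * D0 - (D0 + \<kappa>)\<^sup>2" using range0 by (simp add: elbow_range_def D0_def)
    qed
    ultimately show ?thesis by eventually_elim (simp add: elbow_range_def)
  qed
  moreover have "eventually (\<lambda>q. cmod (A q - A ?z) < \<delta>) ?N" "eventually (\<lambda>q. cmod (B q - B ?z) < \<delta>) ?N"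
    "eventually (\<lambda>q. cmod (Q q - Q ?z) < \<epsilon>) ?N"
    using pos by (intro ev_near A B Q; simp)+
  moreover have "eventually (\<lambda>q. cmod (A q - B ?z) > \<delta>) ?N" "eventually (\<lambda>q. cmod (B q - A ?z) > \<delta>) ?N"
    "eventually (\<lambda>q. cmod (snd q - Q ?z) > \<epsilon>) ?N"
    by (rule ev_far[OF A] ev_far[OF B] ev_far[OF snd];
        use AB QP in \<open>simp add: \<delta>_def \<epsilon>_def norm_minus_commute\<close>)+
  ultimately have "eventually (\<lambda>q. elbow_range \<kappa> r (fst q) (snd q) \<and>
      cmod (A q - A ?z) < \<delta> \<and> cmod (B q - B ?z) < \<delta> \<and> cmod (Q q - Q ?z) < \<epsilon> \<and>
      cmod (A q - B ?z) > \<delta> \<and> cmod (B q - A ?z) > \<delta> \<and> cmod (snd q - Q ?z) > \<epsilon>) ?N"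
    (is "eventually ?good ?N")
    by eventually_elim blast
  then obtain \<eta> where \<eta>: "\<eta> > 0" and near: "\<And>q. dist q ?z < \<eta> \<Longrightarrow> ?good q"
    unfolding eventually_nhds_metric by blast
  show thesis
  proof (rule that[of "\<eta> / 2"])
    show "\<eta> / 2 > 0" using \<eta> by simp
    fix I :: "'i set" and U Y \<F> f g
    assume R: "realizable I U Y \<F>" and fg: "f \<in> \<F>" "g \<in> \<F>"
      and close: "\<forall>y\<in>U. cmod (f y - c0) < \<eta> / 2 \<and> cmod (g y - p0) < \<eta> / 2"
    have IU: "finite I" "U \<subseteq> I \<rightarrow>\<^sub>E UNIV" using realizable_domain[OF R] by blast+
    have "?good (f y, g y)" if "y \<in> U" for y
    proof -
      have "dist (f y, g y) ?z \<le> dist (f y) c0 + dist (g y) p0"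
        unfolding dist_Pair_Pair by (rule sqrt_sum_squares_le_sum) auto
      also have "\<dots> < \<eta>" using close that by (fastforce simp: dist_norm)
      finally show ?thesis using near by blast
    qed
    note near' = this[unfolded fst_conv snd_conv]
    have fg_an: "plane_analytic I U f" "plane_analytic I U g"
      using realizable_analytic[OF R] fg by blast+
    define a where "a = (\<lambda>y. A (f y, g y))"
    define b where "b = (\<lambda>y. B (f y, g y))"
    define q where "q = (\<lambda>y. Q (f y, g y))"
    have a_an: "plane_analytic I U a" and b_an: "plane_analytic I U b"
      unfolding a_def b_def A_def B_def fst_conv snd_conv
      by (intro plane_analytic_elbow IU fg_an; use near' in blast)+
    have fg_ne: "f y \<noteq> g y" if "y \<in> U" for y
      using near'[OF that] by (auto simp: elbow_range_def)
    have ab_ne: "a y \<noteq> b y" if "y \<in> U" for y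
      using elbows_differ near'[OF that] by (simp add: a_def b_def A_def B_def)
    have q_eq: "q y = a y + b y - g y" if "y \<in> U" for y
      using elbows_sum[of "g y" "f y" \<kappa> r] fg_ne[OF that] by (simp add: a_def b_def q_def A_def B_def Q_def)
    let ?l = "sqrt (r\<^sup>2 - \<kappa>)"
    have l: "?l > 0" using \<kappa>r by simp
    have da: "cmod (a y - f y) = r" "cmod (a y - g y) = ?l"
      and db: "cmod (b y - f y) = r" "cmod (b y - g y) = ?l" if "y \<in> U" for y
      using elbow_distances[of \<kappa> r "f y" "g y"] near'[OF that] r \<kappa>r
      by (simp_all add: a_def b_def A_def B_def)
    have R1: "realizable I U Y (insert a \<F>)"
      by (rule realizable_circle_intersection[OF R fg a_an r l pos(1) fg_ne da db, where c = "A ?z"])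
         (use near' in \<open>auto simp: a_def b_def less_imp_le\<close>)
    have R2: "realizable I U Y (insert b (insert a \<F>))"
      by (rule realizable_circle_intersection[OF R1 _ _ b_an r l pos(1) fg_ne db da, where c = "B ?z"])
         (use near' fg in \<open>auto simp: a_def b_def less_imp_le\<close>)
    have q_an: "plane_analytic I U (\<lambda>y. a y + b y - g y)"
      by (intro plane_analytic_add plane_analytic_diff a_an b_an fg_an)
    have R3: "realizable I U Y (insert (\<lambda>y. a y + b y - g y) (insert b (insert a \<F>)))"
    proof (rule realizable_circle_intersection[OF R2 _ _ q_an l l pos(2) ab_ne, where h' = g and c = "Q ?z"])
      fix y assume y: "y \<in> U"
      show "cmod (a y + b y - g y - a y) = ?l" "cmod (a y + b y - g y - b y) = ?l"
        "cmod (g y - a y) = ?l" "cmod (g y - b y) = ?l"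
        using da(2)[OF y] db(2)[OF y] by (simp_all add: norm_minus_commute)
      show "cmod (a y + b y - g y - Q ?z) \<le> \<epsilon>" "cmod (g y - Q ?z) > \<epsilon>"
        using near'[OF y] q_eq[OF y] by (simp_all add: q_def)
    qed auto
    have "realizable I U Y (insert q (insert b (insert a \<F>)))"
      by (rule realizable_cong[OF R3]) (simp add: q_eq)
    then show "realizable I U Y (insert (\<lambda>y. inversion \<kappa> (f y) (g y)) \<F>)"
      by (rule realizable_mono) (auto simp: q_def Q_def)
  qed
qed

section \<open>Arithmetic on the real axis\<close>

text \<open>A vertex showing \<open>\<Phi> (f, g)\<close> can be added whenever vertices on the real axis show \<open>f\<close> and \<open>g\<close> and
  these stay within \<open>\<eta>\<close> of \<open>b\<close>, uniformly in the linkage and its parameters.\<close>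

definition gate :: "(real \<times> real \<Rightarrow> real) \<Rightarrow> real \<times> real \<Rightarrow> real \<Rightarrow> bool" where
  "gate \<Phi> b \<eta> \<longleftrightarrow>
     (\<forall>(I :: nat set) U Y \<F> f g. realizable I U Y \<F> \<longrightarrow>
        (\<lambda>y. complex_of_real (f y)) \<in> \<F> \<longrightarrow> (\<lambda>y. complex_of_real (g y)) \<in> \<F> \<longrightarrow>
        (\<forall>y\<in>U. \<bar>f y - fst b\<bar> < \<eta> \<and> \<bar>g y - snd b\<bar> < \<eta>) \<longrightarrow>
        realizable I U Y (insert (\<lambda>y. complex_of_real (\<Phi> (f y, g y))) \<F>))"

lemma gateD:
  fixes I :: "nat set"
  assumes "gate \<Phi> b \<eta>" "realizable I U Y \<F>"
    "(\<lambda>y. complex_of_real (f y)) \<in> \<F>" "(\<lambda>y. complex_of_real (g y)) \<in> \<F>"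
    "\<forall>y\<in>U. \<bar>f y - fst b\<bar> < \<eta> \<and> \<bar>g y - snd b\<bar> < \<eta>"
  shows "realizable I U Y (insert (\<lambda>y. complex_of_real (\<Phi> (f y, g y))) \<F>)"
  using assms unfolding gate_def by blast

text \<open>Being a gate on some neighbourhood depends only on the germ of \<open>\<Phi>\<close> at \<open>b\<close>. Continuity is carried
  along because it keeps the arguments of a further gate in its range.\<close>

definition constructible :: "(real \<times> real \<Rightarrow> real) \<Rightarrow> real \<times> real \<Rightarrow> bool" where
  "constructible \<Phi> b \<longleftrightarrow> (\<Phi> \<longlongrightarrow> \<Phi> b) (nhds b) \<and> (\<exists>\<eta>>0. gate \<Phi> b \<eta>)"

lemma constructibleI:
  assumes "(\<Phi> \<longlongrightarrow> \<Phi> b) (nhds b)" "\<eta> > 0"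
    and "\<And>(I :: nat set) U Y \<F> f g. realizable I U Y \<F> \<Longrightarrow>
        (\<lambda>y. complex_of_real (f y)) \<in> \<F> \<Longrightarrow> (\<lambda>y. complex_of_real (g y)) \<in> \<F> \<Longrightarrow>
        \<forall>y\<in>U. \<bar>f y - fst b\<bar> < \<eta> \<and> \<bar>g y - snd b\<bar> < \<eta> \<Longrightarrow>
        realizable I U Y (insert (\<lambda>y. complex_of_real (\<Phi> (f y, g y))) \<F>)"
  shows "constructible \<Phi> b"
  unfolding constructible_def gate_def using assms by blast

lemma constructible_tendsto: "constructible \<Phi> b \<Longrightarrow> (\<Phi> \<longlongrightarrow> \<Phi> b) (nhds b)"
  by (simp add: constructible_def)

lemma tendsto_nhds_fst: "(fst \<longlongrightarrow> fst b) (nhds b)" and tendsto_nhds_snd: "(snd \<longlongrightarrow> snd b) (nhds b)"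
  by (auto intro!: tendsto_eq_intros filterlim_ident)

lemma constructible_fst: "constructible fst b" and constructible_snd: "constructible snd b"
  by (rule constructibleI[where \<eta> = 1]; simp add: tendsto_nhds_fst tendsto_nhds_snd insert_absorb)+

lemma constructible_const: "constructible (\<lambda>_. a) b"
  by (rule constructibleI[where \<eta> = 1]) (simp_all add: realizable_const)

lemma eventually_nhds_pair:
  fixes b :: "real \<times> real"
  assumes "eventually P (nhds b)"
  obtains \<eta> where "\<eta> > 0" "\<And>x y. \<bar>x - fst b\<bar> < \<eta> \<Longrightarrow> \<bar>y - snd b\<bar> < \<eta> \<Longrightarrow> P (x, y)"
proof -
  obtain d where d: "d > 0" "\<And>q. dist q b < d \<Longrightarrow> P q"
    using assms unfolding eventually_nhds_metric by blast
  show thesis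
  proof
    show "d / 2 > 0" using d by simp
    fix x y assume xy: "\<bar>x - fst b\<bar> < d / 2" "\<bar>y - snd b\<bar> < d / 2"
    have "dist (x, y) b \<le> \<bar>x - fst b\<bar> + \<bar>y - snd b\<bar>"
      unfolding dist_prod_def dist_real_def fst_conv snd_conv
      by (rule order_trans[OF sqrt_sum_squares_le_sum_abs]) simp
    then show "P (x, y)" using xy by (intro d(2)) linarith
  qed
qed

lemma inversion_of_real:
  "inversion \<kappa> (of_real c) (of_real p) = of_real (c + \<kappa> / (p - c))"
proof -
  have "cmod (of_real p - of_real c) = \<bar>p - c\<bar>" by (metis of_real_diff norm_of_real)
  then show ?thesis by (simp add: inversion_def power2_eq_square)
qed

lemma constructible_inversion:
  assumes "constructible \<Phi> b" "constructible \<Psi> b" "\<Phi> b \<noteq> \<Psi> b" "\<kappa> \<noteq> (\<Psi> b - \<Phi> b)\<^sup>2"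
  shows "constructible (\<lambda>q. \<Phi> q + \<kappa> / (\<Psi> q - \<Phi> q)) b"
proof -
  obtain \<eta>1 \<eta>2 where \<eta>1: "\<eta>1 > 0" "gate \<Phi> b \<eta>1" and \<eta>2: "\<eta>2 > 0" "gate \<Psi> b \<eta>2"
    using assms(1,2) unfolding constructible_def by blast
  have ne: "complex_of_real (\<Phi> b) \<noteq> complex_of_real (\<Psi> b)" using assms(3) by simp
  have "cmod (complex_of_real (\<Psi> b) - complex_of_real (\<Phi> b)) = \<bar>\<Psi> b - \<Phi> b\<bar>"
    by (metis of_real_diff norm_of_real)
  then have \<kappa>: "\<kappa> \<noteq> (cmod (complex_of_real (\<Psi> b) - complex_of_real (\<Phi> b)))\<^sup>2"
    using assms(4) by simp
  obtain \<eta>3 where \<eta>3: "\<eta>3 > 0"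
    "\<And>(I :: nat set) U Y \<F> f g. realizable I U Y \<F> \<Longrightarrow> f \<in> \<F> \<Longrightarrow> g \<in> \<F> \<Longrightarrow>
       \<forall>y\<in>U. cmod (f y - of_real (\<Phi> b)) < \<eta>3 \<and> cmod (g y - of_real (\<Psi> b)) < \<eta>3 \<Longrightarrow>
       realizable I U Y (insert (\<lambda>y. inversion \<kappa> (f y) (g y)) \<F>)"
    by (rule inversor[OF ne \<kappa>]) (rule that)
  have \<Phi>: "(\<Phi> \<longlongrightarrow> \<Phi> b) (nhds b)" and \<Psi>: "(\<Psi> \<longlongrightarrow> \<Psi> b) (nhds b)"
    using assms constructible_tendsto by blast+
  have "eventually (\<lambda>q. \<bar>\<Phi> q - \<Phi> b\<bar> < \<eta>3 \<and> \<bar>\<Psi> q - \<Psi> b\<bar> < \<eta>3) (nhds b)"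
    using tendstoD[OF \<Phi> \<eta>3(1)] tendstoD[OF \<Psi> \<eta>3(1)] unfolding dist_real_def by (rule eventually_conj)
  from eventually_nhds_pair[OF this] obtain \<eta>4 where \<eta>4: "\<eta>4 > 0" "\<And>x y. \<bar>x - fst b\<bar> < \<eta>4 \<Longrightarrow> \<bar>y - snd b\<bar> < \<eta>4 \<Longrightarrow>
      \<bar>\<Phi> (x, y) - \<Phi> b\<bar> < \<eta>3 \<and> \<bar>\<Psi> (x, y) - \<Psi> b\<bar> < \<eta>3"
    by blast
  show ?thesis
  proof (rule constructibleI)
    show "((\<lambda>q. \<Phi> q + \<kappa> / (\<Psi> q - \<Phi> q)) \<longlongrightarrow> \<Phi> b + \<kappa> / (\<Psi> b - \<Phi> b)) (nhds b)"
      by (intro tendsto_intros \<Phi> \<Psi>) (use assms(3) in simp)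
    show "min \<eta>1 (min \<eta>2 \<eta>4) > 0" using \<eta>1 \<eta>2 \<eta>4 by simp
    fix I :: "nat set" and U Y \<F> f g
    assume R: "realizable I U Y \<F>" and F: "(\<lambda>y. complex_of_real (f y)) \<in> \<F>" "(\<lambda>y. complex_of_real (g y)) \<in> \<F>"
      and close: "\<forall>y\<in>U. \<bar>f y - fst b\<bar> < min \<eta>1 (min \<eta>2 \<eta>4) \<and> \<bar>g y - snd b\<bar> < min \<eta>1 (min \<eta>2 \<eta>4)"
    let ?p = "\<lambda>y. complex_of_real (\<Phi> (f y, g y))" and ?q = "\<lambda>y. complex_of_real (\<Psi> (f y, g y))"
    have R1: "realizable I U Y (insert ?p \<F>)" by (rule gateD[OF \<eta>1(2) R F]) (use close in simp)
    have R2: "realizable I U Y (insert ?q (insert ?p \<F>))"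
      by (rule gateD[OF \<eta>2(2) R1 insertI2[OF F(1)] insertI2[OF F(2)]]) (use close in simp)
    have "cmod (?p y - of_real (\<Phi> b)) < \<eta>3 \<and> cmod (?q y - of_real (\<Psi> b)) < \<eta>3" if "y \<in> U" for y
      using \<eta>4(2)[of "f y" "g y"] close that by (simp flip: of_real_diff)
    then have R3: "realizable I U Y (insert (\<lambda>y. inversion \<kappa> (?p y) (?q y)) (insert ?q (insert ?p \<F>)))"
      by (intro \<eta>3(2)[OF R2]) auto
    show "realizable I U Y (insert (\<lambda>y. complex_of_real (\<Phi> (f y, g y) +
        \<kappa> / (\<Psi> (f y, g y) - \<Phi> (f y, g y)))) \<F>)"
      by (rule realizable_mono[OF R3[unfolded inversion_of_real]]) auto
  qed
qed

lemma constructible_cong: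
  assumes "constructible \<Phi> b" "eventually (\<lambda>q. \<Phi> q = \<Psi> q) (nhds b)"
  shows "constructible \<Psi> b"
proof -
  obtain \<eta> where \<eta>: "\<eta> > 0" "gate \<Phi> b \<eta>"
    using assms(1) unfolding constructible_def by blast
  obtain d where d: "d > 0" "\<And>x y. \<bar>x - fst b\<bar> < d \<Longrightarrow> \<bar>y - snd b\<bar> < d \<Longrightarrow> \<Phi> (x, y) = \<Psi> (x, y)"
    using eventually_nhds_pair[OF assms(2)] by blast
  have "\<Phi> b = \<Psi> b" using d(2)[of "fst b" "snd b"] d(1) by simp
  show ?thesis
  proof (rule constructibleI)
    show "(\<Psi> \<longlongrightarrow> \<Psi> b) (nhds b)"
      using constructible_tendsto[OF assms(1)] assms(2) \<open>\<Phi> b = \<Psi> b\<close>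
      by (metis Lim_transform_eventually)
    show "min \<eta> d > 0" using \<eta> d by simp
    fix I :: "nat set" and U Y \<F> f g
    assume R: "realizable I U Y \<F>" and F: "(\<lambda>y. complex_of_real (f y)) \<in> \<F>" "(\<lambda>y. complex_of_real (g y)) \<in> \<F>"
      and close: "\<forall>y\<in>U. \<bar>f y - fst b\<bar> < min \<eta> d \<and> \<bar>g y - snd b\<bar> < min \<eta> d"
    have "realizable I U Y (insert (\<lambda>y. complex_of_real (\<Phi> (f y, g y))) \<F>)"
      by (rule gateD[OF \<eta>(2) R F]) (use close in simp)
    then show "realizable I U Y (insert (\<lambda>y. complex_of_real (\<Psi> (f y, g y))) \<F>)"
      by (rule realizable_cong) (use close d(2) in simp)
  qed
qed

text \<open>Two inversions with the same centre and powers \<open>\<kappa>\<close> and \<open>c * \<kappa>\<close> compose to a homothety of ratio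
  \<open>c\<close>.\<close>

lemma constructible_combination:
  assumes "constructible \<Phi> b" "constructible \<Psi> b" "\<Phi> b \<noteq> \<Psi> b" "c \<noteq> 0"
  shows "constructible (\<lambda>q. \<Phi> q + c * (\<Psi> q - \<Phi> q)) b"
proof -
  define d where "d = (\<Psi> b - \<Phi> b)\<^sup>2"
  have d: "d > 0" using assms(3) by (simp add: d_def)
  \<comment> \<open>A negative power satisfies the condition on the first inversor, and \<open>\<kappa> \<noteq> c * d\<close> the one on the
    second.\<close>
  obtain \<kappa> :: real where \<kappa>: "\<kappa> < 0" "\<kappa> \<noteq> c * d"
  proof (cases "c * d = -1")
    case True then show ?thesis using that[of "-2"] by simp
  next
    case False then show ?thesis using that[of "-1"] by simp
  qed
  have "constructible (\<lambda>q. \<Phi> q + \<kappa> / (\<Psi> q - \<Phi> q)) b"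
    using \<kappa>(1) d unfolding d_def by (intro constructible_inversion assms(1-3)) linarith
  then have "constructible (\<lambda>q. \<Phi> q + (c * \<kappa>) / ((\<Phi> q + \<kappa> / (\<Psi> q - \<Phi> q)) - \<Phi> q)) b"
  proof (rule constructible_inversion[OF assms(1)])
    show "\<Phi> b \<noteq> \<Phi> b + \<kappa> / (\<Psi> b - \<Phi> b)" using assms(3) \<kappa>(1) by simp
    have "(\<Phi> b + \<kappa> / (\<Psi> b - \<Phi> b) - \<Phi> b)\<^sup>2 = \<kappa>\<^sup>2 / d" by (simp add: power_divide d_def)
    moreover have "c * \<kappa> \<noteq> \<kappa>\<^sup>2 / d"
      using \<kappa> d by (simp add: field_simps power2_eq_square)
    ultimately show "c * \<kappa> \<noteq> (\<Phi> b + \<kappa> / (\<Psi> b - \<Phi> b) - \<Phi> b)\<^sup>2" by simp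
  qed
  then show ?thesis using \<kappa>(1) by simp
qed

text \<open>A homothety of ratio \<open>2\<close> followed by one of ratio \<open>1/2\<close> with another centre. The first centre is at
  distance \<open>t\<close> from the base value, with \<open>t\<close> chosen so that the second centre differs from the
  base value that it meets.\<close>

lemma constructible_translate:
  assumes "constructible \<Phi> b"
  shows "constructible (\<lambda>q. \<Phi> q + a) b"
proof -
  define t where "t = \<bar>a\<bar> + 1"
  have t: "t > 0" "t \<noteq> - a" by (auto simp: t_def)
  have 1: "constructible (\<lambda>q. (\<Phi> b + t) + 2 * (\<Phi> q - (\<Phi> b + t))) b"
    using t by (intro constructible_combination constructible_const assms) auto
  have "constructible (\<lambda>q. (\<Phi> b + t + 2 * a) + 1/2 * (((\<Phi> b + t) + 2 * (\<Phi> q - (\<Phi> b + t))) - (\<Phi> b + t + 2 * a))) b"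
    (is "constructible ?\<Psi> b")
    using t by (intro constructible_combination constructible_const 1) auto
  moreover have "?\<Psi> = (\<lambda>q. \<Phi> q + a)" by (rule ext) (simp add: field_simps)
  ultimately show ?thesis by (simp only:)
qed

lemma constructible_cmult:
  assumes "constructible \<Phi> b" "c \<noteq> 0"
  shows "constructible (\<lambda>q. c * \<Phi> q) b"
proof -
  have "constructible (\<lambda>q. (\<Phi> b + 1) + c * (\<Phi> q - (\<Phi> b + 1))) b"
    using assms by (intro constructible_combination constructible_const) auto
  from constructible_translate[OF this, of "(c - 1) * (\<Phi> b + 1)"] show ?thesis
    by (simp add: algebra_simps)
qed

text \<open>Twice a midpoint. The translation by \<open>a\<close> separates the base values, as
  \<open>constructible_combination\<close> requires.\<close>

lemma constructible_add:
  assumes "constructible \<Phi> b" "constructible \<Psi> b"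
  shows "constructible (\<lambda>q. \<Phi> q + \<Psi> q) b"
proof -
  define a where "a = \<Phi> b - \<Psi> b + 1"
  have "constructible (\<lambda>q. \<Phi> q + 1/2 * ((\<Psi> q + a) - \<Phi> q)) b"
    by (intro constructible_combination constructible_translate assms) (auto simp: a_def)
  from constructible_translate[OF constructible_cmult[OF this, of 2], of "-a"]
  have "constructible (\<lambda>q. 2 * (\<Phi> q + 1/2 * ((\<Psi> q + a) - \<Phi> q)) + - a) b" by simp
  moreover have "(\<lambda>q. 2 * (\<Phi> q + 1/2 * ((\<Psi> q + a) - \<Phi> q)) + - a) = (\<lambda>q. \<Phi> q + \<Psi> q)"
    by (rule ext) (simp add: field_simps)
  ultimately show ?thesis by (simp only:)
qed

text \<open>Inversion with power \<open>-1\<close> in the fixed centre \<open>0\<close>.\<close>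

lemma constructible_inverse:
  assumes "constructible \<Phi> b" "\<Phi> b \<noteq> 0"
  shows "constructible (\<lambda>q. 1 / \<Phi> q) b"
proof -
  have "(\<Phi> b)\<^sup>2 \<ge> 0" by simp
  then have "-1 \<noteq> (\<Phi> b)\<^sup>2" by linarith
  then have "constructible (\<lambda>q. 0 + (-1) / (\<Phi> q - 0)) b"
    using assms by (intro constructible_inversion constructible_const) auto
  from constructible_cmult[OF this, of "-1"] show ?thesis by simp
qed

text \<open>The identity \<open>1 / (x - t) - 1 / (x + t) = 2 t / (x\<^sup>2 - t\<^sup>2)\<close> gets the square from reciprocals. It fails
  at \<open>x = \<plusminus> t\<close>, which \<open>t > \<bar>\<Phi> b\<bar>\<close> keeps away from the base value.\<close>

lemma constructible_square:
  assumes "constructible \<Phi> b"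
  shows "constructible (\<lambda>q. (\<Phi> q)\<^sup>2) b"
proof -
  define t where "t = \<bar>\<Phi> b\<bar> + 1"
  have t: "t > 0" "\<Phi> b + t \<noteq> 0" "\<Phi> b - t \<noteq> 0" by (auto simp: t_def)
  define \<Psi> where "\<Psi> q = 1 / (\<Phi> q + - t) + (-1) * (1 / (\<Phi> q + t))" for q
  have \<Psi>: "constructible \<Psi> b"
    unfolding \<Psi>_def using t
    by (intro constructible_add constructible_cmult constructible_inverse constructible_translate assms) auto
  have \<Psi>_eq: "1 / \<Psi> q = ((\<Phi> q)\<^sup>2 - t\<^sup>2) / (2 * t)" if "\<Phi> q + t \<noteq> 0" "\<Phi> q - t \<noteq> 0" for q
  proof -
    have "(\<Phi> q)\<^sup>2 - t\<^sup>2 = (\<Phi> q + t) * (\<Phi> q - t)" by (simp add: power2_eq_square algebra_simps)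
    moreover have "\<Psi> q = 2 * t / ((\<Phi> q + t) * (\<Phi> q - t))"
      using that by (simp add: \<Psi>_def field_simps)
    ultimately show ?thesis by simp
  qed
  have "\<Psi> b \<noteq> 0"
  proof
    assume "\<Psi> b = 0"
    then have "(\<Phi> b + t) * (\<Phi> b - t) = 0" using \<Psi>_eq[of b] t by (simp add: power2_eq_square algebra_simps)
    then show False using t by simp
  qed
  then have 1: "constructible (\<lambda>q. 2 * t * (1 / \<Psi> q) + t\<^sup>2) b"
    using t by (intro constructible_translate constructible_cmult constructible_inverse \<Psi>) auto
  show ?thesis
  proof (rule constructible_cong[OF 1])
    have \<Phi>: "(\<Phi> \<longlongrightarrow> \<Phi> b) (nhds b)" using assms by (rule constructible_tendsto)
    have "eventually (\<lambda>q. \<Phi> q + t \<noteq> 0) (nhds b)" "eventually (\<lambda>q. \<Phi> q - t \<noteq> 0) (nhds b)"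
      using t by (intro tendsto_imp_eventually_ne[of _ "\<Phi> b + t"] tendsto_imp_eventually_ne[of _ "\<Phi> b - t"]
          tendsto_intros \<Phi>; simp)+
    then show "eventually (\<lambda>q. 2 * t * (1 / \<Psi> q) + t\<^sup>2 = (\<Phi> q)\<^sup>2) (nhds b)"
      by eventually_elim (use t \<Psi>_eq in simp)
  qed
qed

lemma constructible_mult:
  assumes "constructible \<Phi> b" "constructible \<Psi> b"
  shows "constructible (\<lambda>q. \<Phi> q * \<Psi> q) b"
proof -
  have "constructible (\<lambda>q. 1/2 * ((\<Phi> q + \<Psi> q)\<^sup>2 + ((-1) * (\<Phi> q)\<^sup>2 + (-1) * (\<Psi> q)\<^sup>2))) b"
    (is "constructible ?\<Theta> b")
    by (intro constructible_cmult constructible_add constructible_square assms) auto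
  moreover have "?\<Theta> = (\<lambda>q. \<Phi> q * \<Psi> q)"
    by (rule ext) (simp add: power2_eq_square algebra_simps)
  ultimately show ?thesis by (simp only:)
qed

lemma gate_mono: "gate \<Phi> b \<eta> \<Longrightarrow> \<eta>' \<le> \<eta> \<Longrightarrow> gate \<Phi> b \<eta>'"
  unfolding gate_def by (meson order_less_le_trans)

theorem arithmetic_gates:
  obtains \<eta> where "0 < \<eta>" "\<eta> \<le> 1"
    "gate (\<lambda>q. fst q + snd q) (0, 0) \<eta>" "gate (\<lambda>q. fst q * snd q) (0, 0) \<eta>"
proof -
  have "constructible (\<lambda>q. fst q + snd q) (0, 0)" "constructible (\<lambda>q. fst q * snd q) (0, 0)"
    by (intro constructible_add constructible_mult constructible_fst constructible_snd)+
  then obtain \<eta>1 \<eta>2 where \<eta>1: "\<eta>1 > 0" "gate (\<lambda>q. fst q + snd q) (0, 0) \<eta>1"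
    and \<eta>2: "\<eta>2 > 0" "gate (\<lambda>q. fst q * snd q) (0, 0) \<eta>2"
    unfolding constructible_def by blast
  show thesis
    using \<eta>1(1) \<eta>2(1) gate_mono[OF \<eta>1(2)] gate_mono[OF \<eta>2(2)]
    by (intro that[of "min 1 (min \<eta>1 \<eta>2)"]) auto
qed

section \<open>Real inputs and free points\<close>

text \<open>The point of the unit circle that stereographic projection from \<open>-\<i>\<close> sends to \<open>t\<close>; it is close to \<open>\<i>\<close>
  for small \<open>t\<close>.\<close>

definition stereo :: "real \<Rightarrow> complex" where
  "stereo t = Complex (2 * t / (1 + t\<^sup>2)) ((1 - t\<^sup>2) / (1 + t\<^sup>2))"

lemma one_plus_square_pos: "1 + t\<^sup>2 > 0" for t :: real
  by (simp add: add_pos_nonneg)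

lemma stereo_on_circle: "cmod (stereo t) = 1"
proof -
  have "(2 * t)\<^sup>2 + (1 - t\<^sup>2)\<^sup>2 = (1 + t\<^sup>2)\<^sup>2" by (simp add: power2_eq_square algebra_simps)
  then have "(cmod (stereo t))\<^sup>2 = 1"
    using one_plus_square_pos[of t] by (simp add: stereo_def cmod_power2 power_divide flip: add_divide_distrib)
  then have "cmod (stereo t) = 1 \<or> cmod (stereo t) = - 1" by (simp only: power2_eq_1_iff)
  then show ?thesis using norm_ge_zero[of "stereo t"] by linarith
qed

lemma stereo_near_pole: "(cmod (stereo t - \<i>))\<^sup>2 = 4 * t\<^sup>2 / (1 + t\<^sup>2)"
proof -
  have p: "1 + t\<^sup>2 \<noteq> 0" using one_plus_square_pos[of t] by simp
  have "(Re (stereo t))\<^sup>2 + (Im (stereo t))\<^sup>2 = 1"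
    using stereo_on_circle[of t] cmod_power2[of "stereo t"] by simp
  then have "(cmod (stereo t - \<i>))\<^sup>2 = 2 - 2 * Im (stereo t)"
    by (simp add: cmod_power2 power2_diff)
  also have "\<dots> = 4 * t\<^sup>2 / (1 + t\<^sup>2)" using p by (simp add: stereo_def field_simps)
  finally show ?thesis .
qed

lemma stereo_surj:
  assumes "cmod z = 1" "(cmod (z - \<i>))\<^sup>2 \<le> 4 * \<rho>\<^sup>2 / (1 + \<rho>\<^sup>2)" "\<rho> \<ge> 0"
  obtains t where "\<bar>t\<bar> \<le> \<rho>" "z = stereo t"
proof
  have z: "(Re z)\<^sup>2 + (Im z)\<^sup>2 = 1" using assms(1) cmod_power2[of z] by simp
  have P: "1 + \<rho>\<^sup>2 > 0" by (rule one_plus_square_pos)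
  have "(cmod (z - \<i>))\<^sup>2 = 2 - 2 * Im z" using z by (simp add: cmod_power2 power2_diff)
  then have "2 - 2 * Im z \<le> 4 * \<rho>\<^sup>2 / (1 + \<rho>\<^sup>2)" using assms(2) by simp
  then have "(2 - 2 * Im z) * (1 + \<rho>\<^sup>2) \<le> 4 * \<rho>\<^sup>2" using P by (simp add: pos_le_divide_eq)
  then have im: "1 - Im z \<le> \<rho>\<^sup>2 * (1 + Im z)" by (simp add: algebra_simps)
  have "Im z \<noteq> -1" using im by auto
  moreover have "\<bar>Im z\<bar> \<le> 1" using abs_Im_le_cmod[of z] assms(1) by simp
  ultimately have Q: "1 + Im z > 0" by linarith
  define t where "t = Re z / (1 + Im z)"
  have "(Re z)\<^sup>2 = (1 - Im z) * (1 + Im z)" using z by (simp add: power2_eq_square algebra_simps)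
  then have t2: "t\<^sup>2 = (1 - Im z) / (1 + Im z)"
    using Q by (simp add: t_def power_divide power2_eq_square)
  have "t\<^sup>2 \<le> \<rho>\<^sup>2" unfolding t2 using im Q by (simp add: pos_divide_le_eq)
  then show "\<bar>Re z / (1 + Im z)\<bar> \<le> \<rho>"
    using assms(3) unfolding t_def by (metis abs_le_square_iff abs_of_nonneg)
  have "1 + t\<^sup>2 = 2 / (1 + Im z)" using Q by (simp add: t2 field_simps)
  moreover have "1 - t\<^sup>2 = 2 * Im z / (1 + Im z)" using Q by (simp add: t2 field_simps)
  ultimately have "stereo t = z" using Q by (simp add: stereo_def t_def complex_eq_iff)
  then show "z = stereo (Re z / (1 + Im z))" by (simp add: t_def)
qed

text \<open>Inversion in \<open>-\<i>\<close> with power \<open>2\<close> carries the unit circle to the real axis.\<close>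

lemma inversion_stereo: "inversion 2 (- \<i>) (stereo t) = of_real t"
proof -
  have p: "1 + t\<^sup>2 \<noteq> 0" using one_plus_square_pos[of t] by simp
  have e: "stereo t - - \<i> = of_real (2 / (1 + t\<^sup>2)) * Complex t 1"
    using p by (simp add: stereo_def complex_eq_iff field_simps)
  have "(cmod (stereo t - - \<i>))\<^sup>2 = (2 / (1 + t\<^sup>2))\<^sup>2 * (1 + t\<^sup>2)"
    unfolding e norm_mult power_mult_distrib by (simp add: cmod_power2)
  also have "(2 / u)\<^sup>2 * u = 4 / u" if "u \<noteq> 0" for u :: real
    using that by (simp add: power2_eq_square)
  from this[OF p] have "(2 / (1 + t\<^sup>2))\<^sup>2 * (1 + t\<^sup>2) = 4 / (1 + t\<^sup>2)" .
  finally have "(cmod (stereo t - - \<i>))\<^sup>2 = 4 / (1 + t\<^sup>2)" .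
  then have "inversion 2 (- \<i>) (stereo t) = - \<i> + of_real (2 / (4 / (1 + t\<^sup>2))) * (of_real (2 / (1 + t\<^sup>2)) * Complex t 1)"
    unfolding inversion_def e by simp
  also have "\<dots> = - \<i> + of_real (2 / (4 / (1 + t\<^sup>2)) * (2 / (1 + t\<^sup>2))) * Complex t 1"
    by (simp only: of_real_mult mult.assoc)
  also have "2 / (4 / (1 + t\<^sup>2)) * (2 / (1 + t\<^sup>2)) = 1" using p by simp
  finally show ?thesis by (simp add: complex_eq_iff)
qed

text \<open>Vertices \<open>i < n\<close> are tied by bars of length \<open>1\<close> to \<open>n + k\<close>, fixed at \<open>0\<close>, and by cables of length \<open>\<delta>\<close> to
  \<open>n + k + 1\<close>, fixed at \<open>\<i>\<close>; the \<open>k\<close> vertices from \<open>n\<close> on are isolated.\<close>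

definition input_linkage :: "nat \<Rightarrow> nat \<Rightarrow> real \<Rightarrow> nat linkage" where
  "input_linkage n k \<delta> =
     \<lparr>vertices = {..<n + k + 2},
      edges = (\<lambda>i. {i, n + k}) ` {..<n} \<union> (\<lambda>i. {i, n + k + 1}) ` {..<n},
      edge_length = (\<lambda>e. if n + k \<in> e then 1 else \<delta>),
      fixed = {n + k, n + k + 1},
      position = (\<lambda>v. if v = n + k then 0 else \<i>),
      flexible = (\<lambda>i. {i, n + k + 1}) ` {..<n}\<rparr>"

lemma cabled_linkage_input: "\<delta> > 0 \<Longrightarrow> cabled_linkage (input_linkage n k \<delta>)"
  by (auto simp: cabled_linkage_def input_linkage_def)

lemma configuration_space_input:
  "\<phi> \<in> configuration_space (input_linkage n k \<delta>) \<longleftrightarrow>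
     \<phi> \<in> {..<n + k + 2} \<rightarrow>\<^sub>E UNIV \<and> \<phi> (n + k) = 0 \<and> \<phi> (n + k + 1) = \<i> \<and>
     (\<forall>i<n. cmod (\<phi> i) = 1 \<and> cmod (\<phi> i - \<i>) \<le> \<delta>)"
proof -
  let ?L = "input_linkage n k \<delta>"
  have pinned: "(\<forall>v\<in>fixed ?L. \<phi> v = position ?L v) \<longleftrightarrow> \<phi> (n + k) = 0 \<and> \<phi> (n + k + 1) = \<i>"
    by (simp add: input_linkage_def)
  have flex: "{v, w} \<in> flexible ?L \<longleftrightarrow> (v < n \<and> w = n + k + 1) \<or> (w < n \<and> v = n + k + 1)" for v w
    by (auto simp: input_linkage_def doubleton_eq_iff)
  have rigid: "{v, w} \<in> edges ?L - flexible ?L \<longleftrightarrow> (v < n \<and> w = n + k) \<or> (w < n \<and> v = n + k)" for v w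
  proof -
    have bar: "{v, w} \<in> (\<lambda>i. {i, n + k}) ` {..<n} \<longleftrightarrow> (v < n \<and> w = n + k) \<or> (w < n \<and> v = n + k)"
      by (auto simp: doubleton_eq_iff)
    have "edges ?L = (\<lambda>i. {i, n + k}) ` {..<n} \<union> flexible ?L" by (simp add: input_linkage_def)
    then show ?thesis by (simp only: Diff_iff Un_iff bar flex) arith
  qed
  have len: "edge_length ?L {v, w} = (if n + k = v \<or> n + k = w then 1 else \<delta>)" for v w
    by (simp add: input_linkage_def)
  have verts: "vertices ?L = {..<n + k + 2}" by (simp add: input_linkage_def)
  have flexes: "(\<forall>v w. {v, w} \<in> flexible ?L \<longrightarrow> cmod (\<phi> v - \<phi> w) \<le> edge_length ?L {v, w}) \<longleftrightarrow>
      (\<forall>i<n. cmod (\<phi> i - \<phi> (n + k + 1)) \<le> \<delta>)"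
    unfolding flex len by (auto simp: norm_minus_commute)
  have rigids: "(\<forall>v w. {v, w} \<in> edges ?L - flexible ?L \<longrightarrow> cmod (\<phi> v - \<phi> w) = edge_length ?L {v, w}) \<longleftrightarrow>
      (\<forall>i<n. cmod (\<phi> i - \<phi> (n + k)) = 1)"
    unfolding rigid len by (auto simp: norm_minus_commute)
  show ?thesis
    unfolding configuration_space_def mem_Collect_eq flexes rigids pinned verts by auto
qed

definition free_point :: "nat \<Rightarrow> nat \<Rightarrow> (nat \<Rightarrow> real) \<Rightarrow> complex" where
  "free_point n j y = Complex (y (n + 2 * j)) (y (n + 2 * j + 1))"

lemma plane_analytic_stereo:
  assumes "finite I" "U \<subseteq> I \<rightarrow>\<^sub>E UNIV" "i \<in> I"
  shows "plane_analytic I U (\<lambda>y. stereo (\<epsilon> * y i))"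
  unfolding plane_analytic_def
proof
  fix a assume "a \<in> U"
  then have a: "a \<in> I \<rightarrow>\<^sub>E UNIV" using assms(2) by blast
  have t: "analytic_at I (\<lambda>y. \<epsilon> * y i) a"
    by (intro analytic_at_cmult analytic_at_coord assms)
  have "1 + (\<epsilon> * a i)\<^sup>2 \<noteq> 0" using one_plus_square_pos[of "\<epsilon> * a i"] by linarith
  then have inv: "analytic_at I (\<lambda>y. inverse (1 + (\<epsilon> * y i)\<^sup>2)) a"
    by (intro analytic_at_inverse analytic_at_add analytic_at_const analytic_at_square assms a t)
  have "analytic_at I (\<lambda>y. 2 * ((\<epsilon> * y i) * inverse (1 + (\<epsilon> * y i)\<^sup>2))) a"
    "analytic_at I (\<lambda>y. (1 - (\<epsilon> * y i)\<^sup>2) * inverse (1 + (\<epsilon> * y i)\<^sup>2)) a"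
    by (intro analytic_at_cmult analytic_at_mult analytic_at_diff analytic_at_const analytic_at_square assms a t inv)+
  moreover have "Re (stereo (\<epsilon> * y i)) = 2 * ((\<epsilon> * y i) * inverse (1 + (\<epsilon> * y i)\<^sup>2))"
    "Im (stereo (\<epsilon> * y i)) = (1 - (\<epsilon> * y i)\<^sup>2) * inverse (1 + (\<epsilon> * y i)\<^sup>2)" for y
    unfolding stereo_def complex.sel divide_real_def by (simp_all only: mult.assoc)
  ultimately show "analytic_at I (\<lambda>y. Re (stereo (\<epsilon> * y i))) a \<and> analytic_at I (\<lambda>y. Im (stereo (\<epsilon> * y i))) a"
    by (simp only:)
qed

definition input_box :: "nat \<Rightarrow> nat \<Rightarrow> real \<Rightarrow> (nat \<Rightarrow> real) set" where
  "input_box n m M = {y \<in> {..<n + m} \<rightarrow>\<^sub>E UNIV. \<forall>i<n. \<bar>y i\<bar> < M}"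

lemma openin_input_box: "openin (powertop_real {..<n + m}) (input_box n m M)"
proof -
  have "input_box n m M = (\<Pi>\<^sub>E i\<in>{..<n + m}. if i < n then {- M <..< M} else UNIV)"
  proof (rule set_eqI)
    fix y :: "nat \<Rightarrow> real"
    have "\<bar>y i\<bar> < M \<longleftrightarrow> y i \<in> {- M <..< M}" for i by auto
    then have "(i < n \<longrightarrow> \<bar>y i\<bar> < M) \<longleftrightarrow> y i \<in> (if i < n then {- M <..< M} else UNIV)" for i by simp
    moreover have "(\<forall>i<n. \<bar>y i\<bar> < M) \<longleftrightarrow> (\<forall>i\<in>{..<n + m}. i < n \<longrightarrow> \<bar>y i\<bar> < M)" by auto
    ultimately show "y \<in> input_box n m M \<longleftrightarrow> y \<in> (\<Pi>\<^sub>E i\<in>{..<n + m}. if i < n then {- M <..< M} else UNIV)"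
      by (simp add: input_box_def PiE_iff) blast
  qed
  then show ?thesis by (simp add: openin_PiE)
qed

text \<open>Each tied vertex sweeps a symmetric arc about \<open>\<i>\<close>, and stereographic projection turns it into the interval
  from \<open>-\<rho>\<close> to \<open>\<rho>\<close>. The parameters are rescaled by \<open>\<epsilon>\<close>, so that a cube of any size \<open>M\<close> can be covered by
  small motions.\<close>

lemma input_linkage_parametrized:
  assumes "\<rho> > 0" "\<epsilon> > 0" "\<epsilon> * M = \<rho>" "M < M'"
  shows "realizable {..<n + 2 * k} (input_box n (2 * k) M')
     {y \<in> {..<n + 2 * k} \<rightarrow>\<^sub>E UNIV. \<forall>i<n. \<bar>y i\<bar> \<le> M}
     ((\<lambda>i y. stereo (\<epsilon> * y i)) ` {..<n} \<union> free_point n ` {..<k})"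
    (is "realizable ?I ?U ?Y ?F")
proof -
  \<comment> \<open>The distance from \<open>\<i>\<close> to \<open>stereo \<rho>\<close>, by \<open>stereo_near_pole\<close>.\<close>
  define \<delta> where "\<delta> = sqrt (4 * \<rho>\<^sup>2 / (1 + \<rho>\<^sup>2))"
  have P: "1 + \<rho>\<^sup>2 > 0" by (rule one_plus_square_pos)
  have \<delta>: "\<delta> > 0" "\<delta>\<^sup>2 = 4 * \<rho>\<^sup>2 / (1 + \<rho>\<^sup>2)"
    using assms(1) P by (simp_all add: \<delta>_def)
  have le_\<delta>: "cmod z \<le> \<delta> \<longleftrightarrow> (cmod z)\<^sup>2 \<le> 4 * \<rho>\<^sup>2 / (1 + \<rho>\<^sup>2)" for z
    using \<delta> by (metis abs_le_square_iff abs_norm_cancel abs_of_pos)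
  have M: "M > 0" using assms(1-3) by (metis zero_less_mult_pos)
  let ?L = "input_linkage n k \<delta>"
  define G where "G v = (if v < n then (\<lambda>y. stereo (\<epsilon> * y v)) else if v < n + k then free_point n (v - n)
     else if v = n + k then (\<lambda>_. 0) else (\<lambda>_. \<i>))" for v
  have verts: "vertices ?L = {..<n + k + 2}" by (simp add: input_linkage_def)
  have U: "?U \<subseteq> ?I \<rightarrow>\<^sub>E UNIV" by (auto simp: input_box_def)
  have an: "plane_analytic ?I ?U (G v)" for v
  proof -
    consider "v < n" | "n \<le> v" "v < n + k" | "n + k \<le> v" by linarith
    then show ?thesis
    proof cases
      case 1
      then show ?thesis using plane_analytic_stereo[OF _ U, of v \<epsilon>] by (simp add: G_def)
    next
      case 2
      then have "n + 2 * (v - n) \<in> ?I" "n + 2 * (v - n) + 1 \<in> ?I" by auto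
      then have "plane_analytic ?I ?U (free_point n (v - n))"
        unfolding plane_analytic_def free_point_def by (simp add: analytic_at_coord)
      then show ?thesis using 2 by (simp add: G_def)
    next
      case 3
      then show ?thesis by (simp add: G_def plane_analytic_const)
    qed
  qed
  have "configuration_space ?L = (\<lambda>y. \<lambda>v\<in>{..<n + k + 2}. G v y) ` ?Y"
  proof (intro set_eqI iffI)
    fix \<phi> assume "\<phi> \<in> configuration_space ?L"
    then have \<phi>: "\<phi> \<in> {..<n + k + 2} \<rightarrow>\<^sub>E UNIV" "\<phi> (n + k) = 0" "\<phi> (n + k + 1) = \<i>"
      and rod: "\<forall>i<n. cmod (\<phi> i) = 1 \<and> cmod (\<phi> i - \<i>) \<le> \<delta>"
      unfolding configuration_space_input by blast+
    have "\<exists>t. \<bar>t\<bar> \<le> \<rho> \<and> \<phi> i = stereo t" if "i < n" for i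
      using stereo_surj[of "\<phi> i" \<rho>] rod that assms(1) unfolding le_\<delta> by (metis less_imp_le)
    then obtain t where t: "\<And>i. i < n \<Longrightarrow> \<bar>t i\<bar> \<le> \<rho> \<and> \<phi> i = stereo (t i)" by metis
    define y where "y = (\<lambda>i\<in>?I. if i < n then t i / \<epsilon> else
        if even (i - n) then Re (\<phi> (n + (i - n) div 2)) else Im (\<phi> (n + (i - n) div 2)))"
    have y1: "y i = t i / \<epsilon>" if "i < n" for i using that by (simp add: y_def)
    have "\<bar>y i\<bar> \<le> M" if "i < n" for i
    proof -
      have "\<bar>t i\<bar> \<le> \<epsilon> * M" using t[OF that] assms(3) by simp
      then show ?thesis
        unfolding y1[OF that] abs_divide using assms(2) by (simp add: pos_divide_le_eq mult.commute)
    qed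
    then have "y \<in> ?Y" by (auto simp: y_def)
    moreover have "\<phi> = (\<lambda>v\<in>{..<n + k + 2}. G v y)"
    proof
      fix v
      consider "v < n" | "n \<le> v" "v < n + k" | "v = n + k" | "v = n + k + 1" | "v \<ge> n + k + 2" by linarith
      then show "\<phi> v = (\<lambda>v\<in>{..<n + k + 2}. G v y) v"
      proof cases
        case 1 then show ?thesis using t[OF 1] y1[OF 1] assms(2) by (simp add: G_def)
      next
        case 2
        then have "y (n + 2 * (v - n)) = Re (\<phi> v)" "y (n + 2 * (v - n) + 1) = Im (\<phi> v)"
          by (auto simp: y_def)
        then show ?thesis using 2 by (simp add: G_def free_point_def)
      next
        case 3 then show ?thesis using \<phi> by (simp add: G_def)
      next
        case 4 then show ?thesis using \<phi> by (simp add: G_def)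
      next
        case 5 then show ?thesis using \<phi>(1) by (simp add: PiE_iff extensional_def)
      qed
    qed
    ultimately show "\<phi> \<in> (\<lambda>y. \<lambda>v\<in>{..<n + k + 2}. G v y) ` ?Y" by blast
  next
    fix \<phi> assume "\<phi> \<in> (\<lambda>y. \<lambda>v\<in>{..<n + k + 2}. G v y) ` ?Y"
    then obtain y where y: "y \<in> ?Y" and \<phi>: "\<phi> = (\<lambda>v\<in>{..<n + k + 2}. G v y)" by blast
    have "cmod (\<phi> i) = 1 \<and> cmod (\<phi> i - \<i>) \<le> \<delta>" if "i < n" for i
    proof -
      have \<phi>i: "\<phi> i = stereo (\<epsilon> * y i)" using that by (simp add: \<phi> G_def)
      have "\<bar>\<epsilon> * y i\<bar> \<le> \<bar>\<rho>\<bar>"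
        using y that assms(1,2) M by (simp add: abs_mult flip: assms(3))
      then have le: "(\<epsilon> * y i)\<^sup>2 \<le> \<rho>\<^sup>2" by (simp only: abs_le_square_iff)
      have "4 * (\<epsilon> * y i)\<^sup>2 / (1 + (\<epsilon> * y i)\<^sup>2) \<le> 4 * \<rho>\<^sup>2 / (1 + \<rho>\<^sup>2)"
      proof -
        have "4 * (\<epsilon> * y i)\<^sup>2 * (1 + \<rho>\<^sup>2) \<le> 4 * \<rho>\<^sup>2 * (1 + (\<epsilon> * y i)\<^sup>2)"
          using le by (simp add: algebra_simps)
        then show ?thesis using P one_plus_square_pos[of "\<epsilon> * y i"] by (simp add: divide_le_eq pos_le_divide_eq field_simps)
      qed
      then show ?thesis unfolding \<phi>i le_\<delta> stereo_near_pole by (simp add: stereo_on_circle)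
    qed
    then show "\<phi> \<in> configuration_space ?L"
      unfolding configuration_space_input by (auto simp: \<phi> G_def)
  qed
  then have par: "parametrizes ?I ?U ?Y ?L G"
    using an cabled_linkage_input[OF \<delta>(1)] by (simp add: parametrizes_def verts)
  have "?Y \<subseteq> ?U" using assms(4) by (auto simp: input_box_def intro: le_less_trans)
  moreover have "(\<lambda>i\<in>?I. 0) \<in> ?U" using M assms(4) by (auto simp: input_box_def)
  then have "?U \<noteq> {}" by blast
  moreover have "\<exists>v\<in>vertices ?L. \<forall>y\<in>?U. G v y = f y" if "f \<in> ?F" for f
  proof -
    from that consider i where "i < n" "f = (\<lambda>y. stereo (\<epsilon> * y i))" | j where "j < k" "f = free_point n j"
      by blast
    then show ?thesis
    proof cases
      case 1 then show ?thesis by (intro bexI[of _ i]) (auto simp: verts G_def)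
    next
      case 2 then show ?thesis by (intro bexI[of _ "n + j"]) (auto simp: verts G_def)
    qed
  qed
  ultimately show ?thesis
    unfolding realizable_def using par openin_input_box by blast
qed

section \<open>Compact quasialgebraic sets as configuration spaces\<close>

text \<open>Quantifying over \<open>Y\<close> and over all \<open>\<F> \<supseteq> \<B>\<close> makes this a property of \<open>f\<close> alone that survives later
  vertices and later constraints.\<close>

definition realizable_over ::
  "nat set \<Rightarrow> (nat \<Rightarrow> real) set \<Rightarrow> ((nat \<Rightarrow> real) \<Rightarrow> complex) set \<Rightarrow> ((nat \<Rightarrow> real) \<Rightarrow> real) \<Rightarrow> bool" where
  "realizable_over I U \<B> f \<longleftrightarrow>
     (\<forall>Y \<F>. \<B> \<subseteq> \<F> \<longrightarrow> realizable I U Y \<F> \<longrightarrow>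
        realizable I U Y (insert (\<lambda>y. complex_of_real (f y)) \<F>))"

lemma realizable_overD:
  assumes "realizable_over I U \<B> f" "\<B> \<subseteq> \<F>" "realizable I U Y \<F>"
  shows "realizable I U Y (insert (\<lambda>y. complex_of_real (f y)) \<F>)"
  using assms unfolding realizable_over_def by blast

lemma realizable_over_const: "realizable_over I U \<B> (\<lambda>_. c)"
  unfolding realizable_over_def by (simp add: realizable_const)

lemma realizable_over_base:
  "(\<lambda>y. complex_of_real (f y)) \<in> \<B> \<Longrightarrow> realizable_over I U \<B> f"
  unfolding realizable_over_def by (auto simp: insert_absorb subset_iff)

lemma realizable_over_gate:
  assumes gate: "gate \<Phi> (0, 0) \<eta>" and fg: "realizable_over I U \<B> f" "realizable_over I U \<B> g"
    and bound: "\<And>y. y \<in> U \<Longrightarrow> \<bar>f y\<bar> < \<eta>" "\<And>y. y \<in> U \<Longrightarrow> \<bar>g y\<bar> < \<eta>"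
  shows "realizable_over I U \<B> (\<lambda>y. \<Phi> (f y, g y))"
  unfolding realizable_over_def
proof (intro allI impI)
  fix Y \<F> assume B: "\<B> \<subseteq> \<F>" and R: "realizable I U Y \<F>"
  let ?f = "\<lambda>y. complex_of_real (f y)" and ?g = "\<lambda>y. complex_of_real (g y)"
  have R2: "realizable I U Y (insert ?g (insert ?f \<F>))"
    by (rule realizable_overD[OF fg(2) _ realizable_overD[OF fg(1) B R]]) (use B in auto)
  have "realizable I U Y (insert (\<lambda>y. complex_of_real (\<Phi> (f y, g y))) (insert ?g (insert ?f \<F>)))"
    by (rule gateD[OF gate R2]) (use bound in auto)
  then show "realizable I U Y (insert (\<lambda>y. complex_of_real (\<Phi> (f y, g y))) \<F>)"
    by (rule realizable_mono) auto
qed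

text \<open>Since \<open>\<eta> \<le> 1\<close>, products of quantities bounded by \<open>\<eta>\<close> stay bounded by \<open>\<eta>\<close>; for sums the bound comes
  from the coefficients.\<close>

locale small_inputs =
  fixes I :: "nat set" and U :: "(nat \<Rightarrow> real) set" and \<B> :: "((nat \<Rightarrow> real) \<Rightarrow> complex) set"
    and \<eta> :: real and n :: nat and \<tau> :: "nat \<Rightarrow> (nat \<Rightarrow> real) \<Rightarrow> real"
  assumes \<eta>: "0 < \<eta>" "\<eta> \<le> 1"
    and gates: "gate (\<lambda>q. fst q + snd q) (0, 0) \<eta>" "gate (\<lambda>q. fst q * snd q) (0, 0) \<eta>"
    and inputs: "\<And>i. i < n \<Longrightarrow> (\<lambda>y. complex_of_real (\<tau> i y)) \<in> \<B>"
    and small: "\<And>i y. i < n \<Longrightarrow> y \<in> U \<Longrightarrow> \<bar>\<tau> i y\<bar> < \<eta>"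
begin

lemma realizable_over_add:
  assumes "realizable_over I U \<B> f" "realizable_over I U \<B> g"
    "\<And>y. y \<in> U \<Longrightarrow> \<bar>f y\<bar> < \<eta>" "\<And>y. y \<in> U \<Longrightarrow> \<bar>g y\<bar> < \<eta>"
  shows "realizable_over I U \<B> (\<lambda>y. f y + g y)"
  using realizable_over_gate[OF gates(1) assms] by simp

lemma realizable_over_mult_power:
  assumes f: "realizable_over I U \<B> f" "\<And>y. y \<in> U \<Longrightarrow> \<bar>f y\<bar> < \<eta>" and i: "i < n"
  shows "realizable_over I U \<B> (\<lambda>y. f y * \<tau> i y ^ m)"
    and "\<And>y. y \<in> U \<Longrightarrow> \<bar>f y * \<tau> i y ^ m\<bar> < \<eta>"
proof -
  have bound: "\<bar>f y * \<tau> i y ^ m\<bar> < \<eta>" if "y \<in> U" for y m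
  proof -
    have "\<bar>\<tau> i y\<bar> ^ m \<le> 1"
      using small[OF i that] \<eta> by (intro power_le_one) auto
    then have "\<bar>f y\<bar> * \<bar>\<tau> i y\<bar> ^ m \<le> \<bar>f y\<bar> * 1" by (intro mult_left_mono) auto
    then show ?thesis using f(2)[OF that] by (simp add: abs_mult power_abs)
  qed
  then show "\<And>y. y \<in> U \<Longrightarrow> \<bar>f y * \<tau> i y ^ m\<bar> < \<eta>" .
  show "realizable_over I U \<B> (\<lambda>y. f y * \<tau> i y ^ m)"
  proof (induction m)
    case 0 then show ?case using f(1) by simp
  next
    case (Suc m)
    have "realizable_over I U \<B> (\<lambda>y. (f y * \<tau> i y ^ m) * \<tau> i y)"
      using realizable_over_gate[OF gates(2) Suc realizable_over_base[OF inputs[OF i]] bound small[OF i]]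
      by simp
    then show ?case by (simp add: mult_ac)
  qed
qed

lemma realizable_over_monomial:
  assumes "\<bar>c\<bar> < \<eta>" "m \<le> n"
  shows "realizable_over I U \<B> (\<lambda>y. c * (\<Prod>i<m. \<tau> i y ^ \<alpha> i)) \<and>
     (\<forall>y\<in>U. \<bar>c * (\<Prod>i<m. \<tau> i y ^ \<alpha> i)\<bar> < \<eta>)"
  using assms(2)
proof (induction m)
  case 0 then show ?case using assms(1) by (simp add: realizable_over_const)
next
  case (Suc m)
  then have IH: "realizable_over I U \<B> (\<lambda>y. c * (\<Prod>i<m. \<tau> i y ^ \<alpha> i))"
     "\<And>y. y \<in> U \<Longrightarrow> \<bar>c * (\<Prod>i<m. \<tau> i y ^ \<alpha> i)\<bar> < \<eta>" and m: "m < n" by auto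
  show ?case
    using realizable_over_mult_power[OF IH m, where m = "\<alpha> m"] by (simp add: mult.assoc)
qed

lemma abs_monomial_inputs_le_1:
  assumes "y \<in> U"
  shows "\<bar>\<Prod>i<n. \<tau> i y ^ \<alpha> i\<bar> \<le> 1"
  unfolding abs_prod
proof (rule prod_le_1)
  fix i assume "i \<in> {..<n}"
  then have "\<bar>\<tau> i y\<bar> < \<eta>" using small assms by simp
  then show "0 \<le> \<bar>\<tau> i y ^ \<alpha> i\<bar> \<and> \<bar>\<tau> i y ^ \<alpha> i\<bar> \<le> 1"
    using \<eta>(2) by (simp add: power_abs power_le_one)
qed

lemma realizable_over_polynomial:
  assumes "finite A" "(\<Sum>\<alpha>\<in>A. \<bar>c \<alpha>\<bar>) < \<eta>"
  shows "realizable_over I U \<B> (\<lambda>y. \<Sum>\<alpha>\<in>A. c \<alpha> * (\<Prod>i<n. \<tau> i y ^ \<alpha> i))"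
    and "\<And>y. y \<in> U \<Longrightarrow> \<bar>\<Sum>\<alpha>\<in>A. c \<alpha> * (\<Prod>i<n. \<tau> i y ^ \<alpha> i)\<bar> < \<eta>"
proof -
  have bound: "\<bar>\<Sum>\<alpha>\<in>A. c \<alpha> * (\<Prod>i<n. \<tau> i y ^ \<alpha> i)\<bar> \<le> (\<Sum>\<alpha>\<in>A. \<bar>c \<alpha>\<bar>)" if "y \<in> U" for y A
  proof -
    have "\<bar>\<Sum>\<alpha>\<in>A. c \<alpha> * (\<Prod>i<n. \<tau> i y ^ \<alpha> i)\<bar> \<le> (\<Sum>\<alpha>\<in>A. \<bar>c \<alpha> * (\<Prod>i<n. \<tau> i y ^ \<alpha> i)\<bar>)"
      by (rule sum_abs)
    also have "\<dots> \<le> (\<Sum>\<alpha>\<in>A. \<bar>c \<alpha>\<bar>)"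
    proof (rule sum_mono)
      fix \<alpha>
      have "\<bar>c \<alpha>\<bar> * \<bar>\<Prod>i<n. \<tau> i y ^ \<alpha> i\<bar> \<le> \<bar>c \<alpha>\<bar> * 1"
        by (rule mult_left_mono[OF abs_monomial_inputs_le_1[OF that]]) simp
      then show "\<bar>c \<alpha> * (\<Prod>i<n. \<tau> i y ^ \<alpha> i)\<bar> \<le> \<bar>c \<alpha>\<bar>" by (simp add: abs_mult)
    qed
    finally show ?thesis .
  qed
  show "\<And>y. y \<in> U \<Longrightarrow> \<bar>\<Sum>\<alpha>\<in>A. c \<alpha> * (\<Prod>i<n. \<tau> i y ^ \<alpha> i)\<bar> < \<eta>"
    using bound assms(2) by (rule le_less_trans)
  show "realizable_over I U \<B> (\<lambda>y. \<Sum>\<alpha>\<in>A. c \<alpha> * (\<Prod>i<n. \<tau> i y ^ \<alpha> i))"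
    using assms
  proof (induction A rule: finite_induct)
    case empty then show ?case by (simp add: realizable_over_const)
  next
    case (insert \<alpha> A)
    have s: "\<bar>c \<alpha>\<bar> + (\<Sum>\<alpha>\<in>A. \<bar>c \<alpha>\<bar>) < \<eta>" using insert by simp
    moreover have "(\<Sum>\<alpha>\<in>A. \<bar>c \<alpha>\<bar>) \<ge> 0" by (simp add: sum_nonneg)
    ultimately have s': "\<bar>c \<alpha>\<bar> < \<eta>" "(\<Sum>\<alpha>\<in>A. \<bar>c \<alpha>\<bar>) < \<eta>" by linarith+
    have "realizable_over I U \<B> (\<lambda>y. c \<alpha> * (\<Prod>i<n. \<tau> i y ^ \<alpha> i) + (\<Sum>\<alpha>\<in>A. c \<alpha> * (\<Prod>i<n. \<tau> i y ^ \<alpha> i)))"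
      using realizable_over_monomial[OF s'(1) order_refl, of \<alpha>] insert.IH[OF s'(2)] bound s'(2)
      by (intro realizable_over_add) (auto intro: le_less_trans)
    then show ?case using insert by simp
  qed
qed

end

text \<open>The factor \<open>l\<close> makes the coefficients of \<open>p\<close>, rewritten in the inputs \<open>\<epsilon> * y i\<close>, so small that every
  intermediate result of evaluating \<open>l * p\<close> stays within the range of the gates. It changes
  neither the zeros nor the sign of \<open>p\<close>.\<close>

lemma realizable_scaled_polynomial:
  assumes S: "small_inputs U \<B> \<eta> n (\<lambda>i y. \<epsilon> * y i)" and "\<epsilon> > 0"
    and p: "polynomial_on {..<n} p"
  obtains g l where "l > 0" "realizable_over I U \<B> g"
    "\<And>y. g y = l * p (restrict y {..<n})" "\<And>y. y \<in> U \<Longrightarrow> \<bar>g y\<bar> < \<eta>"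
proof -
  interpret small_inputs I U \<B> \<eta> n "\<lambda>i y. \<epsilon> * y i" by (rule S)
  obtain A c where A: "finite A" and p: "\<And>x. x \<in> {..<n} \<rightarrow>\<^sub>E UNIV \<Longrightarrow> p x = (\<Sum>\<alpha>\<in>A. c \<alpha> * monomial {..<n} \<alpha> x)"
    using p unfolding polynomial_on_def by blast
  define d where "d \<alpha> = c \<alpha> / (\<Prod>i<n. \<epsilon> ^ \<alpha> i)" for \<alpha>
  define K where "K = (\<Sum>\<alpha>\<in>A. \<bar>d \<alpha>\<bar>)"
  have K: "K \<ge> 0" by (simp add: K_def sum_nonneg)
  define l where "l = \<eta> / (K + 1)"
  have l: "l > 0" using \<eta> K by (simp add: l_def)
  have "(\<Sum>\<alpha>\<in>A. \<bar>l * d \<alpha>\<bar>) = l * K" using l by (simp add: abs_mult K_def sum_distrib_left)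
  also have "\<dots> < \<eta>" using \<eta> K by (simp add: l_def pos_divide_less_eq algebra_simps)
  finally have small: "(\<Sum>\<alpha>\<in>A. \<bar>l * d \<alpha>\<bar>) < \<eta>" .
  define g where "g y = (\<Sum>\<alpha>\<in>A. (l * d \<alpha>) * (\<Prod>i<n. (\<epsilon> * y i) ^ \<alpha> i))" for y
  have "g y = l * p (restrict y {..<n})" for y
  proof -
    have "d \<alpha> * (\<Prod>i<n. (\<epsilon> * y i) ^ \<alpha> i) = c \<alpha> * monomial {..<n} \<alpha> (restrict y {..<n})" for \<alpha>
      using \<open>\<epsilon> > 0\<close> by (simp add: d_def monomial_def power_mult_distrib prod.distrib)
    then show ?thesis by (simp add: g_def p sum_distrib_left mult.assoc)
  qed
  then show thesis
    using that[OF l, of g] realizable_over_polynomial[OF A small] unfolding g_def by blast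
qed

text \<open>On the real axis, the discs of radius \<open>1\<close> about \<open>1\<close> and \<open>-1\<close> cut out the half-lines near \<open>0\<close>; they
  touch in \<open>0\<close> only.\<close>

lemma realizable_polynomial_constraint:
  assumes S: "small_inputs U \<B> \<eta> n (\<lambda>i y. \<epsilon> * y i)" and "\<epsilon> > 0"
    and p: "polynomial_on {..<n} p" and R: "realizable I U Y \<B>"
  shows "realizable I U {y \<in> Y. p (restrict y {..<n}) = 0} \<B>"
    and "realizable I U {y \<in> Y. p (restrict y {..<n}) \<ge> 0} \<B>"
proof -
  obtain g l where l: "l > 0" and g: "realizable_over I U \<B> g"
    "\<And>y. g y = l * p (restrict y {..<n})" "\<And>y. y \<in> U \<Longrightarrow> \<bar>g y\<bar> < \<eta>"
    by (rule realizable_scaled_polynomial[OF S \<open>\<epsilon> > 0\<close> p]) (rule that)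
  have "\<eta> \<le> 1" using S by (simp add: small_inputs_def)
  have "Y \<subseteq> U" by (rule realizable_domain[OF R])
  then have small: "\<bar>g y\<bar> < 1" if "y \<in> Y" for y using g(3)[of y] that \<open>\<eta> \<le> 1\<close> by auto
  let ?g = "\<lambda>y. complex_of_real (g y)"
  have R1: "realizable I U Y (insert ?g \<B>)" by (rule realizable_overD[OF g(1) order_refl R])
  have disk: "cmod (?g y - of_real a) \<le> 1 \<longleftrightarrow> \<bar>g y - a\<bar> \<le> 1" for y a
    by (metis of_real_diff norm_of_real)
  have R2: "realizable I U {y \<in> Y. cmod (?g y - of_real 1) \<le> 1} (insert ?g \<B>)"
    by (rule realizable_disk[OF R1]) auto
  also have "{y \<in> Y. cmod (?g y - of_real 1) \<le> 1} = {y \<in> Y. p (restrict y {..<n}) \<ge> 0}"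
  proof -
    have "\<bar>g y - 1\<bar> \<le> 1 \<longleftrightarrow> p (restrict y {..<n}) \<ge> 0" if "y \<in> Y" for y
    proof -
      have "\<bar>g y - 1\<bar> \<le> 1 \<longleftrightarrow> g y \<ge> 0" using small[OF that] by auto
      then show ?thesis using l by (simp add: g(2) zero_le_mult_iff)
    qed
    then show ?thesis unfolding disk by blast
  qed
  finally show "realizable I U {y \<in> Y. p (restrict y {..<n}) \<ge> 0} \<B>"
    by (rule realizable_mono) auto
  have "realizable I U {y \<in> {y \<in> Y. cmod (?g y - of_real 1) \<le> 1}. cmod (?g y - of_real (-1)) \<le> 1} (insert ?g \<B>)"
    by (rule realizable_disk[OF R2]) auto
  also have "{y \<in> {y \<in> Y. cmod (?g y - of_real 1) \<le> 1}. cmod (?g y - of_real (-1)) \<le> 1} =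
      {y \<in> Y. p (restrict y {..<n}) = 0}"
  proof -
    have "\<bar>g y - 1\<bar> \<le> 1 \<and> \<bar>g y - (-1)\<bar> \<le> 1 \<longleftrightarrow> p (restrict y {..<n}) = 0" for y
    proof -
      have "\<bar>g y - 1\<bar> \<le> 1 \<and> \<bar>g y - (-1)\<bar> \<le> 1 \<longleftrightarrow> g y = 0" by auto
      then show ?thesis using l by (simp add: g(2))
    qed
    then show ?thesis unfolding disk by blast
  qed
  finally show "realizable I U {y \<in> Y. p (restrict y {..<n}) = 0} \<B>"
    by (rule realizable_mono) auto
qed

lemma realizable_polynomial_constraints:
  assumes S: "small_inputs U \<B> \<eta> n (\<lambda>i y. \<epsilon> * y i)" and "\<epsilon> > 0"
    and R: "realizable I U Y \<B>"
    and "finite P" "finite Q" "\<forall>p\<in>P \<union> Q. polynomial_on {..<n} p"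
  shows "realizable I U {y \<in> Y. (\<forall>p\<in>P. p (restrict y {..<n}) = 0) \<and> (\<forall>q\<in>Q. q (restrict y {..<n}) \<ge> 0)} \<B>"
proof -
  have 1: "realizable I U {y \<in> Y. \<forall>p\<in>P. p (restrict y {..<n}) = 0} \<B>"
    using assms(4,6)
  proof (induction P rule: finite_induct)
    case empty then show ?case using R by simp
  next
    case (insert p P)
    then have "realizable I U {y \<in> {y \<in> Y. \<forall>p\<in>P. p (restrict y {..<n}) = 0}. p (restrict y {..<n}) = 0} \<B>"
      by (intro realizable_polynomial_constraint(1)[OF S \<open>\<epsilon> > 0\<close>]) auto
    also have "{y \<in> {y \<in> Y. \<forall>p\<in>P. p (restrict y {..<n}) = 0}. p (restrict y {..<n}) = 0} =
       {y \<in> Y. \<forall>p\<in>insert p P. p (restrict y {..<n}) = 0}" by blast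
    finally show ?case .
  qed
  let ?Z = "{y \<in> Y. \<forall>p\<in>P. p (restrict y {..<n}) = 0}"
  have "realizable I U {y \<in> ?Z. \<forall>q\<in>Q. q (restrict y {..<n}) \<ge> 0} \<B>"
    using assms(5,6)
  proof (induction Q rule: finite_induct)
    case empty
    show ?case using 1 by (rule back_subst[of "\<lambda>Z. realizable I U Z \<B>"]) blast
  next
    case (insert q Q)
    then have "realizable I U {y \<in> {y \<in> ?Z. \<forall>q\<in>Q. q (restrict y {..<n}) \<ge> 0}. q (restrict y {..<n}) \<ge> 0} \<B>"
      by (intro realizable_polynomial_constraint(2)[OF S \<open>\<epsilon> > 0\<close>]) auto
    also have "{y \<in> {y \<in> ?Z. \<forall>q\<in>Q. q (restrict y {..<n}) \<ge> 0}. q (restrict y {..<n}) \<ge> 0} =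
       {y \<in> ?Z. \<forall>q\<in>insert q Q. q (restrict y {..<n}) \<ge> 0}" by blast
    finally show ?case .
  qed
  also have "{y \<in> ?Z. \<forall>q\<in>Q. q (restrict y {..<n}) \<ge> 0} =
      {y \<in> Y. (\<forall>p\<in>P. p (restrict y {..<n}) = 0) \<and> (\<forall>q\<in>Q. q (restrict y {..<n}) \<ge> 0)}" by blast
  finally show ?thesis .
qed

text \<open>If every parameter is, up to a factor, a coordinate of some vertex, then reading off these
  coordinates is an analytic, indeed linear, inverse of the parametrization.\<close>

lemma realizable_imp_isomorphic:
  fixes I :: "nat set"
  assumes R: "realizable I U Y \<F>"
    and read: "\<And>i. i \<in> I \<Longrightarrow> \<exists>f\<in>\<F>. \<exists>c. (\<forall>y\<in>Y. y i = c * Re (f y)) \<or> (\<forall>y\<in>Y. y i = c * Im (f y))"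
  shows "\<exists>L :: nat linkage. cabled_linkage L \<and>
     analytically_isomorphic I Y (vertices L <+> vertices L) (real_configuration_space L)"
proof (rule realizableE[OF R])
  fix L :: "nat linkage" and G loc
  assume L: "cabled_linkage L" "finite (vertices L)" "parametrizes I U Y L G"
    and loc: "\<And>f. f \<in> \<F> \<Longrightarrow> loc f \<in> vertices L" "\<And>f y. f \<in> \<F> \<Longrightarrow> y \<in> U \<Longrightarrow> G (loc f) y = f y"
  note dom = realizable_domain[OF R]
  let ?V = "vertices L"
  let ?J = "?V <+> ?V"
  define F where "F y = real_coords ?V (\<lambda>v\<in>?V. G v y)" for y
  have F_Inl: "F y (Inl v) = Re (G v y)" and F_Inr: "F y (Inr v) = Im (G v y)" if "v \<in> ?V" for v y
    using that by (auto simp: F_def real_coords_def)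
  have image: "real_configuration_space L = F ` Y"
    using L(3) unfolding parametrizes_def real_configuration_space_def F_def by (simp add: image_image)
  have "\<exists>c s. s \<in> ?J \<and> (\<forall>y\<in>Y. y i = c * F y s)" if i: "i \<in> I" for i
  proof -
    obtain f c where f: "f \<in> \<F>" and "(\<forall>y\<in>Y. y i = c * Re (f y)) \<or> (\<forall>y\<in>Y. y i = c * Im (f y))"
      using read[OF i] by blast
    then show ?thesis
    proof (elim disjE)
      assume "\<forall>y\<in>Y. y i = c * Re (f y)"
      then have "\<forall>y\<in>Y. y i = c * F y (Inl (loc f))"
        using loc(1)[OF f] loc(2)[OF f] dom(5) by (auto simp: F_Inl subset_iff)
      then show ?thesis using loc(1)[OF f] by blast
    next
      assume "\<forall>y\<in>Y. y i = c * Im (f y)"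
      then have "\<forall>y\<in>Y. y i = c * F y (Inr (loc f))"
        using loc(1)[OF f] loc(2)[OF f] dom(5) by (auto simp: F_Inr subset_iff)
      then show ?thesis using loc(1)[OF f] by blast
    qed
  qed
  then obtain c s where s: "\<And>i. i \<in> I \<Longrightarrow> s i \<in> ?J" and cs: "\<And>i y. i \<in> I \<Longrightarrow> y \<in> Y \<Longrightarrow> y i = c i * F y (s i)"
    by metis
  define g where "g \<xi> = (\<lambda>i\<in>I. c i * \<xi> (s i))" for \<xi> :: "nat + nat \<Rightarrow> real"
  have gF: "g (F y) = y" if "y \<in> Y" for y
  proof
    fix i
    have "y \<in> extensional I" using that dom(3,5) by (auto simp: PiE_iff)
    then show "g (F y) i = y i" using cs[OF _ that, of i] by (auto simp: g_def extensional_def)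
  qed
  have J: "finite ?J" using L(2) by simp
  have "analytic_map I ?J U F"
    unfolding analytic_map_def
  proof (intro conjI ballI)
    show "openin (powertop_real I) U" by (rule dom)
    show "F \<in> U \<rightarrow> (?J \<rightarrow>\<^sub>E UNIV)" by (auto simp: F_def real_coords_def)
    fix a j assume a: "a \<in> U" and j: "j \<in> ?J"
    have an: "plane_analytic I U (G v)" if "v \<in> ?V" for v
      using L(3) that unfolding parametrizes_def by blast
    from j show "analytic_at I (\<lambda>x. F x j) a"
    proof
      fix v assume v: "v \<in> ?V" and j: "j = Inl v"
      show ?thesis unfolding j F_Inl[OF v] using an[OF v] a unfolding plane_analytic_def by blast
    next
      fix v assume v: "v \<in> ?V" and j: "j = Inr v"
      show ?thesis unfolding j F_Inr[OF v] using an[OF v] a unfolding plane_analytic_def by blast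
    qed
  qed
  then have rF: "restriction_of_analytic I ?J Y F"
    unfolding restriction_of_analytic_def using dom(5) by blast
  have "analytic_map ?J I (?J \<rightarrow>\<^sub>E UNIV) g"
    unfolding analytic_map_def
  proof (intro conjI ballI)
    show "openin (powertop_real ?J) (?J \<rightarrow>\<^sub>E UNIV)"
      using openin_topspace[of "powertop_real ?J"] by simp
    show "g \<in> (?J \<rightarrow>\<^sub>E UNIV) \<rightarrow> I \<rightarrow>\<^sub>E UNIV" by (auto simp: g_def)
    fix a i assume "i \<in> I"
    then show "analytic_at ?J (\<lambda>x. g x i) a"
      using analytic_at_cmult[OF analytic_at_coord[OF J s]] by (simp add: g_def)
  qed
  moreover have sub: "F ` Y \<subseteq> ?J \<rightarrow>\<^sub>E UNIV" by (auto simp: F_def real_coords_def)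
  ultimately have rg: "restriction_of_analytic ?J I (F ` Y) g"
    unfolding restriction_of_analytic_def by blast
  have "analytically_isomorphic I Y ?J (F ` Y)"
    by (rule analytically_isomorphicI[OF dom(1) J _ sub rF rg]) (use dom gF in auto)
  then show ?thesis using L(1) image by auto
qed

text \<open>The cube of size \<open>M\<close> contains \<open>X\<close>, so imposing the polynomial constraints of \<open>X\<close> on the first \<open>n\<close>
  parameters leaves exactly \<open>X \<times> \<real>\<^sup>2\<^sup>k\<close>. The open set of size \<open>2 * M\<close> around it is the domain of
  analyticity, which is why the inputs are kept below \<open>2 * \<rho>\<close>.\<close>

theorem compact_quasialgebraic_is_configuration_space:
  assumes X: "quasialgebraic {..<n} X" and compact: "compactin (powertop_real {..<n}) X"
  shows "\<exists>L :: nat linkage. cabled_linkage L \<and>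
     analytically_isomorphic {..<n + 2 * k} (times_Euclidean n X (2 * k))
       (vertices L <+> vertices L) (real_configuration_space L)"
proof -
  obtain P Q where PQ: "finite P" "finite Q" "\<forall>p\<in>P \<union> Q. polynomial_on {..<n} p"
    and X_eq: "X = {x \<in> {..<n} \<rightarrow>\<^sub>E UNIV. (\<forall>p\<in>P. p x = 0) \<and> (\<forall>q\<in>Q. q x \<ge> 0)}"
    using X unfolding quasialgebraic_def by blast
  have "\<exists>M. \<forall>x\<in>X. \<bar>x i\<bar> \<le> M" if "i < n" for i
  proof -
    have "compactin euclideanreal ((\<lambda>x. x i) ` X)"
      using that by (intro image_compactin[OF compact] continuous_map_product_projection) auto
    then have "bounded ((\<lambda>x. x i) ` X)" by (simp add: compact_imp_bounded)
    then show ?thesis by (auto simp: bounded_iff)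
  qed
  then obtain m where m: "\<And>i x. i < n \<Longrightarrow> x \<in> X \<Longrightarrow> \<bar>x i\<bar> \<le> m i" by metis
  define M where "M = Max (insert 1 (m ` {..<n}))"
  have M: "M > 0" "\<And>i. i < n \<Longrightarrow> m i \<le> M" by (auto simp: M_def Max_gr_iff)
  obtain \<eta> where \<eta>: "0 < \<eta>" "\<eta> \<le> 1" and gates: "gate (\<lambda>q. fst q + snd q) (0, 0) \<eta>"
    "gate (\<lambda>q. fst q * snd q) (0, 0) \<eta>"
    by (rule arithmetic_gates)
  have "- \<i> \<noteq> \<i>" by (simp add: complex_eq_iff)
  moreover have "2 \<noteq> (cmod (\<i> - - \<i>))\<^sup>2"
  proof -
    have "\<i> - - \<i> = 2 * \<i>" by simp
    then have "cmod (\<i> - - \<i>) = 2" by (simp only: norm_mult norm_ii) simp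
    then show ?thesis by simp
  qed
  ultimately obtain \<zeta> where \<zeta>: "\<zeta> > 0"
    "\<And>(I :: nat set) U Y \<F> f g. realizable I U Y \<F> \<Longrightarrow> f \<in> \<F> \<Longrightarrow> g \<in> \<F> \<Longrightarrow>
       \<forall>y\<in>U. cmod (f y - - \<i>) < \<zeta> \<and> cmod (g y - \<i>) < \<zeta> \<Longrightarrow>
       realizable I U Y (insert (\<lambda>y. inversion 2 (f y) (g y)) \<F>)"
    by (rule inversor) (rule that)
  \<comment> \<open>Small enough for the arithmetic gates and for the inversors that straighten the arcs.\<close>
  define \<rho> where "\<rho> = min \<eta> \<zeta> / 4"
  define \<epsilon> where "\<epsilon> = \<rho> / M"
  have \<rho>: "\<rho> > 0" "2 * \<rho> < \<eta>" "4 * \<rho> \<le> \<zeta>" using \<eta>(1) \<zeta>(1) by (auto simp: \<rho>_def)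
  have \<epsilon>: "\<epsilon> > 0" "\<epsilon> * M = \<rho>" using \<rho> M by (simp_all add: \<epsilon>_def)
  let ?I = "{..<n + 2 * k}"
  let ?U = "input_box n (2 * k) (2 * M)"
  let ?Y = "{y \<in> ?I \<rightarrow>\<^sub>E UNIV. \<forall>i<n. \<bar>y i\<bar> \<le> M}"
  let ?S = "(\<lambda>i y. stereo (\<epsilon> * y i)) ` {..<n}" and ?W = "free_point n ` {..<k}"
  let ?T = "\<lambda>j. (\<lambda>i y. complex_of_real (\<epsilon> * y i)) ` {..<j}"
  have small: "\<bar>\<epsilon> * y i\<bar> < 2 * \<rho>" if "y \<in> ?U" "i < n" for y i
  proof -
    have "\<epsilon> * \<bar>y i\<bar> < \<epsilon> * (2 * M)"
      using that \<epsilon>(1) by (intro mult_strict_left_mono) (auto simp: input_box_def)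
    moreover have "\<epsilon> * (2 * M) = 2 * \<rho>" using \<epsilon>(2) by simp
    ultimately show ?thesis using \<epsilon>(1) by (simp add: abs_mult)
  qed
  have near: "cmod (stereo (\<epsilon> * y i) - \<i>) < \<zeta>" if "y \<in> ?U" "i < n" for y i
  proof -
    let ?t = "\<epsilon> * y i"
    have "4 * ?t\<^sup>2 / (1 + ?t\<^sup>2) \<le> 4 * ?t\<^sup>2 / 1"
      by (intro divide_left_mono) (auto simp: add_pos_nonneg)
    then have "(cmod (stereo ?t - \<i>))\<^sup>2 \<le> (2 * \<bar>?t\<bar>)\<^sup>2"
      unfolding stereo_near_pole by (simp add: power_mult_distrib)
    then have "cmod (stereo ?t - \<i>) \<le> 2 * \<bar>?t\<bar>" by (rule power2_le_imp_le) simp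
    then show ?thesis using small[OF that] \<rho>(3) by linarith
  qed
  have R0: "realizable ?I ?U ?Y (?S \<union> ?W)"
    by (rule input_linkage_parametrized[OF \<rho>(1) \<epsilon>]) (use M in simp)
  have "realizable ?I ?U ?Y (?T j \<union> (?S \<union> ?W))" if "j \<le> n" for j
    using that
  proof (induction j)
    case 0 then show ?case using R0 by simp
  next
    case (Suc j)
    let ?F = "?T j \<union> (?S \<union> ?W)" and ?s = "\<lambda>y. stereo (\<epsilon> * y j)"
    have R1: "realizable ?I ?U ?Y (insert (\<lambda>_. - \<i>) ?F)"
      by (rule realizable_const) (use Suc in auto)
    have "realizable ?I ?U ?Y (insert (\<lambda>y. inversion 2 (- \<i>) (?s y)) (insert (\<lambda>_. - \<i>) ?F))"
      by (rule \<zeta>(2)[OF R1]) (use Suc \<zeta>(1) near in auto)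
    then show ?case
      unfolding inversion_stereo by (rule realizable_mono) (auto simp: lessThan_Suc)
  qed
  from this[OF order_refl] have R: "realizable ?I ?U ?Y (?T n \<union> ?W)"
    by (rule realizable_mono) auto
  have "small_inputs ?U (?T n \<union> ?W) \<eta> n (\<lambda>i y. \<epsilon> * y i)"
  proof
    show "\<bar>\<epsilon> * y i\<bar> < \<eta>" if "i < n" "y \<in> ?U" for i y
      using small[OF that(2,1)] \<rho>(2) by linarith
  qed (use \<eta> gates in auto)
  then have "realizable ?I ?U {y \<in> ?Y. (\<forall>p\<in>P. p (restrict y {..<n}) = 0) \<and>
      (\<forall>q\<in>Q. q (restrict y {..<n}) \<ge> 0)} (?T n \<union> ?W)"
    by (rule realizable_polynomial_constraints[OF _ \<epsilon>(1) R PQ])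
  also have "{y \<in> ?Y. (\<forall>p\<in>P. p (restrict y {..<n}) = 0) \<and> (\<forall>q\<in>Q. q (restrict y {..<n}) \<ge> 0)} =
      times_Euclidean n X (2 * k)"
  proof -
    have "\<bar>y i\<bar> \<le> M" if "restrict y {..<n} \<in> X" "i < n" for y i
      using m[OF that(2,1)] M(2)[OF that(2)] that(2) by simp
    then show ?thesis unfolding times_Euclidean_def X_eq by auto
  qed
  finally show ?thesis
  proof (rule realizable_imp_isomorphic)
    fix i assume i: "i \<in> ?I"
    show "\<exists>f\<in>?T n \<union> ?W. \<exists>c. (\<forall>y\<in>times_Euclidean n X (2 * k). y i = c * Re (f y)) \<or>
        (\<forall>y\<in>times_Euclidean n X (2 * k). y i = c * Im (f y))"
    proof (cases "i < n")
      case True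
      then have t: "(\<lambda>y. complex_of_real (\<epsilon> * y i)) \<in> ?T n \<union> ?W" by blast
      show ?thesis by (intro bexI[OF _ t] exI[of _ "1 / \<epsilon>"]) (use \<epsilon>(1) in simp)
    next
      case False
      let ?j = "(i - n) div 2"
      have j: "free_point n ?j \<in> ?T n \<union> ?W" using i False by auto
      show ?thesis
      proof (cases "even (i - n)")
        case True
        then have "n + 2 * ?j = i" using False by auto
        then show ?thesis by (intro bexI[OF _ j] exI[of _ 1]) (simp add: free_point_def)
      next
        case odd: False
        then have "n + 2 * ?j + 1 = i" using False by (metis add_Suc_right le_add_diff_inverse not_less odd_two_times_div_two_succ Suc_eq_plus1)
        then show ?thesis by (intro bexI[OF _ j] exI[of _ 1]) (simp add: free_point_def)
      qed
    qed
  qed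
qed

section \<open>The connected components of a linkage\<close>

text \<open>A component is an equivalence class of \<open>adj\<^sup>*\<close>. A vertex is \<open>free\<close> if its component has no fixed
  vertex, and \<open>rep\<close> chooses one vertex in every component.\<close>

locale linkage_components =
  fixes L :: "'v linkage"
  assumes L: "cabled_linkage L"
begin

abbreviation "V \<equiv> vertices L"

definition adj :: "('v \<times> 'v) set" where
  "adj = {(v, w). {v, w} \<in> edges L}"

definition rep :: "'v \<Rightarrow> 'v" where
  "rep v = (SOME u. (v, u) \<in> adj\<^sup>*)"

definition free :: "'v \<Rightarrow> bool" where
  "free v \<longleftrightarrow> (\<forall>u\<in>fixed L. (v, u) \<notin> adj\<^sup>*)"

definition base_points :: "'v set" where
  "base_points = {v \<in> V. free v \<and> rep v = v}"

lemma finite_V: "finite V" and fixed_subset: "fixed L \<subseteq> V" and flexible_subset: "flexible L \<subseteq> edges L"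
  using L by (auto simp: cabled_linkage_def)

lemma edge_vertices: "{v, w} \<in> edges L \<Longrightarrow> v \<in> V \<and> w \<in> V"
  using L unfolding cabled_linkage_def by (metis insert_subset)

lemma adj_sym: "sym (adj\<^sup>*)"
  by (rule sym_rtrancl) (auto simp: sym_def adj_def insert_commute)

lemma connected_eq: "(v, w) \<in> adj\<^sup>* \<Longrightarrow> (v, u) \<in> adj\<^sup>* \<longleftrightarrow> (w, u) \<in> adj\<^sup>*"
  using adj_sym by (meson rtrancl_trans symD)

lemma rep_connected: "(v, rep v) \<in> adj\<^sup>*"
  unfolding rep_def by (rule someI[of _ v]) simp

lemma rep_cong: "(v, w) \<in> adj\<^sup>* \<Longrightarrow> rep v = rep w"
  unfolding rep_def using connected_eq[of v w] by simp

lemma free_cong: "(v, w) \<in> adj\<^sup>* \<Longrightarrow> free v = free w"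
  unfolding free_def using connected_eq[of v w] by simp

lemma connected_in_V: "(v, w) \<in> adj\<^sup>* \<Longrightarrow> v \<in> V \<Longrightarrow> w \<in> V"
  by (induction rule: rtrancl_induct) (auto simp: adj_def dest: edge_vertices)

lemma rep_base_point: "v \<in> V \<Longrightarrow> free v \<Longrightarrow> rep v \<in> base_points"
  using rep_connected[of v] rep_cong[of v "rep v"] free_cong[of v "rep v"] connected_in_V
  by (auto simp: base_points_def)

lemma configuration_space_translate:
  assumes \<phi>: "\<phi> \<in> configuration_space L"
    and c: "\<And>v w. {v, w} \<in> edges L \<Longrightarrow> c v = c w" "\<And>v. v \<in> fixed L \<Longrightarrow> c v = 0"
  shows "(\<lambda>v\<in>V. \<phi> v + c v) \<in> configuration_space L"
proof -
  let ?\<psi> = "\<lambda>v\<in>V. \<phi> v + c v"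
  have diff: "?\<psi> v - ?\<psi> w = \<phi> v - \<phi> w" if "{v, w} \<in> edges L" for v w
    using edge_vertices[OF that] c(1)[OF that] by simp
  have "?\<psi> v = \<phi> v" if "v \<in> fixed L" for v using that fixed_subset c(2) by auto
  then show ?thesis
    using \<phi> diff flexible_subset unfolding configuration_space_def by (auto simp: subset_iff)
qed

definition normalized :: "('v \<Rightarrow> complex) set" where
  "normalized = {\<phi> \<in> configuration_space L. \<forall>u\<in>base_points. \<phi> u = 0}"

lemma edge_bound:
  assumes "\<phi> \<in> configuration_space L" "{v, w} \<in> edges L"
  shows "cmod (\<phi> v - \<phi> w) \<le> edge_length L {v, w}"
  using assms unfolding configuration_space_def by (cases "{v, w} \<in> flexible L") auto

text \<open>Every component contains a vertex whose position is prescribed, either by \<open>fixed\<close> or by the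
  normalization, and edges bound the distance of neighbours.\<close>

lemma normalized_bounded:
  assumes "v \<in> V"
  shows "\<exists>B. \<forall>\<phi>\<in>normalized. cmod (\<phi> v) \<le> B"
proof -
  have spread: "\<exists>B. \<forall>\<phi>\<in>normalized. cmod (\<phi> w) \<le> B"
    if "(u, w) \<in> adj\<^sup>*" "\<exists>B. \<forall>\<phi>\<in>normalized. cmod (\<phi> u) \<le> B" for u w
    using that
  proof (induction rule: rtrancl_induct)
    case (step x y)
    then obtain B where B: "\<forall>\<phi>\<in>normalized. cmod (\<phi> x) \<le> B" by blast
    have xy: "{y, x} \<in> edges L" using step(2) by (simp add: adj_def insert_commute)
    have "cmod (\<phi> y) \<le> B + edge_length L {y, x}" if "\<phi> \<in> normalized" for \<phi>
    proof -
      have "cmod (\<phi> y - \<phi> x) \<le> edge_length L {y, x}"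
        using edge_bound[OF _ xy] that by (simp add: normalized_def)
      moreover have "cmod (\<phi> x) \<le> B" using B that by blast
      moreover have "cmod (\<phi> y) \<le> cmod (\<phi> y - \<phi> x) + cmod (\<phi> x)" using norm_triangle_ineq[of "\<phi> y - \<phi> x" "\<phi> x"] by simp
      ultimately show ?thesis by linarith
    qed
    then show ?case by blast
  qed
  show ?thesis
  proof (cases "free v")
    case True
    have "(rep v, v) \<in> adj\<^sup>*" using rep_connected adj_sym by (meson symD)
    moreover have "\<forall>\<phi>\<in>normalized. cmod (\<phi> (rep v)) \<le> 0"
      using rep_base_point[OF assms True] by (simp add: normalized_def)
    ultimately show ?thesis using spread by blast
  next
    case False
    then obtain u where u: "u \<in> fixed L" "(u, v) \<in> adj\<^sup>*"
      unfolding free_def using adj_sym by (meson symD)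
    then have "\<forall>\<phi>\<in>normalized. cmod (\<phi> u) \<le> cmod (position L u)"
      by (simp add: normalized_def configuration_space_def)
    then show ?thesis using spread[OF u(2)] by blast
  qed
qed

text \<open>A configuration from its \<open>n\<close> real coordinates, numbered by \<open>e\<close>.\<close>

definition decode :: "('v + 'v \<Rightarrow> nat) \<Rightarrow> (nat \<Rightarrow> real) \<Rightarrow> 'v \<Rightarrow> complex" where
  "decode e x = (\<lambda>v\<in>V. Complex (x (e (Inl v))) (x (e (Inr v))))"

lemma normalized_quasialgebraic:
  assumes e: "bij_betw e (V <+> V) {..<n}"
  shows "quasialgebraic {..<n} {x \<in> {..<n} \<rightarrow>\<^sub>E UNIV. decode e x \<in> normalized}"
proof -
  let ?I = "{..<n}"
  define re where "re v x = (x (e (Inl v)) :: real)" for v x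
  define im where "im v x = (x (e (Inr v)) :: real)" for v x
  \<comment> \<open>Squaring is harmless as edge lengths are positive, and makes the distance conditions polynomial.\<close>
  define gap where "gap v w x = edge_length L {v, w} ^ 2 - ((re v x - re w x) * (re v x - re w x) +
      (im v x - im w x) * (im v x - im w x))" for v w x
  define P where "P = (\<lambda>v x. re v x - Re (position L v)) ` fixed L \<union> (\<lambda>v x. im v x - Im (position L v)) ` fixed L \<union>
     re ` base_points \<union> im ` base_points \<union>
     (\<lambda>(v, w). gap v w) ` {(v, w) \<in> V \<times> V. {v, w} \<in> edges L - flexible L}"
  define Q where "Q = (\<lambda>(v, w). gap v w) ` {(v, w) \<in> V \<times> V. {v, w} \<in> flexible L}"
  have base: "base_points \<subseteq> V" by (auto simp: base_points_def)
  have pairs: "finite {(v, w) \<in> V \<times> V. R v w}" for R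
    by (rule finite_subset[of _ "V \<times> V"]) (auto simp: finite_V)
  have finP: "finite P"
    unfolding P_def
    by (intro finite_UnI finite_imageI pairs finite_subset[OF fixed_subset finite_V] finite_subset[OF base finite_V])
  have finQ: "finite Q"
    unfolding Q_def by (intro finite_imageI pairs)
  have poly: "polynomial_on ?I (re v)" "polynomial_on ?I (im v)" if "v \<in> V" for v
  proof -
    have "e (Inl v) \<in> ?I" "e (Inr v) \<in> ?I" using e that by (auto simp: bij_betw_def)
    then show "polynomial_on ?I (re v)" "polynomial_on ?I (im v)"
      unfolding re_def im_def by (auto intro: polynomial_on_coord)
  qed
  then have gap: "polynomial_on ?I (gap v w)" if "v \<in> V" "w \<in> V" for v w
    unfolding gap_def using that
    by (intro polynomial_on_diff polynomial_on_add polynomial_on_mult polynomial_on_const) auto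
  have polys: "\<forall>p\<in>P \<union> Q. polynomial_on ?I p"
  proof
    fix p assume "p \<in> P \<union> Q"
    then show "polynomial_on ?I p"
      unfolding P_def Q_def using fixed_subset base poly gap
      by (auto intro!: polynomial_on_diff polynomial_on_const)
  qed
  have iff: "decode e x \<in> normalized \<longleftrightarrow> (\<forall>p\<in>P. p x = 0) \<and> (\<forall>q\<in>Q. q x \<ge> 0)" for x
  proof -
    let ?\<phi> = "decode e x"
    have \<phi>: "?\<phi> v = Complex (re v x) (im v x)" if "v \<in> V" for v
      using that by (simp add: decode_def re_def im_def)
    have gap_eq: "gap v w x = edge_length L {v, w} ^ 2 - (cmod (?\<phi> v - ?\<phi> w))\<^sup>2" if "v \<in> V" "w \<in> V" for v w
      unfolding gap_def \<phi>[OF that(1)] \<phi>[OF that(2)] cmod_power2 minus_complex.sel complex.sel by (simp only: power2_eq_square)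
    have pos: "edge_length L {v, w} > 0" if "{v, w} \<in> edges L" for v w
      using L that unfolding cabled_linkage_def by blast
    have eq: "cmod (?\<phi> v - ?\<phi> w) = edge_length L {v, w} \<longleftrightarrow> gap v w x = 0"
      and le: "cmod (?\<phi> v - ?\<phi> w) \<le> edge_length L {v, w} \<longleftrightarrow> gap v w x \<ge> 0"
      if "{v, w} \<in> edges L" for v w
    proof -
      have "v \<in> V" "w \<in> V" using edge_vertices[OF that] by auto
      note g = gap_eq[OF this]
      show "cmod (?\<phi> v - ?\<phi> w) = edge_length L {v, w} \<longleftrightarrow> gap v w x = 0"
        unfolding g using pos[OF that] by (auto simp: power2_eq_iff_nonneg)
      show "cmod (?\<phi> v - ?\<phi> w) \<le> edge_length L {v, w} \<longleftrightarrow> gap v w x \<ge> 0"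
        unfolding g using pos[OF that] abs_le_square_iff[of "cmod (?\<phi> v - ?\<phi> w)" "edge_length L {v, w}"] by simp
    qed
    have "?\<phi> \<in> V \<rightarrow>\<^sub>E UNIV" by (simp add: decode_def)
    moreover have "(\<forall>v\<in>fixed L. ?\<phi> v = position L v) \<longleftrightarrow>
        (\<forall>v\<in>fixed L. re v x - Re (position L v) = 0 \<and> im v x - Im (position L v) = 0)"
      using \<phi> fixed_subset by (auto simp: complex_eq_iff subset_iff)
    moreover have "(\<forall>v\<in>base_points. ?\<phi> v = 0) \<longleftrightarrow> (\<forall>v\<in>base_points. re v x = 0 \<and> im v x = 0)"
      using \<phi> base by (auto simp: complex_eq_iff subset_iff)
    moreover have "(\<forall>v w. {v, w} \<in> flexible L \<longrightarrow> cmod (?\<phi> v - ?\<phi> w) \<le> edge_length L {v, w}) \<longleftrightarrow>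
        (\<forall>q\<in>Q. q x \<ge> 0)"
      unfolding Q_def using le flexible_subset edge_vertices by (auto simp: subset_iff)
    moreover have "(\<forall>v w. {v, w} \<in> edges L - flexible L \<longrightarrow> cmod (?\<phi> v - ?\<phi> w) = edge_length L {v, w}) \<longleftrightarrow>
        (\<forall>p\<in>(\<lambda>(v, w). gap v w) ` {(v, w) \<in> V \<times> V. {v, w} \<in> edges L - flexible L}. p x = 0)"
      using eq edge_vertices by auto
    moreover have "(\<forall>p\<in>P. p x = 0) \<longleftrightarrow>
        (\<forall>v\<in>fixed L. re v x - Re (position L v) = 0 \<and> im v x - Im (position L v) = 0) \<and>
        (\<forall>v\<in>base_points. re v x = 0 \<and> im v x = 0) \<and>
        (\<forall>p\<in>(\<lambda>(v, w). gap v w) ` {(v, w) \<in> V \<times> V. {v, w} \<in> edges L - flexible L}. p x = 0)"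
      unfolding P_def ball_Un by (simp only: ball_simps) blast
    ultimately show ?thesis
      unfolding normalized_def configuration_space_def mem_Collect_eq by argo
  qed
  show ?thesis
    unfolding quasialgebraic_def iff using finP finQ polys by blast
qed

lemma normalized_compactin:
  assumes e: "bij_betw e (V <+> V) {..<n}"
  shows "compactin (powertop_real {..<n}) {x \<in> {..<n} \<rightarrow>\<^sub>E UNIV. decode e x \<in> normalized}"
proof -
  have "\<exists>B. \<forall>x. decode e x \<in> normalized \<longrightarrow> \<bar>x i\<bar> \<le> B" if "i < n" for i
  proof -
    obtain s where s: "s \<in> V <+> V" "i = e s" using e \<open>i < n\<close> by (metis bij_betw_def imageE lessThan_iff)
    have *: "\<exists>B. \<forall>x. decode e x \<in> normalized \<longrightarrow> \<bar>x (e (Inl v))\<bar> \<le> B \<and> \<bar>x (e (Inr v))\<bar> \<le> B" if v: "v \<in> V" for v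
    proof -
      obtain B where B: "\<forall>\<phi>\<in>normalized. cmod (\<phi> v) \<le> B" using normalized_bounded[OF v] by blast
      have "\<bar>x (e (Inl v))\<bar> \<le> B \<and> \<bar>x (e (Inr v))\<bar> \<le> B" if "decode e x \<in> normalized" for x
      proof -
        have "cmod (Complex (x (e (Inl v))) (x (e (Inr v)))) \<le> B"
          using B that v by (force simp: decode_def)
        then show ?thesis
          using abs_Re_le_cmod[of "Complex (x (e (Inl v))) (x (e (Inr v)))"]
            abs_Im_le_cmod[of "Complex (x (e (Inl v))) (x (e (Inr v)))"] by simp
      qed
      then show ?thesis by blast
    qed
    from s(1) show ?thesis using *  unfolding s(2) by (elim PlusE) (simp, blast)+
  qed
  then obtain B where "\<And>i x. i < n \<Longrightarrow> decode e x \<in> normalized \<Longrightarrow> \<bar>x i\<bar> \<le> B i" by metis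
  then show ?thesis
    by (intro quasialgebraic_bounded_compactin[where B = B] normalized_quasialgebraic[OF e]) auto
qed

lemma real_coords_eq:
  assumes "v \<in> V"
  shows "real_coords V \<phi> (Inl v) = Re (\<phi> v)" "real_coords V \<phi> (Inr v) = Im (\<phi> v)"
  using assms by (auto simp: real_coords_def)

lemma rep_rep: "rep (rep v) = rep v"
  using rep_cong[OF rep_connected] by metis

lemma base_points_V: "u \<in> base_points \<Longrightarrow> u \<in> V"
  and base_points_free: "u \<in> base_points \<Longrightarrow> free u"
  and base_points_rep: "u \<in> base_points \<Longrightarrow> rep u = u"
  by (auto simp: base_points_def)

lemma translation_admissible:
  assumes "{v, w} \<in> edges L"
  shows "free v = free w" "rep v = rep w"
proof -
  have "(v, w) \<in> adj\<^sup>*" using assms by (auto simp: adj_def)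
  then show "free v = free w" "rep v = rep w" by (rule free_cong, rule rep_cong)
qed

lemma fixed_not_free: "v \<in> fixed L \<Longrightarrow> \<not> free v"
  unfolding free_def by blast

text \<open>Subtracting the position of the representative from every vertex of a free component, and
  recording the representatives separately, has an obvious inverse; both maps are linear.\<close>

theorem analytically_isomorphic_normalized:
  assumes e: "bij_betw e (V <+> V) {..<n}" and r: "bij_betw r base_points {..<k}"
  shows "analytically_isomorphic (V <+> V) (real_configuration_space L) {..<n + 2 * k}
     (times_Euclidean n {x \<in> {..<n} \<rightarrow>\<^sub>E UNIV. decode e x \<in> normalized} (2 * k))"
proof -
  let ?J = "V <+> V" and ?I = "{..<n + 2 * k}"
  let ?X = "{x \<in> {..<n} \<rightarrow>\<^sub>E UNIV. decode e x \<in> normalized}"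
  let ?Z = "times_Euclidean n ?X (2 * k)"
  have J: "finite ?J" using finite_V by simp
  have e_less: "e s < n" if "s \<in> ?J" for s using e that by (auto simp: bij_betw_def)
  have r_less: "r u < k" if "u \<in> base_points" for u using r that by (auto simp: bij_betw_def)
  have index_cases: thesis
    if "i \<in> ?I" "\<And>v. v \<in> V \<Longrightarrow> i = e (Inl v) \<Longrightarrow> thesis" "\<And>v. v \<in> V \<Longrightarrow> i = e (Inr v) \<Longrightarrow> thesis"
      "\<And>u. u \<in> base_points \<Longrightarrow> i = n + 2 * r u \<Longrightarrow> thesis"
      "\<And>u. u \<in> base_points \<Longrightarrow> i = n + 2 * r u + 1 \<Longrightarrow> thesis" for i thesis
  proof (cases "i < n")
    case True
    then obtain s where "s \<in> ?J" "i = e s" using e by (metis bij_betw_def imageE lessThan_iff)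
    then show thesis using that(2,3) by blast
  next
    case False
    define j where "j = (i - n) div 2"
    have "j < k" using that(1) False by (auto simp: j_def)
    then obtain u where u: "u \<in> base_points" "j = r u" using r by (metis bij_betw_def imageE lessThan_iff)
    have "i = n + 2 * j \<or> i = n + 2 * j + 1" using False unfolding j_def by presburger
    then show thesis using that(4,5) u by blast
  qed
  define inv_e where "inv_e = inv_into ?J e"
  define inv_r where "inv_r = inv_into base_points r"
  have inv_e: "inv_e (e s) = s" if "s \<in> ?J" for s
    using e that by (simp add: inv_e_def bij_betw_def)
  have inv_r: "inv_r (r u) = u" if "u \<in> base_points" for u
    using r that by (simp add: inv_r_def bij_betw_def)
  define f where "f \<xi> = (\<lambda>i\<in>?I.
      if i < n then (case inv_e i of
          Inl v \<Rightarrow> \<xi> (Inl v) - (if free v then \<xi> (Inl (rep v)) else 0)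
        | Inr v \<Rightarrow> \<xi> (Inr v) - (if free v then \<xi> (Inr (rep v)) else 0))
      else if even (i - n) then \<xi> (Inl (inv_r ((i - n) div 2))) else \<xi> (Inr (inv_r ((i - n) div 2))))"
    for \<xi> :: "'v + 'v \<Rightarrow> real"
  define g where "g z = (\<lambda>s\<in>?J. case s of
        Inl v \<Rightarrow> z (e (Inl v)) + (if free v then z (n + 2 * r (rep v)) else 0)
      | Inr v \<Rightarrow> z (e (Inr v)) + (if free v then z (n + 2 * r (rep v) + 1) else 0))"
    for z :: "nat \<Rightarrow> real"
  have f_e: "f \<xi> (e (Inl v)) = \<xi> (Inl v) - (if free v then \<xi> (Inl (rep v)) else 0)"
    "f \<xi> (e (Inr v)) = \<xi> (Inr v) - (if free v then \<xi> (Inr (rep v)) else 0)" if "v \<in> V" for v \<xi>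
    using e_less[OF InlI[OF that]] e_less[OF InrI[OF that]] inv_e[OF InlI[OF that]] inv_e[OF InrI[OF that]]
    by (simp_all add: f_def)
  have f_r: "f \<xi> (n + 2 * r u) = \<xi> (Inl u)" "f \<xi> (n + 2 * r u + 1) = \<xi> (Inr u)" if "u \<in> base_points" for u \<xi>
    using r_less[OF that] inv_r[OF that] by (auto simp: f_def)
  have f_ext: "f \<xi> \<in> ?I \<rightarrow>\<^sub>E UNIV" for \<xi> by (simp add: f_def)
  have g_Inl: "g z (Inl v) = z (e (Inl v)) + (if free v then z (n + 2 * r (rep v)) else 0)"
    and g_Inr: "g z (Inr v) = z (e (Inr v)) + (if free v then z (n + 2 * r (rep v) + 1) else 0)"
    if "v \<in> V" for v z
    using that by (auto simp: g_def)
  have g_ext: "g z \<in> ?J \<rightarrow>\<^sub>E UNIV" for z by (simp add: g_def)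
  have rep_V: "rep v \<in> V" if "v \<in> V" for v using connected_in_V[OF rep_connected that] .
  have opens: "openin (powertop_real A) (A \<rightarrow>\<^sub>E UNIV)" for A :: "'b set"
    using openin_topspace[of "powertop_real A"] by simp
  have coord: "analytic_at ?J (\<lambda>\<xi>. \<xi> (Inl v)) a" "analytic_at ?J (\<lambda>\<xi>. \<xi> (Inr v)) a" if "v \<in> V" for v a
    using that by (auto intro: analytic_at_coord[OF J])
  have "analytic_map ?J ?I (?J \<rightarrow>\<^sub>E UNIV) f"
    unfolding analytic_map_def
  proof (intro conjI ballI opens)
    show "f \<in> (?J \<rightarrow>\<^sub>E UNIV) \<rightarrow> ?I \<rightarrow>\<^sub>E UNIV" using f_ext by blast
    fix a i assume "i \<in> ?I"
    then show "analytic_at ?J (\<lambda>\<xi>. f \<xi> i) a"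
    proof (rule index_cases)
      fix v assume v: "v \<in> V" and i: "i = e (Inl v)"
      show ?thesis unfolding i f_e[OF v]
        by (cases "free v") (simp_all add: analytic_at_diff coord v rep_V)
    next
      fix v assume v: "v \<in> V" and i: "i = e (Inr v)"
      show ?thesis unfolding i f_e[OF v]
        by (cases "free v") (simp_all add: analytic_at_diff coord v rep_V)
    next
      fix u assume u: "u \<in> base_points" and i: "i = n + 2 * r u"
      show ?thesis unfolding i f_r[OF u] by (rule coord[OF base_points_V[OF u]])
    next
      fix u assume u: "u \<in> base_points" and i: "i = n + 2 * r u + 1"
      show ?thesis unfolding i f_r[OF u] by (rule coord[OF base_points_V[OF u]])
    qed
  qed
  moreover have sub: "real_configuration_space L \<subseteq> ?J \<rightarrow>\<^sub>E UNIV"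
    by (auto simp: real_configuration_space_def real_coords_def)
  ultimately have rf: "restriction_of_analytic ?J ?I (real_configuration_space L) f"
    unfolding restriction_of_analytic_def by blast
  have "analytic_map ?I ?J (?I \<rightarrow>\<^sub>E UNIV) g"
    unfolding analytic_map_def
  proof (intro conjI ballI opens)
    show "g \<in> (?I \<rightarrow>\<^sub>E UNIV) \<rightarrow> ?J \<rightarrow>\<^sub>E UNIV" using g_ext by blast
    fix a s assume s: "s \<in> ?J"
    have c: "analytic_at ?I (\<lambda>z. z i) a" if "i < n + 2 * k" for i
      using that by (intro analytic_at_coord) auto
    from s show "analytic_at ?I (\<lambda>z. g z s) a"
    proof
      fix v assume v: "v \<in> V" and s: "s = Inl v"
      have "e (Inl v) < n + 2 * k" using e_less[OF InlI[OF v]] by simp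
      moreover have "n + 2 * r (rep v) < n + 2 * k" if "free v"
        using r_less[OF rep_base_point[OF v that]] by simp
      ultimately show ?thesis unfolding s g_Inl[OF v]
        by (cases "free v") (simp_all add: analytic_at_add c)
    next
      fix v assume v: "v \<in> V" and s: "s = Inr v"
      have "e (Inr v) < n + 2 * k" using e_less[OF InrI[OF v]] by simp
      moreover have "n + 2 * r (rep v) + 1 < n + 2 * k" if "free v"
        using r_less[OF rep_base_point[OF v that]] by simp
      ultimately show ?thesis unfolding s g_Inr[OF v]
        by (cases "free v") (simp_all add: analytic_at_add c)
    qed
  qed
  moreover have subZ: "?Z \<subseteq> ?I \<rightarrow>\<^sub>E UNIV" by (auto simp: times_Euclidean_def)
  ultimately have rg: "restriction_of_analytic ?I ?J ?Z g"
    unfolding restriction_of_analytic_def by blast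
  have forward: "f \<xi> \<in> ?Z \<and> g (f \<xi>) = \<xi>" if conf: "\<xi> \<in> real_configuration_space L" for \<xi>
  proof -
    obtain \<phi> where \<phi>: "\<phi> \<in> configuration_space L" and \<xi>: "\<xi> = real_coords V \<phi>"
      using conf unfolding real_configuration_space_def by blast
    note \<xi>_eq = real_coords_eq[where \<phi> = \<phi>, folded \<xi>]
    let ?c = "\<lambda>v. if free v then - \<phi> (rep v) else 0"
    let ?\<psi> = "\<lambda>v\<in>V. \<phi> v + ?c v"
    have "?\<psi> \<in> configuration_space L"
      by (rule configuration_space_translate[OF \<phi>]) (simp_all add: translation_admissible fixed_not_free)
    moreover have "?\<psi> u = 0" if "u \<in> base_points" for u
      using base_points_V[OF that] base_points_free[OF that] base_points_rep[OF that] by simp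
    ultimately have \<psi>: "?\<psi> \<in> normalized" by (simp add: normalized_def)
    have "decode e (restrict (f \<xi>) {..<n}) = ?\<psi>"
    proof
      fix v
      show "decode e (restrict (f \<xi>) {..<n}) v = ?\<psi> v"
      proof (cases "v \<in> V")
        case True
        have "e (Inl v) < n" "e (Inr v) < n" using e_less[OF InlI[OF True]] e_less[OF InrI[OF True]] by auto
        then show ?thesis using True f_e[OF True] \<xi>_eq[OF True] \<xi>_eq[OF rep_V[OF True]]
          by (simp add: decode_def complex_eq_iff)
      qed (simp add: decode_def)
    qed
    then have "f \<xi> \<in> ?Z" using \<psi> f_ext by (simp add: times_Euclidean_def)
    moreover have "g (f \<xi>) = \<xi>"
    proof
      fix s
      consider v where "v \<in> V" "s = Inl v" | v where "v \<in> V" "s = Inr v" | "s \<notin> ?J" by (cases s) auto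
      then show "g (f \<xi>) s = \<xi> s"
      proof cases
        case 1
        then show ?thesis using g_Inl[OF 1(1)] f_e[OF 1(1)] f_r rep_base_point[OF 1(1)] by simp
      next
        case 2
        then show ?thesis using g_Inr[OF 2(1)] f_e[OF 2(1)] f_r rep_base_point[OF 2(1)] by simp
      next
        case 3
        then show ?thesis by (simp add: g_def \<xi> real_coords_def)
      qed
    qed
    ultimately show ?thesis by blast
  qed
  have backward: "g z \<in> real_configuration_space L \<and> f (g z) = z" if z: "z \<in> ?Z" for z
  proof -
    let ?\<psi> = "decode e (restrict z {..<n})"
    have \<psi>: "?\<psi> \<in> normalized" and z_ext: "z \<in> ?I \<rightarrow>\<^sub>E UNIV" using z by (auto simp: times_Euclidean_def)
    have \<psi>_eq: "?\<psi> v = Complex (z (e (Inl v))) (z (e (Inr v)))" if "v \<in> V" for v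
      using that e_less[OF InlI[OF that]] e_less[OF InrI[OF that]] by (simp add: decode_def)
    let ?c = "\<lambda>v. if free v then Complex (z (n + 2 * r (rep v))) (z (n + 2 * r (rep v) + 1)) else 0"
    let ?\<phi> = "\<lambda>v\<in>V. ?\<psi> v + ?c v"
    have "?\<phi> \<in> configuration_space L"
      by (rule configuration_space_translate)
        (use \<psi> in \<open>simp_all add: normalized_def translation_admissible fixed_not_free\<close>)
    moreover have "g z = real_coords V ?\<phi>"
    proof
      fix s
      consider v where "v \<in> V" "s = Inl v" | v where "v \<in> V" "s = Inr v" | "s \<notin> ?J" by (cases s) auto
      then show "g z s = real_coords V ?\<phi> s"
      proof cases
        case 1
        then show ?thesis by (simp add: g_Inl real_coords_eq \<psi>_eq)
      next
        case 2
        then show ?thesis by (simp add: g_Inr real_coords_eq \<psi>_eq)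
      next
        case 3
        then show ?thesis by (simp add: g_def real_coords_def)
      qed
    qed
    ultimately have "g z \<in> real_configuration_space L" by (simp add: real_configuration_space_def)
    moreover have "f (g z) = z"
    proof
      fix i
      have zero: "z (e (Inl u)) = 0" "z (e (Inr u)) = 0" if "u \<in> base_points" for u
        using \<psi> \<psi>_eq[OF base_points_V[OF that]] that by (auto simp: normalized_def complex_eq_iff)
      show "f (g z) i = z i"
      proof (cases "i \<in> ?I")
        case True
        then show ?thesis
          by (rule index_cases)
             (simp_all add: f_e f_r[simplified] g_Inl g_Inr rep_V rep_rep zero rep_base_point
                base_points_V base_points_free base_points_rep)
      next
        case False
        then show ?thesis using z_ext f_ext[of "g z"] by (auto simp: PiE_iff extensional_def)
      qed
    qed
    ultimately show ?thesis by blast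
  qed
  show ?thesis
    by (rule analytically_isomorphicI[OF J _ sub subZ rf rg forward backward]) simp_all
qed

theorem configuration_space_is_compact_times_Euclidean:
  "\<exists>n X k. quasialgebraic {..<n} X \<and> compactin (powertop_real {..<n}) X \<and>
     analytically_isomorphic (V <+> V) (real_configuration_space L)
       {..<n + 2 * k} (times_Euclidean n X (2 * k))"
proof -
  have "finite (V <+> V)" "finite base_points"
    using finite_V finite_subset[OF _ finite_V, of base_points] base_points_V by auto
  then obtain e r where "bij_betw e (V <+> V) {..<card (V <+> V)}" "bij_betw r base_points {..<card base_points}"
    by (metis ex_bij_betw_finite_nat atLeast0LessThan)
  then show ?thesis
    using normalized_quasialgebraic normalized_compactin analytically_isomorphic_normalized by blast
qed

end

section \<open>The characterization\<close>

theorem corollary3p1: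
  shows "(\<forall>L :: 'v linkage. cabled_linkage L \<longrightarrow>
            (\<exists>n X k. quasialgebraic {..<n} X \<and> compactin (powertop_real {..<n}) X \<and>
               analytically_isomorphic
                 (vertices L <+> vertices L) (real_configuration_space L)
                 {..<n + 2 * k} (times_Euclidean n X (2 * k))))
       \<and> (\<forall>n X k. quasialgebraic {..<n} X \<and> compactin (powertop_real {..<n}) X \<longrightarrow>
            (\<exists>L :: nat linkage. cabled_linkage L \<and>
               analytically_isomorphic
                 {..<n + 2 * k} (times_Euclidean n X (2 * k))
                 (vertices L <+> vertices L) (real_configuration_space L)))"
  using linkage_components.configuration_space_is_compact_times_Euclidean[OF linkage_components.intro]
    compact_quasialgebraic_is_configuration_space by blast

end
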